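(* Let $k$ be a field and let $Q=\operatorname{Spec}(A)$ be an affine algebraic rack over $k$ with unit $e$, and let $\mathfrak{q}=\operatorname{Der}_k(A,k)$. When considered as a map $\operatorname{ad}\colon\mathfrak{q}\to\mathfrak{gl}(\mathfrak{q})$, the adjoint representation of $\mathfrak{q}$ is precisely the map $D\mapsto[D,\cdot]$; that is, $\operatorname{ad}_D(E)=[D,E]$ for all $D,E\in\mathfrak{q}$. Similarly, if the dual adjoint representation $\operatorname{ad}^{-1}$ is considered as a map $\mathfrak{q}\to\mathfrak{gl}(\mathfrak{q})$, then $\operatorname{ad}^{-1}_D(E)=\{E,D\}$ for all $D,E\in\mathfrak{q}$. In particular, $\mathfrak{q}$ is closed under $[\cdot,\cdot]$ and $\{\cdot,\cdot\}$.
   Context: Schemes are of finite type over $k$; $k$-algebras are finitely generated and commutative. A pointed rack is a set with an element $e$ and operations $\triangleright,\triangleright^{-1}$ such that $(x\triangleright y)\triangleright^{-1}x=y=x\triangleright(y\triangleright^{-1}x)$, $x\triangleright(y\triangleright z)=(x\triangleright y)\triangleright(x\triangleright z)$, $(x\triangleright^{-1}y)\triangleright^{-1}z=(x\triangleright^{-1}z)\triangleright^{-1}(y\triangleright^{-1}z)$, $e\triangleright x=x$, $x\triangleright e=e$. An affine algebraic rack is a pointed rack object in affine schemes over $k$: $Q=\operatorname{Spec}(A)$ with morphisms $\triangleright,\triangleright^{-1}\colon Q\times_kQ\to Q$, $e\colon\operatorname{Spec}(k)\to Q$ making $Q(R)$ a pointed rack for every $k$-algebra $R$. Set $\nabla=\triangleright^\sharp$,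 $\nabla^{-1}=(\triangleright^{-1})^\sharp\colon A\to A\otimes_kA$ and $\varepsilon=e^\sharp\colon A\to k$, the induced ring maps. $\mathfrak{q}=\operatorname{Der}_k(A,k)$ is the space of $k$-linear $D\colon A\to k$ with $D(fg)=D(f)\varepsilon(g)+\varepsilon(f)D(g)$, identified with the tangent space $T_eQ$. The brackets are the convolutions $[D,E]:=(D\otimes E)\circ\nabla$ and $\{D,E\}:=(D\otimes E)\circ\nabla^{-1}$, a priori $k$-linear maps $A\to k$. For a point $x\in Q$ (more generally, an $R$-point, after base change to $R$), $L_x$ is the automorphism $y\mapsto x\triangleright y$ of $Q$ with inverse $L_x^{-1}\colon y\mapsto y\triangleright^{-1}x$; both fix $e$. The tangent map of a morphism $\varphi$ fixing $e$ is $(d\varphi)_e(D)=D\circ\varphi^\sharp$. The adjoint representation of $Q$ is the morphism of schemes $\operatorname{Ad}\colon Q\to\operatorname{GL}(\mathfrak{q})$, $\operatorname{Ad}_x:=(dL_x)_e$, and the dual adjoint representation is $\operatorname{Ad}^{-1}\colon Q\to\operatorname{GL}(\mathfrak{q})$, $\operatorname{Ad}^{-1}_x:=(dL_x^{-1})_e$. Their derivatives at $e$ are $\operatorname{ad}:=(d\operatorname{Ad})_e$ and $\operatorname{ad}^{-1}:=(d\operatorname{Ad}^{-1})_e$, with $\operatorname{ad}_D:=\operatorname{ad}(D)$, etc. These take values in $T_{\mathrm{id}}\operatorname{GL}(\mathfrak{q})$, which is identified with $\mathfrak{gl}(\mathfrak{q})=\operatorname{End}(\mathfrak{q})$ via $T_{\mathrm{id}}\operatorname{GL}(\mathfrak{q})=\ker(\operatorname{GL}(\mathfrak{q})(k[\delta]/(\delta^2))\to\operatorname{GL}(\mathfrak{q})(k))$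 and $f\mapsto\mathrm{id}+\delta f$. *)

theory Defs
  imports "HOL-Algebra.Module" "HOL-Algebra.Subrings"
begin

section \<open>Linear maps, algebras and their homomorphisms\<close>

text \<open>
  Modules over \<open>K\<close> are records of type \<open>('k, 'm) module\<close>.  When such a record is only
  used as a module, its fields \<open>mult\<close> and \<open>one\<close> carry no meaning.  Maps between carriers are
  extensional, so that equality of maps is equality in HOL.
\<close>

definition lin_hom ::
  "('k, 'x) ring_scheme \<Rightarrow> ('k, 'm) module \<Rightarrow> ('k, 'n) module \<Rightarrow> ('m \<Rightarrow> 'n) set" where
  "lin_hom K M N = {h \<in> carrier M \<rightarrow>\<^sub>E carrier N.
     (\<forall>x\<in>carrier M. \<forall>y\<in>carrier M. h (x \<oplus>\<^bsub>M\<^esub> y) = h x \<oplus>\<^bsub>N\<^esub> h y) \<and>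
     (\<forall>c\<in>carrier K. \<forall>x\<in>carrier M. h (c \<odot>\<^bsub>M\<^esub> x) = c \<odot>\<^bsub>N\<^esub> h x)}"

definition alg_hom ::
  "('k, 'x) ring_scheme \<Rightarrow> ('k, 'm) module \<Rightarrow> ('k, 'n) module \<Rightarrow> ('m \<Rightarrow> 'n) set" where
  "alg_hom K A B = lin_hom K A B \<inter> ring_hom A B"

definition ground :: "('k, 'x) ring_scheme \<Rightarrow> ('k, 'k) module" where
  "ground K = \<lparr>carrier = carrier K, mult = mult K, one = one K, zero = zero K, add = add K,
     smult = mult K\<rparr>"

definition fin_gen_algebra :: "('k, 'x) ring_scheme \<Rightarrow> ('k, 'a) module \<Rightarrow> bool" where
  "fin_gen_algebra K A \<longleftrightarrow> algebra K A \<and>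
     (\<exists>S. finite S \<and> S \<subseteq> carrier A \<and>
        (\<forall>H. subring H A \<and> submodule H K A \<and> S \<subseteq> H \<longrightarrow> H = carrier A))"


section \<open>Tensor products and base change\<close>

text \<open>
  The module \<open>M \<otimes>\<^sub>K N\<close> is the free module on \<open>M \<times> N\<close> modulo the submodule generated by the
  bilinearity relations.
\<close>

definition free_mod ::
  "('k, 'x) ring_scheme \<Rightarrow> 'b set \<Rightarrow> ('k, 'b \<Rightarrow> 'k) module" where
  "free_mod K X = \<lparr>
     carrier = {f. (\<forall>p. f p \<in> carrier K) \<and> finite {p. f p \<noteq> \<zero>\<^bsub>K\<^esub>} \<and> {p. f p \<noteq> \<zero>\<^bsub>K\<^esub>} \<subseteq> X},
     mult = undefined, one = undefined,
     zero = (\<lambda>p. \<zero>\<^bsub>K\<^esub>), add = (\<lambda>f g p. f p \<oplus>\<^bsub>K\<^esub> g p), smult = (\<lambda>c f p. c \<otimes>\<^bsub>K\<^esub> f p)\<rparr>"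

definition basis_vec :: "('k, 'x) ring_scheme \<Rightarrow> 'b \<Rightarrow> 'b \<Rightarrow> 'k" where
  "basis_vec K p = (\<lambda>q. if q = p then \<one>\<^bsub>K\<^esub> else \<zero>\<^bsub>K\<^esub>)"

abbreviation free_prod ::
  "('k, 'x) ring_scheme \<Rightarrow> ('k, 'm) module \<Rightarrow> ('k, 'n) module \<Rightarrow> ('k, 'm \<times> 'n \<Rightarrow> 'k) module" where
  "free_prod K M N \<equiv> free_mod K (carrier M \<times> carrier N)"

definition bilinear_relations ::
  "('k, 'x) ring_scheme \<Rightarrow> ('k, 'm) module \<Rightarrow> ('k, 'n) module \<Rightarrow> ('m \<times> 'n \<Rightarrow> 'k) set" where
  "bilinear_relations K M N = (let F = free_prod K M N; b = (\<lambda>m n. basis_vec K (m, n)) in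
     {b (m \<oplus>\<^bsub>M\<^esub> m') n \<ominus>\<^bsub>F\<^esub> (b m n \<oplus>\<^bsub>F\<^esub> b m' n) | m m' n.
        m \<in> carrier M \<and> m' \<in> carrier M \<and> n \<in> carrier N} \<union>
     {b m (n \<oplus>\<^bsub>N\<^esub> n') \<ominus>\<^bsub>F\<^esub> (b m n \<oplus>\<^bsub>F\<^esub> b m n') | m n n'.
        m \<in> carrier M \<and> n \<in> carrier N \<and> n' \<in> carrier N} \<union>
     {b (c \<odot>\<^bsub>M\<^esub> m) n \<ominus>\<^bsub>F\<^esub> c \<odot>\<^bsub>F\<^esub> b m n | c m n.
        c \<in> carrier K \<and> m \<in> carrier M \<and> n \<in> carrier N} \<union>
     {b m (c \<odot>\<^bsub>N\<^esub> n) \<ominus>\<^bsub>F\<^esub> c \<odot>\<^bsub>F\<^esub> b m n | c m n.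
        c \<in> carrier K \<and> m \<in> carrier M \<and> n \<in> carrier N})"

definition bilinear_submodule ::
  "('k, 'x) ring_scheme \<Rightarrow> ('k, 'm) module \<Rightarrow> ('k, 'n) module \<Rightarrow> ('m \<times> 'n \<Rightarrow> 'k) set" where
  "bilinear_submodule K M N =
     \<Inter>{H. submodule H K (free_prod K M N) \<and> bilinear_relations K M N \<subseteq> H}"

definition tensor_mod ::
  "('k, 'x) ring_scheme \<Rightarrow> ('k, 'm) module \<Rightarrow> ('k, 'n) module \<Rightarrow>
   ('k, ('m \<times> 'n \<Rightarrow> 'k) set) module" where
  "tensor_mod K M N = (let F = free_prod K M N; H = bilinear_submodule K M N in \<lparr>
     carrier = a_rcosets\<^bsub>F\<^esub> H, mult = undefined, one = undefined,
     zero = H, add = (\<lambda>X Y. X <+>\<^bsub>F\<^esub> Y), smult = (\<lambda>c X. \<Union>x\<in>X. H +>\<^bsub>F\<^esub> (c \<odot>\<^bsub>F\<^esub> x))\<rparr>)"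

definition tens ::
  "('k, 'x) ring_scheme \<Rightarrow> ('k, 'm) module \<Rightarrow> ('k, 'n) module \<Rightarrow> 'm \<Rightarrow> 'n \<Rightarrow>
   ('m \<times> 'n \<Rightarrow> 'k) set" where
  "tens K M N m n = bilinear_submodule K M N +>\<^bsub>free_prod K M N\<^esub> basis_vec K (m, n)"

text \<open>The linear map \<open>M \<otimes>\<^sub>K N \<rightarrow> P\<close> with \<open>m \<otimes> n \<mapsto> \<beta> m n\<close>, for bilinear \<open>\<beta>\<close>.\<close>

definition tensor_lift ::
  "('k, 'x) ring_scheme \<Rightarrow> ('k, 'm) module \<Rightarrow> ('k, 'n) module \<Rightarrow> ('k, 'p) module \<Rightarrow>
   ('m \<Rightarrow> 'n \<Rightarrow> 'p) \<Rightarrow> ('m \<times> 'n \<Rightarrow> 'k) set \<Rightarrow> 'p" where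
  "tensor_lift K M N P \<beta> = (THE h. h \<in> lin_hom K (tensor_mod K M N) P \<and>
     (\<forall>m\<in>carrier M. \<forall>n\<in>carrier N. h (tens K M N m n) = \<beta> m n))"

text \<open>
  \<open>M \<otimes>\<^sub>K N\<close> with the product \<open>(m \<otimes> n)(m' \<otimes> n') = mm' \<otimes> nn'\<close>, which is meaningful when \<open>M\<close> and
  \<open>N\<close> are algebras.
\<close>

definition tensor_alg ::
  "('k, 'x) ring_scheme \<Rightarrow> ('k, 'm) module \<Rightarrow> ('k, 'n) module \<Rightarrow>
   ('k, ('m \<times> 'n \<Rightarrow> 'k) set) module" where
  "tensor_alg K M N = (tensor_mod K M N)\<lparr>
     mult := (\<lambda>X Y. tensor_lift K M N (tensor_mod K M N) (\<lambda>m n.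
        tensor_lift K M N (tensor_mod K M N)
          (\<lambda>m' n'. tens K M N (m \<otimes>\<^bsub>M\<^esub> m') (n \<otimes>\<^bsub>N\<^esub> n')) Y) X),
     one := tens K M N \<one>\<^bsub>M\<^esub> \<one>\<^bsub>N\<^esub>\<rparr>"

text \<open>
  The \<open>R\<close>-module \<open>M \<otimes>\<^sub>K R\<close> with \<open>r (m \<otimes> s) = m \<otimes> rs\<close>; it is an \<open>R\<close>-algebra when \<open>M\<close> is a
  \<open>K\<close>-algebra.
\<close>

definition base_change ::
  "('k, 'x) ring_scheme \<Rightarrow> ('k, 'm) module \<Rightarrow> ('k, 'r) module \<Rightarrow>
   ('r, ('m \<times> 'r \<Rightarrow> 'k) set) module" where
  "base_change K M R = (let T = tensor_alg K M R in \<lparr>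
     carrier = carrier T, mult = mult T, one = one T, zero = zero T, add = add T,
     smult = (\<lambda>r. tensor_lift K M R T (\<lambda>m s. tens K M R m (r \<otimes>\<^bsub>R\<^esub> s)))\<rparr>)"

text \<open>The \<open>R\<close>-linear map \<open>M \<otimes>\<^sub>K R \<rightarrow> P\<close> with \<open>m \<otimes> 1 \<mapsto> \<phi> m\<close>, for \<open>K\<close>-linear \<open>\<phi>\<close>.\<close>

definition base_lift ::
  "('k, 'x) ring_scheme \<Rightarrow> ('k, 'm) module \<Rightarrow> ('k, 'r) module \<Rightarrow> ('r, 'p) module \<Rightarrow>
   ('m \<Rightarrow> 'p) \<Rightarrow> ('m \<times> 'r \<Rightarrow> 'k) set \<Rightarrow> 'p" where
  "base_lift K M R P \<phi> = (THE h. h \<in> lin_hom R (base_change K M R) P \<and>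
     (\<forall>m\<in>carrier M. h (tens K M R m \<one>\<^bsub>R\<^esub>) = \<phi> m))"


section \<open>Affine algebraic racks\<close>

locale pointed_rack =
  fixes Q :: "'q set" and e :: 'q
    and rk :: "'q \<Rightarrow> 'q \<Rightarrow> 'q" (infix "\<triangleright>" 70)
    and rki :: "'q \<Rightarrow> 'q \<Rightarrow> 'q" (infix "\<triangleright>i" 70)
  assumes unit_closed: "e \<in> Q"
    and rk_closed: "\<lbrakk>x \<in> Q; y \<in> Q\<rbrakk> \<Longrightarrow> x \<triangleright> y \<in> Q"
    and rki_closed: "\<lbrakk>x \<in> Q; y \<in> Q\<rbrakk> \<Longrightarrow> x \<triangleright>i y \<in> Q"
    and rk_rki: "\<lbrakk>x \<in> Q; y \<in> Q\<rbrakk> \<Longrightarrow> (x \<triangleright> y) \<triangleright>i x = y"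
    and rki_rk: "\<lbrakk>x \<in> Q; y \<in> Q\<rbrakk> \<Longrightarrow> x \<triangleright> (y \<triangleright>i x) = y"
    and rk_distrib: "\<lbrakk>x \<in> Q; y \<in> Q; z \<in> Q\<rbrakk> \<Longrightarrow> x \<triangleright> (y \<triangleright> z) = (x \<triangleright> y) \<triangleright> (x \<triangleright> z)"
    and rki_distrib: "\<lbrakk>x \<in> Q; y \<in> Q; z \<in> Q\<rbrakk> \<Longrightarrow> (x \<triangleright>i y) \<triangleright>i z = (x \<triangleright>i z) \<triangleright>i (y \<triangleright>i z)"
    and unit_rk: "x \<in> Q \<Longrightarrow> e \<triangleright> x = x"
    and rk_unit: "x \<in> Q \<Longrightarrow> x \<triangleright> e = e"

text \<open>
  For \<open>Q = Spec A\<close>, the set \<open>Q(R)\<close> is \<open>alg_hom K A R\<close>.  A comorphism \<open>\<nu> : A \<rightarrow> A \<otimes> A\<close> induces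
  \<open>Q(R) \<times> Q(R) \<rightarrow> Q(R)\<close>: the pair \<open>(x, y)\<close> corresponds to \<open>a \<otimes> b \<mapsto> x(a)y(b)\<close> on \<open>A \<otimes> A\<close>.
\<close>

definition point_op ::
  "('k, 'x) ring_scheme \<Rightarrow> ('k, 'a) module \<Rightarrow> ('a \<Rightarrow> ('a \<times> 'a \<Rightarrow> 'k) set) \<Rightarrow> ('k, 'r) module \<Rightarrow>
   ('a \<Rightarrow> 'r) \<Rightarrow> ('a \<Rightarrow> 'r) \<Rightarrow> 'a \<Rightarrow> 'r" where
  "point_op K A \<nu> R x y =
     compose (carrier A) (tensor_lift K A A R (\<lambda>a b. x a \<otimes>\<^bsub>R\<^esub> y b)) \<nu>"

definition point_unit ::
  "('k, 'a) module \<Rightarrow> ('a \<Rightarrow> 'k) \<Rightarrow> ('k, 'r) module \<Rightarrow> 'a \<Rightarrow> 'r" where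
  "point_unit A \<epsilon> R = (\<lambda>a\<in>carrier A. \<epsilon> a \<odot>\<^bsub>R\<^esub> \<one>\<^bsub>R\<^esub>)"

text \<open>
  Algebras over \<open>K\<close> are finitely generated, hence spanned by countably many elements.  The finite
  sequences of coefficients surject onto such an algebra, so every finitely generated \<open>K\<close>-algebra
  is isomorphic to one whose elements are of type \<open>'k list\<close>, and letting \<open>R\<close> range over that type
  covers all of them.
\<close>

locale affine_algebraic_rack =
  fixes K :: "('k, 'x) ring_scheme" and A :: "('k, 'a) module"
    and nabla nabla_inv :: "'a \<Rightarrow> ('a \<times> 'a \<Rightarrow> 'k) set" and \<epsilon> :: "'a \<Rightarrow> 'k"
  assumes coordinate_algebra: "fin_gen_algebra K A"
    and nabla: "nabla \<in> alg_hom K A (tensor_alg K A A)"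
    and nabla_inv: "nabla_inv \<in> alg_hom K A (tensor_alg K A A)"
    and counit: "\<epsilon> \<in> alg_hom K A (ground K)"
    and points_rack: "\<And>R :: ('k, 'k list) module. fin_gen_algebra K R \<Longrightarrow>
      pointed_rack (alg_hom K A R) (point_unit A \<epsilon> R)
        (point_op K A nabla R) (point_op K A nabla_inv R)"


section \<open>Tangent spaces and brackets\<close>

text \<open>
  \<open>Der\<^sub>K(A, K)\<close>, the derivations at the point \<open>\<epsilon> : A \<rightarrow> K\<close>.  It is applied below both over the
  base field and over an algebra \<open>R\<close> after base change.
\<close>

definition der_module ::
  "('k, 'x) ring_scheme \<Rightarrow> ('k, 'a) module \<Rightarrow> ('a \<Rightarrow> 'k) \<Rightarrow> ('k, 'a \<Rightarrow> 'k) module" where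
  "der_module K A \<epsilon> = \<lparr>
     carrier = {D \<in> lin_hom K A (ground K). \<forall>f\<in>carrier A. \<forall>g\<in>carrier A.
       D (f \<otimes>\<^bsub>A\<^esub> g) = D f \<otimes>\<^bsub>K\<^esub> \<epsilon> g \<oplus>\<^bsub>K\<^esub> \<epsilon> f \<otimes>\<^bsub>K\<^esub> D g},
     mult = undefined, one = undefined,
     zero = (\<lambda>a\<in>carrier A. \<zero>\<^bsub>K\<^esub>),
     add = (\<lambda>D E. \<lambda>a\<in>carrier A. D a \<oplus>\<^bsub>K\<^esub> E a),
     smult = (\<lambda>c D. \<lambda>a\<in>carrier A. c \<otimes>\<^bsub>K\<^esub> D a)\<rparr>"

text \<open>\<open>(D \<otimes> E) \<circ> \<nu>\<close>, where \<open>k \<otimes> k\<close> is identified with \<open>k\<close>.\<close>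

definition convolution ::
  "('k, 'x) ring_scheme \<Rightarrow> ('k, 'a) module \<Rightarrow> ('a \<Rightarrow> ('a \<times> 'a \<Rightarrow> 'k) set) \<Rightarrow>
   ('a \<Rightarrow> 'k) \<Rightarrow> ('a \<Rightarrow> 'k) \<Rightarrow> 'a \<Rightarrow> 'k" where
  "convolution K A \<nu> D E =
     compose (carrier A) (tensor_lift K A A (ground K) (\<lambda>a b. D a \<otimes>\<^bsub>K\<^esub> E b)) \<nu>"


section \<open>The adjoint representations on points\<close>

text \<open>
  Write \<open>A\<^sub>R = A \<otimes>\<^sub>K R\<close>.  For a point \<open>x\<close> of \<open>Q(R)\<close>, the endomorphism \<open>y \<mapsto> x \<triangleright> y\<close> of
  \<open>Q\<^sub>R = Spec A\<^sub>R\<close> is determined, by Yoneda, by its value on the universal point \<open>a \<mapsto> a \<otimes> 1\<close> in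
  \<open>Q(A\<^sub>R)\<close>; the image of \<open>x\<close> in \<open>Q(A\<^sub>R)\<close> is \<open>a \<mapsto> 1 \<otimes> x(a)\<close>.
\<close>

definition universal_point ::
  "('k, 'x) ring_scheme \<Rightarrow> ('k, 'a) module \<Rightarrow> ('k, 'r) module \<Rightarrow> 'a \<Rightarrow> ('a \<times> 'r \<Rightarrow> 'k) set" where
  "universal_point K A R = (\<lambda>a\<in>carrier A. tens K A R a \<one>\<^bsub>R\<^esub>)"

definition extended_point ::
  "('k, 'x) ring_scheme \<Rightarrow> ('k, 'a) module \<Rightarrow> ('k, 'r) module \<Rightarrow> ('a \<Rightarrow> 'r) \<Rightarrow>
   'a \<Rightarrow> ('a \<times> 'r \<Rightarrow> 'k) set" where
  "extended_point K A R x = (\<lambda>a\<in>carrier A. tens K A R \<one>\<^bsub>A\<^esub> (x a))"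

definition L_comorphism ::
  "('k, 'x) ring_scheme \<Rightarrow> ('k, 'a) module \<Rightarrow> ('a \<Rightarrow> ('a \<times> 'a \<Rightarrow> 'k) set) \<Rightarrow> ('k, 'r) module \<Rightarrow>
   ('a \<Rightarrow> 'r) \<Rightarrow> ('a \<times> 'r \<Rightarrow> 'k) set \<Rightarrow> ('a \<times> 'r \<Rightarrow> 'k) set" where
  "L_comorphism K A nabla R x = base_lift K A R (base_change K A R)
     (point_op K A nabla (tensor_alg K A R) (extended_point K A R x) (universal_point K A R))"

text \<open>The inverse is \<open>y \<mapsto> y \<triangleright>i x\<close>, so \<open>x\<close> is here the second argument.\<close>

definition L_inv_comorphism ::
  "('k, 'x) ring_scheme \<Rightarrow> ('k, 'a) module \<Rightarrow> ('a \<Rightarrow> ('a \<times> 'a \<Rightarrow> 'k) set) \<Rightarrow> ('k, 'r) module \<Rightarrow>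
   ('a \<Rightarrow> 'r) \<Rightarrow> ('a \<times> 'r \<Rightarrow> 'k) set \<Rightarrow> ('a \<times> 'r \<Rightarrow> 'k) set" where
  "L_inv_comorphism K A nabla_inv R x = base_lift K A R (base_change K A R)
     (point_op K A nabla_inv (tensor_alg K A R) (universal_point K A R) (extended_point K A R x))"

text \<open>The tangent space \<open>T\<^sub>e Q\<^sub>R = Der\<^sub>R(A\<^sub>R, R)\<close>, at the base change of \<open>\<epsilon>\<close>.\<close>

definition functional_base_change ::
  "('k, 'x) ring_scheme \<Rightarrow> ('k, 'a) module \<Rightarrow> ('k, 'r) module \<Rightarrow> ('a \<Rightarrow> 'k) \<Rightarrow>
   ('a \<times> 'r \<Rightarrow> 'k) set \<Rightarrow> 'r" where
  "functional_base_change K A R f =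
     base_lift K A R (ground R) (\<lambda>a. f a \<odot>\<^bsub>R\<^esub> \<one>\<^bsub>R\<^esub>)"

definition tangent_base_change ::
  "('k, 'x) ring_scheme \<Rightarrow> ('k, 'a) module \<Rightarrow> ('a \<Rightarrow> 'k) \<Rightarrow> ('k, 'r) module \<Rightarrow>
   ('r, ('a \<times> 'r \<Rightarrow> 'k) set \<Rightarrow> 'r) module" where
  "tangent_base_change K A \<epsilon> R =
     der_module R (base_change K A R) (functional_base_change K A R \<epsilon>)"

text \<open>The canonical \<open>R\<close>-linear identification \<open>q \<otimes>\<^sub>K R \<rightarrow> Der\<^sub>R(A\<^sub>R, R)\<close>.\<close>

definition tangent_iso ::
  "('k, 'x) ring_scheme \<Rightarrow> ('k, 'a) module \<Rightarrow> ('a \<Rightarrow> 'k) \<Rightarrow> ('k, 'r) module \<Rightarrow>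
   (('a \<Rightarrow> 'k) \<times> 'r \<Rightarrow> 'k) set \<Rightarrow> ('a \<times> 'r \<Rightarrow> 'k) set \<Rightarrow> 'r" where
  "tangent_iso K A \<epsilon> R = base_lift K (der_module K A \<epsilon>) R (tangent_base_change K A \<epsilon> R)
     (functional_base_change K A R)"

text \<open>
  The tangent map \<open>D \<mapsto> D \<circ> \<phi>\<close> of an endomorphism of \<open>Q\<^sub>R\<close> with comorphism \<open>\<phi>\<close>, transported
  to \<open>q \<otimes>\<^sub>K R\<close>.
\<close>

definition tangent_map ::
  "('k, 'x) ring_scheme \<Rightarrow> ('k, 'a) module \<Rightarrow> ('a \<Rightarrow> 'k) \<Rightarrow> ('k, 'r) module \<Rightarrow>
   (('a \<times> 'r \<Rightarrow> 'k) set \<Rightarrow> ('a \<times> 'r \<Rightarrow> 'k) set) \<Rightarrow>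
   (('a \<Rightarrow> 'k) \<times> 'r \<Rightarrow> 'k) set \<Rightarrow> (('a \<Rightarrow> 'k) \<times> 'r \<Rightarrow> 'k) set" where
  "tangent_map K A \<epsilon> R \<phi> = (\<lambda>u\<in>carrier (base_change K (der_module K A \<epsilon>) R).
     inv_into (carrier (base_change K (der_module K A \<epsilon>) R)) (tangent_iso K A \<epsilon> R)
       (compose (carrier (base_change K A R)) (tangent_iso K A \<epsilon> R u) \<phi>))"

text \<open>
  The morphisms \<open>Ad, Ad\<^sup>-\<^sup>1 : Q \<rightarrow> GL(q)\<close> are given by their effect on \<open>R\<close>-points, where
  \<open>GL(q)(R)\<close> consists of the \<open>R\<close>-linear automorphisms of \<open>q \<otimes>\<^sub>K R\<close>.
\<close>

definition Ad ::
  "('k, 'x) ring_scheme \<Rightarrow> ('k, 'a) module \<Rightarrow> ('a \<Rightarrow> ('a \<times> 'a \<Rightarrow> 'k) set) \<Rightarrow> ('a \<Rightarrow> 'k) \<Rightarrow>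
   ('k, 'r) module \<Rightarrow> ('a \<Rightarrow> 'r) \<Rightarrow>
   (('a \<Rightarrow> 'k) \<times> 'r \<Rightarrow> 'k) set \<Rightarrow> (('a \<Rightarrow> 'k) \<times> 'r \<Rightarrow> 'k) set" where
  "Ad K A nabla \<epsilon> R x = tangent_map K A \<epsilon> R (L_comorphism K A nabla R x)"

definition Ad_inv ::
  "('k, 'x) ring_scheme \<Rightarrow> ('k, 'a) module \<Rightarrow> ('a \<Rightarrow> ('a \<times> 'a \<Rightarrow> 'k) set) \<Rightarrow> ('a \<Rightarrow> 'k) \<Rightarrow>
   ('k, 'r) module \<Rightarrow> ('a \<Rightarrow> 'r) \<Rightarrow>
   (('a \<Rightarrow> 'k) \<times> 'r \<Rightarrow> 'k) set \<Rightarrow> (('a \<Rightarrow> 'k) \<times> 'r \<Rightarrow> 'k) set" where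
  "Ad_inv K A nabla_inv \<epsilon> R x = tangent_map K A \<epsilon> R (L_inv_comorphism K A nabla_inv R x)"


section \<open>Differentials of the adjoint representations\<close>

text \<open>\<open>k[\<delta>]/(\<delta>\<^sup>2)\<close>, where the pair \<open>(a, b)\<close> stands for \<open>a + \<delta>b\<close>.\<close>

definition dual_numbers :: "('k, 'x) ring_scheme \<Rightarrow> ('k, 'k \<times> 'k) module" where
  "dual_numbers K = \<lparr>
     carrier = carrier K \<times> carrier K,
     mult = (\<lambda>(a, b) (c, d). (a \<otimes>\<^bsub>K\<^esub> c, a \<otimes>\<^bsub>K\<^esub> d \<oplus>\<^bsub>K\<^esub> b \<otimes>\<^bsub>K\<^esub> c)),
     one = (\<one>\<^bsub>K\<^esub>, \<zero>\<^bsub>K\<^esub>), zero = (\<zero>\<^bsub>K\<^esub>, \<zero>\<^bsub>K\<^esub>),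
     add = (\<lambda>(a, b) (c, d). (a \<oplus>\<^bsub>K\<^esub> c, b \<oplus>\<^bsub>K\<^esub> d)),
     smult = (\<lambda>s (a, b). (s \<otimes>\<^bsub>K\<^esub> a, s \<otimes>\<^bsub>K\<^esub> b))\<rparr>"

text \<open>The point \<open>\<epsilon> + \<delta>D\<close> of \<open>Q(k[\<delta>]/(\<delta>\<^sup>2))\<close> that corresponds to the tangent vector \<open>D\<close>.\<close>

definition tangent_point ::
  "('k, 'a) module \<Rightarrow> ('a \<Rightarrow> 'k) \<Rightarrow> ('a \<Rightarrow> 'k) \<Rightarrow> 'a \<Rightarrow> 'k \<times> 'k" where
  "tangent_point A \<epsilon> D = (\<lambda>a\<in>carrier A. (\<epsilon> a, D a))"

definition gl :: "('k, 'x) ring_scheme \<Rightarrow> ('k, 'v) module \<Rightarrow> ('v \<Rightarrow> 'v) set" where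
  "gl K V = lin_hom K V V"

text \<open>
  The automorphism \<open>id + \<delta>f\<close> of \<open>V \<otimes> k[\<delta>]/(\<delta>\<^sup>2)\<close>, with inverse \<open>id - \<delta>f\<close>;
  these are the elements of \<open>ker (GL(V)(k[\<delta>]/(\<delta>\<^sup>2)) \<rightarrow> GL(V)(k)) = T\<^sub>i\<^sub>d GL(V)\<close>.
\<close>

definition id_plus_delta ::
  "('k, 'x) ring_scheme \<Rightarrow> ('k, 'v) module \<Rightarrow> ('v \<Rightarrow> 'v) \<Rightarrow>
   ('v \<times> 'k \<times> 'k \<Rightarrow> 'k) set \<Rightarrow> ('v \<times> 'k \<times> 'k \<Rightarrow> 'k) set" where
  "id_plus_delta K V f = (let R = dual_numbers K in
     base_lift K V R (base_change K V R)
       (\<lambda>v. tens K V R v \<one>\<^bsub>R\<^esub> \<oplus>\<^bsub>base_change K V R\<^esub> tens K V R (f v) (\<zero>\<^bsub>K\<^esub>, \<one>\<^bsub>K\<^esub>)))"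

text \<open>
  The differential at \<open>e\<close> of a morphism \<open>\<Phi> : Q \<rightarrow> GL(V)\<close>, of which only the effect on
  \<open>k[\<delta>]/(\<delta>\<^sup>2)\<close>-points enters: tangent vectors on both sides are such points, and \<open>D\<close> is sent
  to the \<open>f\<close> with \<open>\<Phi>(\<epsilon> + \<delta>D) = id + \<delta>f\<close>.
\<close>

definition differential_GL ::
  "('k, 'x) ring_scheme \<Rightarrow> ('k, 'a) module \<Rightarrow> ('a \<Rightarrow> 'k) \<Rightarrow> ('k, 'v) module \<Rightarrow>
   (('a \<Rightarrow> 'k \<times> 'k) \<Rightarrow> ('v \<times> 'k \<times> 'k \<Rightarrow> 'k) set \<Rightarrow> ('v \<times> 'k \<times> 'k \<Rightarrow> 'k) set) \<Rightarrow>
   ('a \<Rightarrow> 'k) \<Rightarrow> 'v \<Rightarrow> 'v" where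
  "differential_GL K A \<epsilon> V \<Phi> D =
     (THE f. f \<in> gl K V \<and> \<Phi> (tangent_point A \<epsilon> D) = id_plus_delta K V f)"

definition ad ::
  "('k, 'x) ring_scheme \<Rightarrow> ('k, 'a) module \<Rightarrow> ('a \<Rightarrow> ('a \<times> 'a \<Rightarrow> 'k) set) \<Rightarrow> ('a \<Rightarrow> 'k) \<Rightarrow>
   ('a \<Rightarrow> 'k) \<Rightarrow> ('a \<Rightarrow> 'k) \<Rightarrow> 'a \<Rightarrow> 'k" where
  "ad K A nabla \<epsilon> =
     differential_GL K A \<epsilon> (der_module K A \<epsilon>) (Ad K A nabla \<epsilon> (dual_numbers K))"

definition ad_inv ::
  "('k, 'x) ring_scheme \<Rightarrow> ('k, 'a) module \<Rightarrow> ('a \<Rightarrow> ('a \<times> 'a \<Rightarrow> 'k) set) \<Rightarrow> ('a \<Rightarrow> 'k) \<Rightarrow>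
   ('a \<Rightarrow> 'k) \<Rightarrow> ('a \<Rightarrow> 'k) \<Rightarrow> 'a \<Rightarrow> 'k" where
  "ad_inv K A nabla_inv \<epsilon> =
     differential_GL K A \<epsilon> (der_module K A \<epsilon>) (Ad_inv K A nabla_inv \<epsilon> (dual_numbers K))"

end

theory Submission
  imports Defs
begin

text \<open>
  Over the dual numbers \<open>R = k[\<delta>]/(\<delta>\<^sup>2)\<close> a tangent vector \<open>D\<close> becomes the point \<open>\<epsilon> + \<delta>D\<close>, and
  everything is read off from the pairings \<open>(f \<otimes> g) \<circ> \<nabla>\<close> with \<open>f\<close> and \<open>g\<close> among \<open>\<epsilon>\<close>, \<open>D\<close>, \<open>E\<close>.

  The unit laws of the rack, applied to the points \<open>\<epsilon>\<close> and \<open>\<epsilon> + \<delta>D\<close>, compare coefficients of \<open>\<delta>\<close>: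
  \<open>e \<triangleright> x = x\<close> gives \<open>(\<epsilon> \<otimes> D) \<circ> \<nabla> = D\<close>, and \<open>x \<triangleright> e = e\<close> gives \<open>(D \<otimes> \<epsilon>) \<circ> \<nabla> = 0\<close>.  For the inverse
  operation the laws \<open>e \<triangleright>\<inverse> x = e\<close> and \<open>x \<triangleright>\<inverse> e = x\<close> follow, and the two factors exchange roles
  (\<open>convolution_counit\<close>).  Expanding \<open>(D \<otimes> E)(\<nabla>(f) \<nabla>(g))\<close> by the Leibniz rules of \<open>D\<close> and \<open>E\<close> yields
  the Leibniz rule for the convolution plus two mixed terms (\<open>pairing_mult\<close>).  Each mixed term
  has a vanishing factor by these identities, so both brackets preserve
  \<open>q\<close> (\<open>convolution_derivation\<close>, \<open>bracket_closed\<close>).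

  For the adjoint representation, \<open>L\<^sub>x\<close> with \<open>x = \<epsilon> + \<delta>D\<close> has on \<open>A \<otimes> R\<close> the comorphism determined by
  \<open>a \<otimes> 1 \<mapsto> \<Sum> a'' \<otimes> x(a')\<close>, where \<open>\<nabla>(a) = \<Sum> a' \<otimes> a''\<close>.  The extension of \<open>E\<close> to \<open>A \<otimes> R\<close> takes the
  value \<open>((\<epsilon> \<otimes> E) \<circ> \<nabla>)(a) + \<delta> ((D \<otimes> E) \<circ> \<nabla>)(a) = E(a) + \<delta> [D, E](a)\<close> there (\<open>functional_point_op\<close>).
  Hence \<open>Ad\<^sub>x\<close> agrees with \<open>id + \<delta> [D, \<cdot>]\<close> on the elements \<open>E \<otimes> 1\<close>, which generate \<open>q \<otimes> R\<close> over \<open>R\<close>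
  (\<open>tangent_map_id_plus_delta\<close>); and \<open>id + \<delta>f\<close> determines \<open>f\<close> (\<open>id_plus_delta_inj\<close>).  The dual
  representation is computed in the same way, with \<open>x\<close> in the second argument.

  Two facts make the transport to \<open>q \<otimes> R\<close> work.  Every element of \<open>q \<otimes> R\<close> has the form
  \<open>E \<otimes> 1 + F \<otimes> \<delta>\<close>, and its image in \<open>Der\<^sub>R(A \<otimes> R, R)\<close> has the value \<open>E(a) + \<delta>F(a)\<close> at \<open>a \<otimes> 1\<close>.  So the map
  \<open>q \<otimes> R \<rightarrow> Der\<^sub>R(A \<otimes> R, R)\<close> is injective (\<open>tangent_iso_inj\<close>); since the preimage of
  \<open>E\<^sub>R \<circ> L\<^sub>x\<close> is exhibited explicitly, injectivity suffices to evaluate the inverse.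

  Identities between maps out of tensor products are checked on pure tensors (\<open>tensor_induct\<close>) or,
  for \<open>R\<close>-linear maps out of \<open>M \<otimes> R\<close>, on the elements \<open>m \<otimes> 1\<close> (\<open>base_hom_eqI\<close>).
\<close>


section \<open>Modules and linear maps\<close>

lemma lin_homI:
  assumes "\<And>x. x \<in> carrier M \<Longrightarrow> h x \<in> carrier N"
    and "\<And>x. x \<notin> carrier M \<Longrightarrow> h x = undefined"
    and "\<And>x y. \<lbrakk>x \<in> carrier M; y \<in> carrier M\<rbrakk> \<Longrightarrow> h (x \<oplus>\<^bsub>M\<^esub> y) = h x \<oplus>\<^bsub>N\<^esub> h y"
    and "\<And>c x. \<lbrakk>c \<in> carrier K; x \<in> carrier M\<rbrakk> \<Longrightarrow> h (c \<odot>\<^bsub>M\<^esub> x) = c \<odot>\<^bsub>N\<^esub> h x"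
  shows "h \<in> lin_hom K M N"
  using assms by (auto simp: lin_hom_def PiE_def extensional_def)

lemma restrict_lin_homI:
  assumes "module K M"
    and "\<And>x. x \<in> carrier M \<Longrightarrow> h x \<in> carrier N"
    and "\<And>x y. \<lbrakk>x \<in> carrier M; y \<in> carrier M\<rbrakk> \<Longrightarrow> h (x \<oplus>\<^bsub>M\<^esub> y) = h x \<oplus>\<^bsub>N\<^esub> h y"
    and "\<And>c x. \<lbrakk>c \<in> carrier K; x \<in> carrier M\<rbrakk> \<Longrightarrow> h (c \<odot>\<^bsub>M\<^esub> x) = c \<odot>\<^bsub>N\<^esub> h x"
  shows "restrict h (carrier M) \<in> lin_hom K M N"
proof -
  interpret module K M by fact
  show ?thesis by (rule lin_homI) (auto simp: assms(2-))
qed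

lemma lin_hom_closed: "\<lbrakk>h \<in> lin_hom K M N; x \<in> carrier M\<rbrakk> \<Longrightarrow> h x \<in> carrier N"
  and lin_hom_undefined: "\<lbrakk>h \<in> lin_hom K M N; x \<notin> carrier M\<rbrakk> \<Longrightarrow> h x = undefined"
  and lin_hom_add:
    "\<lbrakk>h \<in> lin_hom K M N; x \<in> carrier M; y \<in> carrier M\<rbrakk> \<Longrightarrow> h (x \<oplus>\<^bsub>M\<^esub> y) = h x \<oplus>\<^bsub>N\<^esub> h y"
  and lin_hom_smult:
    "\<lbrakk>h \<in> lin_hom K M N; c \<in> carrier K; x \<in> carrier M\<rbrakk> \<Longrightarrow> h (c \<odot>\<^bsub>M\<^esub> x) = c \<odot>\<^bsub>N\<^esub> h x"
  by (auto simp: lin_hom_def PiE_def extensional_def)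

lemma lin_hom_zero:
  assumes "module K M" "module K N" "h \<in> lin_hom K M N"
  shows "h \<zero>\<^bsub>M\<^esub> = \<zero>\<^bsub>N\<^esub>"
proof -
  interpret M: module K M by fact
  interpret N: module K N by fact
  have "h \<zero>\<^bsub>M\<^esub> \<oplus>\<^bsub>N\<^esub> h \<zero>\<^bsub>M\<^esub> = h \<zero>\<^bsub>M\<^esub>"
    using lin_hom_add[OF assms(3), of "\<zero>\<^bsub>M\<^esub>" "\<zero>\<^bsub>M\<^esub>"] by simp
  then show ?thesis using lin_hom_closed[OF assms(3), of "\<zero>\<^bsub>M\<^esub>"] by simp
qed

lemma lin_hom_minus:
  assumes "module K M" "module K N" "h \<in> lin_hom K M N" "x \<in> carrier M" "y \<in> carrier M"
  shows "h (x \<ominus>\<^bsub>M\<^esub> y) = h x \<ominus>\<^bsub>N\<^esub> h y"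
proof -
  interpret M: module K M by fact
  interpret N: module K N by fact
  note cl = lin_hom_closed[OF assms(3)]
  have "h (\<ominus>\<^bsub>M\<^esub> y) \<oplus>\<^bsub>N\<^esub> h y = \<zero>\<^bsub>N\<^esub>"
    using assms(5) by (simp add: lin_hom_add[OF assms(3), symmetric] M.l_neg lin_hom_zero[OF assms(1-3)])
  then have "h (\<ominus>\<^bsub>M\<^esub> y) = \<ominus>\<^bsub>N\<^esub> h y"
    using cl assms(5) by (metis N.minus_equality M.a_inv_closed)
  then show ?thesis
    using assms(4,5) by (simp add: a_minus_def lin_hom_add[OF assms(3)])
qed

lemma lin_hom_compose:
  assumes "module K L" "f \<in> lin_hom K L M" "g \<in> lin_hom K M N"
  shows "compose (carrier L) g f \<in> lin_hom K L N"
  unfolding compose_def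
  by (rule restrict_lin_homI[OF assms(1)])
    (simp_all add: lin_hom_closed[OF assms(2)] lin_hom_closed[OF assms(3)]
      lin_hom_add[OF assms(2)] lin_hom_add[OF assms(3)]
      lin_hom_smult[OF assms(2)] lin_hom_smult[OF assms(3)])

text \<open>
  An abelian group sees only the additive part of a record.  This moves group and module
  structures between the tensor module, the tensor algebra and the base change, which share
  their additive part but differ in the other fields and their types.
\<close>

lemma abelian_group_cong:
  assumes "abelian_group G" "carrier G' = carrier G" "zero G' = zero G" "add G' = add G"
  shows "abelian_group G'"
proof -
  interpret G: abelian_group G by fact
  show ?thesis
    by (rule abelian_groupI) (use assms G.a_ac G.l_neg in \<open>auto intro: bexI[of _ "\<ominus>\<^bsub>G\<^esub> _"]\<close>)
qed

lemma module_cong: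
  assumes "module K M" "carrier M' = carrier M" "zero M' = zero M" "add M' = add M"
    and "smult M' = smult M"
  shows "module K M'"
proof -
  interpret M: module K M by fact
  have "abelian_group M'" using M.abelian_group_axioms assms(2-4) by (rule abelian_group_cong)
  then show ?thesis
    using assms M.is_cring M.smult_l_distr M.smult_r_distr M.smult_assoc1
    by (intro moduleI) auto
qed

lemma lin_hom_cong:
  assumes "carrier N' = carrier N" "add N' = add N" "smult N' = smult N"
  shows "lin_hom K M N' = lin_hom K M N"
  by (simp add: lin_hom_def assms)

lemma ground_simps [simp]:
  "carrier (ground K) = carrier K" "mult (ground K) = mult K" "one (ground K) = one K"
  "zero (ground K) = zero K" "add (ground K) = add K" "smult (ground K) = mult K"
  by (simp_all add: ground_def)

lemma ground_module:
  assumes "cring K"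
  shows "module K (ground K)"
proof -
  interpret cring K by fact
  show ?thesis
    by (auto intro!: moduleI abelian_groupI assms bexI[of _ "\<ominus>\<^bsub>K\<^esub> _"]
        simp: a_ac r_neg l_distr r_distr m_assoc)
qed

lemma abelian_group_add4:
  assumes "abelian_group G" "a \<in> carrier G" "b \<in> carrier G" "c \<in> carrier G" "d \<in> carrier G"
  shows "(a \<oplus>\<^bsub>G\<^esub> b) \<oplus>\<^bsub>G\<^esub> (c \<oplus>\<^bsub>G\<^esub> d) = (a \<oplus>\<^bsub>G\<^esub> c) \<oplus>\<^bsub>G\<^esub> (b \<oplus>\<^bsub>G\<^esub> d)"
proof -
  interpret abelian_group G by fact
  show ?thesis using assms by (simp add: a_ac)
qed

lemma (in module) smult_left_commute:
  "\<lbrakk>c \<in> carrier R; d \<in> carrier R; x \<in> carrier M\<rbrakk> \<Longrightarrow> c \<odot>\<^bsub>M\<^esub> (d \<odot>\<^bsub>M\<^esub> x) = d \<odot>\<^bsub>M\<^esub> (c \<odot>\<^bsub>M\<^esub> x)"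
  by (simp add: smult_assoc1[symmetric] R.m_comm)

lemma (in algebra) smult_mult_right:
  "\<lbrakk>c \<in> carrier R; a \<in> carrier M; b \<in> carrier M\<rbrakk> \<Longrightarrow>
    a \<otimes>\<^bsub>M\<^esub> (c \<odot>\<^bsub>M\<^esub> b) = c \<odot>\<^bsub>M\<^esub> (a \<otimes>\<^bsub>M\<^esub> b)"
  using smult_assoc2[of c b a] by (simp add: m_comm)


section \<open>Quotient modules\<close>

text \<open>
  The fields repeat those of \<open>tensor_mod\<close>, so that the tensor product is literally a quotient module;
  in particular the scalar multiplication is a union of cosets that all turn out to be equal.
\<close>

definition quotient_mod :: "('k, 'm) module \<Rightarrow> 'm set \<Rightarrow> ('k, 'm set) module" where
  "quotient_mod F H = \<lparr>carrier = a_rcosets\<^bsub>F\<^esub> H, mult = undefined, one = undefined, zero = H,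
     add = (\<lambda>X Y. X <+>\<^bsub>F\<^esub> Y), smult = (\<lambda>c X. \<Union>x\<in>X. H +>\<^bsub>F\<^esub> (c \<odot>\<^bsub>F\<^esub> x))\<rparr>"

context
  fixes K :: "('k, 'x) ring_scheme" and F :: "('k, 'm) module" and H :: "'m set"
  assumes F: "module K F" and H: "submodule H K F"
begin

interpretation F: module K F by (rule F)
interpretation H: submodule H K F by (rule H)
interpretation H: abelian_subgroup H F
  by (rule abelian_subgroupI3)
    (auto intro: F.abelian_group_axioms additive_subgroupI H.subgroup_axioms)

lemma quotient_carrier: "X \<in> carrier (quotient_mod F H) \<longleftrightarrow> (\<exists>x\<in>carrier F. X = H +>\<^bsub>F\<^esub> x)"
  by (simp add: quotient_mod_def A_RCOSETS_def')

lemma coset_closed: "x \<in> carrier F \<Longrightarrow> H +>\<^bsub>F\<^esub> x \<in> carrier (quotient_mod F H)"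
  by (auto simp: quotient_carrier)

lemma coset_add:
  "\<lbrakk>x \<in> carrier F; y \<in> carrier F\<rbrakk> \<Longrightarrow>
    (H +>\<^bsub>F\<^esub> x) \<oplus>\<^bsub>quotient_mod F H\<^esub> (H +>\<^bsub>F\<^esub> y) = H +>\<^bsub>F\<^esub> (x \<oplus>\<^bsub>F\<^esub> y)"
  by (simp add: quotient_mod_def H.a_rcos_sum)

lemma coset_zero: "\<zero>\<^bsub>quotient_mod F H\<^esub> = H +>\<^bsub>F\<^esub> \<zero>\<^bsub>F\<^esub>"
  by (simp add: quotient_mod_def H.a_subset)

lemma coset_memberE:
  assumes "y \<in> H +>\<^bsub>F\<^esub> x"
  obtains h where "h \<in> H" "y = h \<oplus>\<^bsub>F\<^esub> x"
  using assms by (auto simp: a_r_coset_def')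

lemma coset_smult:
  assumes "c \<in> carrier K" "x \<in> carrier F"
  shows "c \<odot>\<^bsub>quotient_mod F H\<^esub> (H +>\<^bsub>F\<^esub> x) = H +>\<^bsub>F\<^esub> (c \<odot>\<^bsub>F\<^esub> x)"
proof -
  have "H +>\<^bsub>F\<^esub> (c \<odot>\<^bsub>F\<^esub> y) = H +>\<^bsub>F\<^esub> (c \<odot>\<^bsub>F\<^esub> x)" if y: "y \<in> H +>\<^bsub>F\<^esub> x" for y
  proof -
    obtain h where h: "h \<in> H" "y = h \<oplus>\<^bsub>F\<^esub> x"
      using coset_memberE[OF y] by blast
    have "c \<odot>\<^bsub>F\<^esub> y = c \<odot>\<^bsub>F\<^esub> h \<oplus>\<^bsub>F\<^esub> c \<odot>\<^bsub>F\<^esub> x"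
      using h assms H.a_subset by (auto simp: F.smult_r_distr)
    then have "c \<odot>\<^bsub>F\<^esub> y \<in> H +>\<^bsub>F\<^esub> (c \<odot>\<^bsub>F\<^esub> x)"
      using h assms by (auto simp: a_r_coset_def')
    then show ?thesis
      using assms by (metis H.a_repr_independence' F.smult_closed)
  qed
  then have "(\<Union>y\<in>H +>\<^bsub>F\<^esub> x. H +>\<^bsub>F\<^esub> (c \<odot>\<^bsub>F\<^esub> y)) = H +>\<^bsub>F\<^esub> (c \<odot>\<^bsub>F\<^esub> x)"
    using UN_constant_eq[OF H.a_rcos_self[OF assms(2)]] by blast
  then show ?thesis by (simp add: quotient_mod_def)
qed

lemma quotient_module: "module K (quotient_mod F H)"
proof (rule moduleI)
  show "cring K" by (rule F.is_cring)
  note ops = coset_add coset_zero coset_smult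
  show "abelian_group (quotient_mod F H)"
  proof (rule abelian_groupI)
    show "\<zero>\<^bsub>quotient_mod F H\<^esub> \<in> carrier (quotient_mod F H)"
      by (metis coset_closed coset_zero F.zero_closed)
  next
    fix X Y assume "X \<in> carrier (quotient_mod F H)" "Y \<in> carrier (quotient_mod F H)"
    then obtain x y where xy: "x \<in> carrier F" "X = H +>\<^bsub>F\<^esub> x" "y \<in> carrier F" "Y = H +>\<^bsub>F\<^esub> y"
      by (auto simp: quotient_carrier)
    then show "X \<oplus>\<^bsub>quotient_mod F H\<^esub> Y \<in> carrier (quotient_mod F H)"
      by (simp add: ops coset_closed)
    from xy show "X \<oplus>\<^bsub>quotient_mod F H\<^esub> Y = Y \<oplus>\<^bsub>quotient_mod F H\<^esub> X"
      by (simp add: ops F.a_comm)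
    fix Z assume "Z \<in> carrier (quotient_mod F H)"
    then obtain z where "z \<in> carrier F" "Z = H +>\<^bsub>F\<^esub> z" by (auto simp: quotient_carrier)
    with xy show "X \<oplus>\<^bsub>quotient_mod F H\<^esub> Y \<oplus>\<^bsub>quotient_mod F H\<^esub> Z =
        X \<oplus>\<^bsub>quotient_mod F H\<^esub> (Y \<oplus>\<^bsub>quotient_mod F H\<^esub> Z)"
      by (simp add: ops F.a_assoc)
  next
    fix X assume "X \<in> carrier (quotient_mod F H)"
    then obtain x where x: "x \<in> carrier F" "X = H +>\<^bsub>F\<^esub> x" by (auto simp: quotient_carrier)
    then show "\<zero>\<^bsub>quotient_mod F H\<^esub> \<oplus>\<^bsub>quotient_mod F H\<^esub> X = X"
      by (simp add: ops del: F.a_coset_add_zero)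
    from x have "(H +>\<^bsub>F\<^esub> (\<ominus>\<^bsub>F\<^esub> x)) \<oplus>\<^bsub>quotient_mod F H\<^esub> X = \<zero>\<^bsub>quotient_mod F H\<^esub>"
      by (simp add: ops F.l_neg)
    then show "\<exists>Y\<in>carrier (quotient_mod F H). Y \<oplus>\<^bsub>quotient_mod F H\<^esub> X = \<zero>\<^bsub>quotient_mod F H\<^esub>"
      using x coset_closed by (meson F.a_inv_closed)
  qed
next
  fix c X assume "c \<in> carrier K" "X \<in> carrier (quotient_mod F H)"
  then show "c \<odot>\<^bsub>quotient_mod F H\<^esub> X \<in> carrier (quotient_mod F H)"
    by (auto simp: quotient_carrier coset_smult)
next
  fix c d X assume "c \<in> carrier K" "d \<in> carrier K" "X \<in> carrier (quotient_mod F H)"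
  then show "(c \<oplus>\<^bsub>K\<^esub> d) \<odot>\<^bsub>quotient_mod F H\<^esub> X =
      c \<odot>\<^bsub>quotient_mod F H\<^esub> X \<oplus>\<^bsub>quotient_mod F H\<^esub> d \<odot>\<^bsub>quotient_mod F H\<^esub> X"
    and "(c \<otimes>\<^bsub>K\<^esub> d) \<odot>\<^bsub>quotient_mod F H\<^esub> X =
      c \<odot>\<^bsub>quotient_mod F H\<^esub> (d \<odot>\<^bsub>quotient_mod F H\<^esub> X)"
    by (auto simp: quotient_carrier coset_add coset_smult F.smult_l_distr F.smult_assoc1)
next
  fix c X Y
  assume "c \<in> carrier K" "X \<in> carrier (quotient_mod F H)" "Y \<in> carrier (quotient_mod F H)"
  then show "c \<odot>\<^bsub>quotient_mod F H\<^esub> (X \<oplus>\<^bsub>quotient_mod F H\<^esub> Y) =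
      c \<odot>\<^bsub>quotient_mod F H\<^esub> X \<oplus>\<^bsub>quotient_mod F H\<^esub> c \<odot>\<^bsub>quotient_mod F H\<^esub> Y"
    by (auto simp: quotient_carrier coset_add coset_smult F.smult_r_distr)
next
  fix X assume "X \<in> carrier (quotient_mod F H)"
  then show "\<one>\<^bsub>K\<^esub> \<odot>\<^bsub>quotient_mod F H\<^esub> X = X"
    by (auto simp: quotient_carrier coset_smult)
qed

text \<open>
  All representatives of a coset have the same image under \<open>g\<close>, so evaluating \<open>g\<close> at a chosen one is
  well defined and linear.
\<close>

lemma quotient_lift:
  assumes P: "module K P" and g: "g \<in> lin_hom K F P" and ker: "\<And>x. x \<in> H \<Longrightarrow> g x = \<zero>\<^bsub>P\<^esub>"
  shows "\<exists>h \<in> lin_hom K (quotient_mod F H) P. \<forall>x\<in>carrier F. h (H +>\<^bsub>F\<^esub> x) = g x"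
proof -
  interpret P: module K P by fact
  define h where "h = (\<lambda>X\<in>carrier (quotient_mod F H). g (SOME x. x \<in> X))"
  have h: "h (H +>\<^bsub>F\<^esub> x) = g x" if x: "x \<in> carrier F" for x
  proof -
    have "(SOME y. y \<in> H +>\<^bsub>F\<^esub> x) \<in> H +>\<^bsub>F\<^esub> x"
      using H.a_rcos_self[OF x] by (rule someI)
    then obtain y where y: "y \<in> H" "(SOME y. y \<in> H +>\<^bsub>F\<^esub> x) = y \<oplus>\<^bsub>F\<^esub> x"
      using coset_memberE by blast
    then have "g (SOME y. y \<in> H +>\<^bsub>F\<^esub> x) = g x"
      using x H.a_subset lin_hom_closed[OF g] by (auto simp: lin_hom_add[OF g] ker)
    then show ?thesis using x by (simp add: h_def coset_closed)
  qed
  have "h \<in> lin_hom K (quotient_mod F H) P"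
  proof (rule lin_homI)
    show "h X = undefined" if "X \<notin> carrier (quotient_mod F H)" for X
      using that by (simp add: h_def)
  next
    fix X assume "X \<in> carrier (quotient_mod F H)"
    then obtain x where x: "x \<in> carrier F" "X = H +>\<^bsub>F\<^esub> x" by (auto simp: quotient_carrier)
    then show "h X \<in> carrier P" by (simp add: h lin_hom_closed[OF g])
  next
    fix X Y assume "X \<in> carrier (quotient_mod F H)" "Y \<in> carrier (quotient_mod F H)"
    then obtain x y where "x \<in> carrier F" "X = H +>\<^bsub>F\<^esub> x" "y \<in> carrier F" "Y = H +>\<^bsub>F\<^esub> y"
      by (auto simp: quotient_carrier)
    then show "h (X \<oplus>\<^bsub>quotient_mod F H\<^esub> Y) = h X \<oplus>\<^bsub>P\<^esub> h Y"
      by (simp add: h coset_add lin_hom_add[OF g])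
  next
    fix c X assume "c \<in> carrier K" "X \<in> carrier (quotient_mod F H)"
    moreover then obtain x where "x \<in> carrier F" "X = H +>\<^bsub>F\<^esub> x" by (auto simp: quotient_carrier)
    ultimately show "h (c \<odot>\<^bsub>quotient_mod F H\<^esub> X) = c \<odot>\<^bsub>P\<^esub> h X"
      by (simp add: h coset_smult lin_hom_smult[OF g])
  qed
  with h show ?thesis by blast
qed

end


section \<open>Free modules\<close>

lemma free_mod_simps:
  "zero (free_mod K X) = (\<lambda>p. \<zero>\<^bsub>K\<^esub>)"
  "add (free_mod K X) f g = (\<lambda>p. f p \<oplus>\<^bsub>K\<^esub> g p)"
  "smult (free_mod K X) c f = (\<lambda>p. c \<otimes>\<^bsub>K\<^esub> f p)"
  by (simp_all add: free_mod_def)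

lemma free_mod_carrier:
  "f \<in> carrier (free_mod K X) \<longleftrightarrow>
    (\<forall>p. f p \<in> carrier K) \<and> finite {p. f p \<noteq> \<zero>\<^bsub>K\<^esub>} \<and> {p. f p \<noteq> \<zero>\<^bsub>K\<^esub>} \<subseteq> X"
  by (simp add: free_mod_def)

context
  fixes K :: "('k, 'x) ring_scheme"
  assumes K: "cring K"
begin

interpretation K: cring K by (rule K)

lemma free_mod_add_closed:
  assumes f: "f \<in> carrier (free_mod K X)" and g: "g \<in> carrier (free_mod K X)"
  shows "f \<oplus>\<^bsub>free_mod K X\<^esub> g \<in> carrier (free_mod K X)"
proof -
  let ?I = "{p. f p \<noteq> \<zero>\<^bsub>K\<^esub>} \<union> {p. g p \<noteq> \<zero>\<^bsub>K\<^esub>}"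
  have supp: "{p. (f \<oplus>\<^bsub>free_mod K X\<^esub> g) p \<noteq> \<zero>\<^bsub>K\<^esub>} \<subseteq> ?I"
    by (auto simp: free_mod_simps)
  have I: "finite ?I" "?I \<subseteq> X" using f g by (auto simp: free_mod_carrier)
  have "(f \<oplus>\<^bsub>free_mod K X\<^esub> g) p \<in> carrier K" for p
    using f g by (simp add: free_mod_carrier free_mod_simps)
  then show ?thesis
    unfolding free_mod_carrier using finite_subset[OF supp I(1)] order_trans[OF supp I(2)] by blast
qed

lemma free_mod_smult_closed:
  assumes c: "c \<in> carrier K" and f: "f \<in> carrier (free_mod K X)"
  shows "c \<odot>\<^bsub>free_mod K X\<^esub> f \<in> carrier (free_mod K X)"
proof -
  have supp: "{p. (c \<odot>\<^bsub>free_mod K X\<^esub> f) p \<noteq> \<zero>\<^bsub>K\<^esub>} \<subseteq> {p. f p \<noteq> \<zero>\<^bsub>K\<^esub>}"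
    using c by (auto simp: free_mod_simps)
  have I: "finite {p. f p \<noteq> \<zero>\<^bsub>K\<^esub>}" "{p. f p \<noteq> \<zero>\<^bsub>K\<^esub>} \<subseteq> X"
    using f by (auto simp: free_mod_carrier)
  have "(c \<odot>\<^bsub>free_mod K X\<^esub> f) p \<in> carrier K" for p
    using c f by (simp add: free_mod_carrier free_mod_simps)
  then show ?thesis
    unfolding free_mod_carrier using finite_subset[OF supp I(1)] order_trans[OF supp I(2)] by blast
qed

lemma free_module: "module K (free_mod K X)"
proof (rule moduleI)
  show "abelian_group (free_mod K X)"
  proof (rule abelian_groupI)
    fix f assume f: "f \<in> carrier (free_mod K X)"
    have "(\<ominus>\<^bsub>K\<^esub> \<one>\<^bsub>K\<^esub>) \<odot>\<^bsub>free_mod K X\<^esub> f \<oplus>\<^bsub>free_mod K X\<^esub> f = \<zero>\<^bsub>free_mod K X\<^esub>"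
      using f by (auto simp: free_mod_simps free_mod_carrier K.l_minus K.l_neg)
    then show "\<exists>g\<in>carrier (free_mod K X). g \<oplus>\<^bsub>free_mod K X\<^esub> f = \<zero>\<^bsub>free_mod K X\<^esub>"
      using free_mod_smult_closed[of "\<ominus>\<^bsub>K\<^esub> \<one>\<^bsub>K\<^esub>" f] f by blast
  next
    show "\<zero>\<^bsub>free_mod K X\<^esub> \<in> carrier (free_mod K X)"
      by (simp add: free_mod_carrier free_mod_simps)
  next
    fix f g assume "f \<in> carrier (free_mod K X)" "g \<in> carrier (free_mod K X)"
    then show "f \<oplus>\<^bsub>free_mod K X\<^esub> g \<in> carrier (free_mod K X)"
      by (rule free_mod_add_closed)
  qed (auto simp: free_mod_simps free_mod_carrier K.a_ac)
next
  fix c f assume "c \<in> carrier K" "f \<in> carrier (free_mod K X)"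
  then show "c \<odot>\<^bsub>free_mod K X\<^esub> f \<in> carrier (free_mod K X)"
    by (rule free_mod_smult_closed)
qed (auto simp: K free_mod_simps free_mod_carrier K.l_distr K.r_distr K.m_assoc)

lemma basis_vec_closed: "p \<in> X \<Longrightarrow> basis_vec K p \<in> carrier (free_mod K X)"
  by (auto simp: free_mod_carrier basis_vec_def)

text \<open>
  A finitely supported function is the sum of its values times basis vectors; the induction removes
  one point of the support at a time.
\<close>

lemma free_mod_induct [consumes 1, case_names zero smult add]:
  assumes f: "f \<in> carrier (free_mod K X)"
    and zero: "S \<zero>\<^bsub>free_mod K X\<^esub>"
    and basis: "\<And>c p. \<lbrakk>c \<in> carrier K; p \<in> X\<rbrakk> \<Longrightarrow> S (c \<odot>\<^bsub>free_mod K X\<^esub> basis_vec K p)"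
    and add: "\<And>g h. \<lbrakk>g \<in> carrier (free_mod K X); h \<in> carrier (free_mod K X); S g; S h\<rbrakk> \<Longrightarrow>
      S (g \<oplus>\<^bsub>free_mod K X\<^esub> h)"
  shows "S f"
proof -
  interpret F: module K "free_mod K X" by (rule free_module)
  have "\<lbrakk>f \<in> carrier (free_mod K X); {p. f p \<noteq> \<zero>\<^bsub>K\<^esub>} = I\<rbrakk> \<Longrightarrow> S f" if "finite I" for I f
    using that
  proof (induction I arbitrary: f)
    case empty
    then have "f = \<zero>\<^bsub>free_mod K X\<^esub>" by (auto simp: free_mod_simps)
    then show ?case using zero by simp
  next
    case (insert q I)
    let ?g = "f(q := \<zero>\<^bsub>K\<^esub>)"
    have supp: "{p. ?g p \<noteq> \<zero>\<^bsub>K\<^esub>} = I" using insert by auto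
    have g: "?g \<in> carrier (free_mod K X)"
      unfolding free_mod_carrier supp using insert by (auto simp: free_mod_carrier)
    have q: "q \<in> X" "f q \<in> carrier K" using insert by (auto simp: free_mod_carrier)
    have "f = f q \<odot>\<^bsub>free_mod K X\<^esub> basis_vec K q \<oplus>\<^bsub>free_mod K X\<^esub> ?g"
      using insert.prems by (auto simp: free_mod_simps basis_vec_def free_mod_carrier)
    moreover have "S (f q \<odot>\<^bsub>free_mod K X\<^esub> basis_vec K q \<oplus>\<^bsub>free_mod K X\<^esub> ?g)"
      using q g supp by (intro add basis insert.IH F.smult_closed basis_vec_closed)
    ultimately show ?case by simp
  qed
  then show ?thesis using f by (auto simp: free_mod_carrier)
qed

text \<open>
  The extension of \<open>\<beta>\<close> is \<open>f \<mapsto> \<Sum> f(p) \<beta>(p)\<close> over the support of \<open>f\<close>.  Supports change under addition, so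
  additivity is proved after enlarging all sums to a common finite index set.
\<close>

lemma free_lift:
  assumes P: "module K P" and \<beta>: "\<And>p. p \<in> X \<Longrightarrow> \<beta> p \<in> carrier P"
  shows "\<exists>g \<in> lin_hom K (free_mod K X) P. \<forall>p\<in>X. g (basis_vec K p) = \<beta> p"
proof -
  interpret P: module K P by fact
  interpret F: module K "free_mod K X" by (rule free_module)
  let ?supp = "\<lambda>f. {p. f p \<noteq> \<zero>\<^bsub>K\<^esub>}"
  define g where "g = (\<lambda>f\<in>carrier (free_mod K X). finsum P (\<lambda>p. f p \<odot>\<^bsub>P\<^esub> \<beta> p) (?supp f))"
  have g: "g f = finsum P (\<lambda>p. f p \<odot>\<^bsub>P\<^esub> \<beta> p) I"
    if "f \<in> carrier (free_mod K X)" "finite I" "?supp f \<subseteq> I" "I \<subseteq> X" for f I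
    unfolding g_def using that \<beta>
    by (auto simp: free_mod_carrier intro!: P.add.finprod_mono_neutral_cong_left)
  have "g \<in> lin_hom K (free_mod K X) P"
    unfolding g_def
  proof (rule restrict_lin_homI[OF free_module])
    fix f assume f: "f \<in> carrier (free_mod K X)"
    then show "finsum P (\<lambda>p. f p \<odot>\<^bsub>P\<^esub> \<beta> p) (?supp f) \<in> carrier P"
      using \<beta> by (auto simp: free_mod_carrier intro!: P.finsum_closed)
    fix f' assume f': "f' \<in> carrier (free_mod K X)"
    let ?I = "?supp f \<union> ?supp f'"
    have I: "finite ?I" "?I \<subseteq> X" "?supp (f \<oplus>\<^bsub>free_mod K X\<^esub> f') \<subseteq> ?I"
      using f f' by (auto simp: free_mod_carrier free_mod_simps)
    have "finsum P (\<lambda>p. (f \<oplus>\<^bsub>free_mod K X\<^esub> f') p \<odot>\<^bsub>P\<^esub> \<beta> p) ?I =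
        finsum P (\<lambda>p. f p \<odot>\<^bsub>P\<^esub> \<beta> p \<oplus>\<^bsub>P\<^esub> f' p \<odot>\<^bsub>P\<^esub> \<beta> p) ?I"
      using f f' \<beta> I
      by (intro P.finsum_cong') (auto simp: free_mod_carrier free_mod_simps P.smult_l_distr subset_iff)
    also have "\<dots> = finsum P (\<lambda>p. f p \<odot>\<^bsub>P\<^esub> \<beta> p) ?I \<oplus>\<^bsub>P\<^esub> finsum P (\<lambda>p. f' p \<odot>\<^bsub>P\<^esub> \<beta> p) ?I"
      using f f' \<beta> I by (intro P.finsum_addf) (auto simp: free_mod_carrier subset_iff)
    finally show "finsum P (\<lambda>p. (f \<oplus>\<^bsub>free_mod K X\<^esub> f') p \<odot>\<^bsub>P\<^esub> \<beta> p) (?supp (f \<oplus>\<^bsub>free_mod K X\<^esub> f')) =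
        finsum P (\<lambda>p. f p \<odot>\<^bsub>P\<^esub> \<beta> p) (?supp f) \<oplus>\<^bsub>P\<^esub> finsum P (\<lambda>p. f' p \<odot>\<^bsub>P\<^esub> \<beta> p) (?supp f')"
      using f f' I g[of "f \<oplus>\<^bsub>free_mod K X\<^esub> f'" ?I] g[of f ?I] g[of f' ?I]
      by (simp add: g_def)
  next
    fix c f assume c: "c \<in> carrier K" and f: "f \<in> carrier (free_mod K X)"
    let ?I = "?supp f"
    have I: "finite ?I" "?I \<subseteq> X" "?supp (c \<odot>\<^bsub>free_mod K X\<^esub> f) \<subseteq> ?I"
      using c f by (auto simp: free_mod_carrier free_mod_simps)
    have "finsum P (\<lambda>p. (c \<odot>\<^bsub>free_mod K X\<^esub> f) p \<odot>\<^bsub>P\<^esub> \<beta> p) ?I =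
        finsum P (\<lambda>p. c \<odot>\<^bsub>P\<^esub> (f p \<odot>\<^bsub>P\<^esub> \<beta> p)) ?I"
      using c f \<beta> I
      by (intro P.finsum_cong') (auto simp: free_mod_carrier free_mod_simps P.smult_assoc1 subset_iff)
    also have "\<dots> = c \<odot>\<^bsub>P\<^esub> finsum P (\<lambda>p. f p \<odot>\<^bsub>P\<^esub> \<beta> p) ?I"
      using c f \<beta> I by (intro P.finsum_smult_ldistr[symmetric]) (auto simp: free_mod_carrier subset_iff)
    finally show "finsum P (\<lambda>p. (c \<odot>\<^bsub>free_mod K X\<^esub> f) p \<odot>\<^bsub>P\<^esub> \<beta> p) (?supp (c \<odot>\<^bsub>free_mod K X\<^esub> f)) =
        c \<odot>\<^bsub>P\<^esub> finsum P (\<lambda>p. f p \<odot>\<^bsub>P\<^esub> \<beta> p) (?supp f)"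
      using c f I g[of "c \<odot>\<^bsub>free_mod K X\<^esub> f" ?I] by (simp add: g_def)
  qed
  moreover have "g (basis_vec K p) = \<beta> p" if "p \<in> X" for p
  proof -
    have "g (basis_vec K p) = finsum P (\<lambda>q. basis_vec K p q \<odot>\<^bsub>P\<^esub> \<beta> q) {p}"
      using that by (intro g) (auto simp: basis_vec_closed, auto simp: basis_vec_def split: if_splits)
    also have "\<dots> = \<beta> p"
      using that \<beta> by (simp add: basis_vec_def P.add.finprod_insert)
    finally show ?thesis .
  qed
  ultimately show ?thesis by blast
qed

end


section \<open>Tensor products of modules\<close>

definition bilinear_map ::
  "('k, 'x) ring_scheme \<Rightarrow> ('k, 'm) module \<Rightarrow> ('k, 'n) module \<Rightarrow> ('k, 'p) module \<Rightarrow>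
   ('m \<Rightarrow> 'n \<Rightarrow> 'p) \<Rightarrow> bool" where
  "bilinear_map K M N P \<beta> \<longleftrightarrow>
     (\<forall>m\<in>carrier M. \<forall>n\<in>carrier N. \<beta> m n \<in> carrier P) \<and>
     (\<forall>m\<in>carrier M. \<forall>m'\<in>carrier M. \<forall>n\<in>carrier N. \<beta> (m \<oplus>\<^bsub>M\<^esub> m') n = \<beta> m n \<oplus>\<^bsub>P\<^esub> \<beta> m' n) \<and>
     (\<forall>m\<in>carrier M. \<forall>n\<in>carrier N. \<forall>n'\<in>carrier N. \<beta> m (n \<oplus>\<^bsub>N\<^esub> n') = \<beta> m n \<oplus>\<^bsub>P\<^esub> \<beta> m n') \<and>
     (\<forall>c\<in>carrier K. \<forall>m\<in>carrier M. \<forall>n\<in>carrier N. \<beta> (c \<odot>\<^bsub>M\<^esub> m) n = c \<odot>\<^bsub>P\<^esub> \<beta> m n) \<and>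
     (\<forall>c\<in>carrier K. \<forall>m\<in>carrier M. \<forall>n\<in>carrier N. \<beta> m (c \<odot>\<^bsub>N\<^esub> n) = c \<odot>\<^bsub>P\<^esub> \<beta> m n)"

lemma bilinear_mapD:
  assumes "bilinear_map K M N P \<beta>"
  shows "\<lbrakk>m \<in> carrier M; n \<in> carrier N\<rbrakk> \<Longrightarrow> \<beta> m n \<in> carrier P"
    and "\<lbrakk>m \<in> carrier M; m' \<in> carrier M; n \<in> carrier N\<rbrakk> \<Longrightarrow>
      \<beta> (m \<oplus>\<^bsub>M\<^esub> m') n = \<beta> m n \<oplus>\<^bsub>P\<^esub> \<beta> m' n"
    and "\<lbrakk>m \<in> carrier M; n \<in> carrier N; n' \<in> carrier N\<rbrakk> \<Longrightarrow>
      \<beta> m (n \<oplus>\<^bsub>N\<^esub> n') = \<beta> m n \<oplus>\<^bsub>P\<^esub> \<beta> m n'"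
    and "\<lbrakk>c \<in> carrier K; m \<in> carrier M; n \<in> carrier N\<rbrakk> \<Longrightarrow>
      \<beta> (c \<odot>\<^bsub>M\<^esub> m) n = c \<odot>\<^bsub>P\<^esub> \<beta> m n"
    and "\<lbrakk>c \<in> carrier K; m \<in> carrier M; n \<in> carrier N\<rbrakk> \<Longrightarrow>
      \<beta> m (c \<odot>\<^bsub>N\<^esub> n) = c \<odot>\<^bsub>P\<^esub> \<beta> m n"
  using assms by (simp_all add: bilinear_map_def)

context
  fixes K :: "('k, 'x) ring_scheme" and M :: "('k, 'm) module" and N :: "('k, 'n) module"
  assumes M: "module K M" and N: "module K N"
begin

interpretation M: module K M by (rule M)
interpretation N: module K N by (rule N)
interpretation F: module K "free_prod K M N" by (rule free_module[OF M.is_cring])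

lemma tensor_mod_quotient: "tensor_mod K M N = quotient_mod (free_prod K M N) (bilinear_submodule K M N)"
  by (simp add: tensor_mod_def quotient_mod_def Let_def)

lemma bilinear_relationsI:
  "\<lbrakk>m \<in> carrier M; m' \<in> carrier M; n \<in> carrier N\<rbrakk> \<Longrightarrow>
    basis_vec K (m \<oplus>\<^bsub>M\<^esub> m', n) \<ominus>\<^bsub>free_prod K M N\<^esub>
      (basis_vec K (m, n) \<oplus>\<^bsub>free_prod K M N\<^esub> basis_vec K (m', n)) \<in> bilinear_relations K M N"
  "\<lbrakk>m \<in> carrier M; n \<in> carrier N; n' \<in> carrier N\<rbrakk> \<Longrightarrow>
    basis_vec K (m, n \<oplus>\<^bsub>N\<^esub> n') \<ominus>\<^bsub>free_prod K M N\<^esub>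
      (basis_vec K (m, n) \<oplus>\<^bsub>free_prod K M N\<^esub> basis_vec K (m, n')) \<in> bilinear_relations K M N"
  "\<lbrakk>c \<in> carrier K; m \<in> carrier M; n \<in> carrier N\<rbrakk> \<Longrightarrow>
    basis_vec K (c \<odot>\<^bsub>M\<^esub> m, n) \<ominus>\<^bsub>free_prod K M N\<^esub>
      c \<odot>\<^bsub>free_prod K M N\<^esub> basis_vec K (m, n) \<in> bilinear_relations K M N"
  "\<lbrakk>c \<in> carrier K; m \<in> carrier M; n \<in> carrier N\<rbrakk> \<Longrightarrow>
    basis_vec K (m, c \<odot>\<^bsub>N\<^esub> n) \<ominus>\<^bsub>free_prod K M N\<^esub>
      c \<odot>\<^bsub>free_prod K M N\<^esub> basis_vec K (m, n) \<in> bilinear_relations K M N"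
  unfolding bilinear_relations_def Let_def by blast+

lemma bilinear_relations_closed: "bilinear_relations K M N \<subseteq> carrier (free_prod K M N)"
  unfolding bilinear_relations_def Let_def
  by (auto intro!: F.minus_closed F.a_closed F.smult_closed basis_vec_closed[OF M.is_cring])

lemma bilinear_submodule: "submodule (bilinear_submodule K M N) K (free_prod K M N)"
proof (rule F.submoduleI)
  show "bilinear_submodule K M N \<subseteq> carrier (free_prod K M N)"
    using F.carrier_is_submodule bilinear_relations_closed by (auto simp: bilinear_submodule_def)
  show "\<zero>\<^bsub>free_prod K M N\<^esub> \<in> bilinear_submodule K M N"
    by (auto simp: bilinear_submodule_def dest: subgroup.one_closed[OF submodule.axioms(1)])
qed (auto simp: bilinear_submodule_def intro: F.submoduleE(3-5))

lemma relations_in_submodule: "x \<in> bilinear_relations K M N \<Longrightarrow> x \<in> bilinear_submodule K M N"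
  by (auto simp: bilinear_submodule_def)

lemma tensor_module: "module K (tensor_mod K M N)"
  unfolding tensor_mod_quotient
  by (rule quotient_module[OF F.module_axioms bilinear_submodule])

lemma tens_closed: "\<lbrakk>m \<in> carrier M; n \<in> carrier N\<rbrakk> \<Longrightarrow> tens K M N m n \<in> carrier (tensor_mod K M N)"
  unfolding tensor_mod_quotient tens_def
  by (intro coset_closed[OF F.module_axioms bilinear_submodule] basis_vec_closed[OF M.is_cring]) auto

text \<open>
  The linear extension of \<open>\<beta>\<close> to the free module kills the bilinearity relations, hence the submodule
  that they generate, and so descends to the quotient.
\<close>

lemma tensor_lift_exists:
  assumes P: "module K P" and \<beta>: "bilinear_map K M N P \<beta>"
  shows "\<exists>h \<in> lin_hom K (tensor_mod K M N) P. \<forall>m\<in>carrier M. \<forall>n\<in>carrier N. h (tens K M N m n) = \<beta> m n"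
proof -
  interpret P: module K P by fact
  have "\<exists>g \<in> lin_hom K (free_prod K M N) P.
      \<forall>p\<in>carrier M \<times> carrier N. g (basis_vec K p) = (\<lambda>(m, n). \<beta> m n) p"
    using \<beta> by (intro free_lift[OF M.is_cring P]) (auto simp: bilinear_map_def)
  then obtain g where g: "g \<in> lin_hom K (free_prod K M N) P"
    and g\<beta>: "\<And>m n. \<lbrakk>m \<in> carrier M; n \<in> carrier N\<rbrakk> \<Longrightarrow> g (basis_vec K (m, n)) = \<beta> m n"
    by auto
  note g_simps = lin_hom_minus[OF F.module_axioms P g] lin_hom_add[OF g] lin_hom_smult[OF g] g\<beta>
    basis_vec_closed[OF M.is_cring]
  let ?ker = "{x \<in> carrier (free_prod K M N). g x = \<zero>\<^bsub>P\<^esub>}"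
  have "submodule ?ker K (free_prod K M N)"
  proof (rule F.submoduleI)
    fix x assume "x \<in> ?ker"
    then show "\<ominus>\<^bsub>free_prod K M N\<^esub> x \<in> ?ker"
      using lin_hom_minus[OF F.module_axioms P g, of "\<zero>\<^bsub>free_prod K M N\<^esub>" x]
        lin_hom_zero[OF F.module_axioms P g]
      by (simp add: F.minus_eq) (simp add: P.minus_eq)
  qed (auto simp: lin_hom_zero[OF F.module_axioms P g] lin_hom_add[OF g] lin_hom_smult[OF g])
  moreover have "bilinear_relations K M N \<subseteq> ?ker"
  proof
    fix x assume x: "x \<in> bilinear_relations K M N"
    then have "g x = \<zero>\<^bsub>P\<^esub>"
      unfolding bilinear_relations_def Let_def
      by (elim UnE CollectE exE conjE)
        (simp_all add: g_simps bilinear_mapD[OF \<beta>] P.minus_eq P.r_neg)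
    then show "x \<in> ?ker" using bilinear_relations_closed x by blast
  qed
  ultimately have ker: "g x = \<zero>\<^bsub>P\<^esub>" if "x \<in> bilinear_submodule K M N" for x
    using that by (auto simp: bilinear_submodule_def)
  obtain h where "h \<in> lin_hom K (tensor_mod K M N) P"
    "\<forall>x\<in>carrier (free_prod K M N). h (bilinear_submodule K M N +>\<^bsub>free_prod K M N\<^esub> x) = g x"
    using quotient_lift[OF F.module_axioms bilinear_submodule P g ker]
    unfolding tensor_mod_quotient by blast
  then show ?thesis
    using g\<beta> by (intro bexI[of _ h]) (auto simp: tens_def basis_vec_closed[OF M.is_cring])
qed

lemma tens_bilinear: "bilinear_map K M N (tensor_mod K M N) (tens K M N)"
proof -
  note Fm = F.module_axioms bilinear_submodule
  note bv = basis_vec_closed[OF M.is_cring]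
  interpret Sub: abelian_subgroup "bilinear_submodule K M N" "free_prod K M N"
    by (rule abelian_subgroupI3)
      (auto intro: F.abelian_group_axioms additive_subgroupI submodule.axioms(1)[OF bilinear_submodule])
  have eq: "bilinear_submodule K M N +>\<^bsub>free_prod K M N\<^esub> x = bilinear_submodule K M N +>\<^bsub>free_prod K M N\<^esub> y"
    if "x \<ominus>\<^bsub>free_prod K M N\<^esub> y \<in> bilinear_relations K M N"
      "x \<in> carrier (free_prod K M N)" "y \<in> carrier (free_prod K M N)" for x y
    using relations_in_submodule[OF that(1)] that(2,3)
    by (metis Sub.a_repr_independence' Sub.a_rcos_module a_minus_def)
  show ?thesis
    unfolding bilinear_map_def
  proof (intro conjI ballI tens_closed)
    fix m m' n assume "m \<in> carrier M" "m' \<in> carrier M" "n \<in> carrier N"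
    then show "tens K M N (m \<oplus>\<^bsub>M\<^esub> m') n =
        tens K M N m n \<oplus>\<^bsub>tensor_mod K M N\<^esub> tens K M N m' n"
      unfolding tens_def tensor_mod_quotient
      by (simp add: coset_add[OF Fm] bv) (intro eq bilinear_relationsI; simp add: bv)
  next
    fix m n n' assume "m \<in> carrier M" "n \<in> carrier N" "n' \<in> carrier N"
    then show "tens K M N m (n \<oplus>\<^bsub>N\<^esub> n') =
        tens K M N m n \<oplus>\<^bsub>tensor_mod K M N\<^esub> tens K M N m n'"
      unfolding tens_def tensor_mod_quotient
      by (simp add: coset_add[OF Fm] bv) (intro eq bilinear_relationsI; simp add: bv)
  next
    fix c m n assume "c \<in> carrier K" "m \<in> carrier M" "n \<in> carrier N"
    then show "tens K M N (c \<odot>\<^bsub>M\<^esub> m) n = c \<odot>\<^bsub>tensor_mod K M N\<^esub> tens K M N m n"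
      "tens K M N m (c \<odot>\<^bsub>N\<^esub> n) = c \<odot>\<^bsub>tensor_mod K M N\<^esub> tens K M N m n"
      unfolding tens_def tensor_mod_quotient
      by (simp_all add: coset_smult[OF Fm] bv) (intro eq bilinear_relationsI; simp add: bv)+
  qed
qed

lemma tens_add_left: "\<lbrakk>m \<in> carrier M; m' \<in> carrier M; n \<in> carrier N\<rbrakk> \<Longrightarrow>
    tens K M N (m \<oplus>\<^bsub>M\<^esub> m') n = tens K M N m n \<oplus>\<^bsub>tensor_mod K M N\<^esub> tens K M N m' n"
  and tens_add_right: "\<lbrakk>m \<in> carrier M; n \<in> carrier N; n' \<in> carrier N\<rbrakk> \<Longrightarrow>
    tens K M N m (n \<oplus>\<^bsub>N\<^esub> n') = tens K M N m n \<oplus>\<^bsub>tensor_mod K M N\<^esub> tens K M N m n'"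
  and tens_smult_left: "\<lbrakk>c \<in> carrier K; m \<in> carrier M; n \<in> carrier N\<rbrakk> \<Longrightarrow>
    tens K M N (c \<odot>\<^bsub>M\<^esub> m) n = c \<odot>\<^bsub>tensor_mod K M N\<^esub> tens K M N m n"
  and tens_smult_right: "\<lbrakk>c \<in> carrier K; m \<in> carrier M; n \<in> carrier N\<rbrakk> \<Longrightarrow>
    tens K M N m (c \<odot>\<^bsub>N\<^esub> n) = c \<odot>\<^bsub>tensor_mod K M N\<^esub> tens K M N m n"
  using tens_bilinear by (auto simp: bilinear_map_def)

text \<open>
  Scalar multiples of pure tensors are pure, and so is zero.  Therefore only sums are left to treat,
  and properties compatible with addition reduce to pure tensors.
\<close>

lemma tensor_induct [consumes 1, case_names tens add]:
  assumes "X \<in> carrier (tensor_mod K M N)"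
    and tens: "\<And>m n. \<lbrakk>m \<in> carrier M; n \<in> carrier N\<rbrakk> \<Longrightarrow> S (tens K M N m n)"
    and add: "\<And>X Y. \<lbrakk>X \<in> carrier (tensor_mod K M N); Y \<in> carrier (tensor_mod K M N); S X; S Y\<rbrakk> \<Longrightarrow> S (X \<oplus>\<^bsub>tensor_mod K M N\<^esub> Y)"
  shows "S X"
proof -
  note Fm = F.module_axioms bilinear_submodule
  interpret T: module K "tensor_mod K M N" by (rule tensor_module)
  obtain f where f: "f \<in> carrier (free_prod K M N)" "X = bilinear_submodule K M N +>\<^bsub>free_prod K M N\<^esub> f"
    using assms(1) unfolding tensor_mod_quotient quotient_carrier[OF Fm] by blast
  have "bilinear_submodule K M N +>\<^bsub>free_prod K M N\<^esub> f \<in> carrier (tensor_mod K M N) \<and> S (bilinear_submodule K M N +>\<^bsub>free_prod K M N\<^esub> f)"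
    using f(1)
  proof (induction f rule: free_mod_induct[OF M.is_cring, consumes 1, case_names zero smult add])
    \<comment> \<open>The zero tensor is the pure tensor of two zeros, which \<open>tens\<close> covers.\<close>
    case zero
    have "bilinear_submodule K M N +>\<^bsub>free_prod K M N\<^esub> \<zero>\<^bsub>free_prod K M N\<^esub> = \<zero>\<^bsub>tensor_mod K M N\<^esub>"
      by (simp add: coset_zero[OF Fm] tensor_mod_quotient)
    also have "\<dots> = \<zero>\<^bsub>K\<^esub> \<odot>\<^bsub>tensor_mod K M N\<^esub> tens K M N \<zero>\<^bsub>M\<^esub> \<zero>\<^bsub>N\<^esub>" by (simp add: tens_closed)
    also have "\<dots> = tens K M N \<zero>\<^bsub>M\<^esub> \<zero>\<^bsub>N\<^esub>"
      using tens_smult_left[of "\<zero>\<^bsub>K\<^esub>" "\<zero>\<^bsub>M\<^esub>" "\<zero>\<^bsub>N\<^esub>"] by simp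
    finally show ?case using tens[of "\<zero>\<^bsub>M\<^esub>" "\<zero>\<^bsub>N\<^esub>"] tens_closed[of "\<zero>\<^bsub>M\<^esub>" "\<zero>\<^bsub>N\<^esub>"] by simp
  next
    case (smult c p)
    then obtain m n where p: "p = (m, n)" "m \<in> carrier M" "n \<in> carrier N" by auto
    have "bilinear_submodule K M N +>\<^bsub>free_prod K M N\<^esub> (c \<odot>\<^bsub>free_prod K M N\<^esub> basis_vec K p) = c \<odot>\<^bsub>tensor_mod K M N\<^esub> tens K M N m n"
      using smult p
      by (simp add: tens_def tensor_mod_quotient coset_smult[OF Fm] basis_vec_closed[OF M.is_cring])
    then have "bilinear_submodule K M N +>\<^bsub>free_prod K M N\<^esub> (c \<odot>\<^bsub>free_prod K M N\<^esub> basis_vec K p) = tens K M N (c \<odot>\<^bsub>M\<^esub> m) n"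
      using smult p by (simp add: tens_smult_left)
    then show ?case using smult p tens tens_closed by simp
  next
    case (add g h)
    then have "bilinear_submodule K M N +>\<^bsub>free_prod K M N\<^esub> (g \<oplus>\<^bsub>free_prod K M N\<^esub> h) =
        (bilinear_submodule K M N +>\<^bsub>free_prod K M N\<^esub> g) \<oplus>\<^bsub>tensor_mod K M N\<^esub> (bilinear_submodule K M N +>\<^bsub>free_prod K M N\<^esub> h)"
      by (simp add: tensor_mod_quotient coset_add[OF Fm])
    with add.IH assms(3) show ?case by simp
  qed
  with f show ?thesis by simp
qed

lemma tensor_hom_eqI:
  assumes h: "h \<in> lin_hom K (tensor_mod K M N) P" and h': "h' \<in> lin_hom K (tensor_mod K M N) P"
    and eq: "\<And>m n. \<lbrakk>m \<in> carrier M; n \<in> carrier N\<rbrakk> \<Longrightarrow> h (tens K M N m n) = h' (tens K M N m n)"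
  shows "h = h'"
proof
  fix X
  show "h X = h' X"
  proof (cases "X \<in> carrier (tensor_mod K M N)")
    case True
    then show ?thesis
      by (induction rule: tensor_induct) (simp_all add: eq lin_hom_add[OF h] lin_hom_add[OF h'])
  qed (simp add: lin_hom_undefined[OF h] lin_hom_undefined[OF h'])
qed

lemma
  assumes P: "module K P" and \<beta>: "bilinear_map K M N P \<beta>"
  shows tensor_lift_hom: "tensor_lift K M N P \<beta> \<in> lin_hom K (tensor_mod K M N) P"
    and tensor_lift_tens:
      "\<lbrakk>m \<in> carrier M; n \<in> carrier N\<rbrakk> \<Longrightarrow> tensor_lift K M N P \<beta> (tens K M N m n) = \<beta> m n"
proof -
  have "\<exists>!h. h \<in> lin_hom K (tensor_mod K M N) P \<and>
      (\<forall>m\<in>carrier M. \<forall>n\<in>carrier N. h (tens K M N m n) = \<beta> m n)"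
    using tensor_lift_exists[OF P \<beta>] by (auto intro!: tensor_hom_eqI)
  from theI'[OF this] show "tensor_lift K M N P \<beta> \<in> lin_hom K (tensor_mod K M N) P"
    "\<lbrakk>m \<in> carrier M; n \<in> carrier N\<rbrakk> \<Longrightarrow> tensor_lift K M N P \<beta> (tens K M N m n) = \<beta> m n"
    by (simp_all add: tensor_lift_def)
qed

end


section \<open>Products on tensor products\<close>

lemma tensor_alg_simps [simp]:
  "carrier (tensor_alg K M N) = carrier (tensor_mod K M N)"
  "zero (tensor_alg K M N) = zero (tensor_mod K M N)"
  "add (tensor_alg K M N) = add (tensor_mod K M N)"
  "smult (tensor_alg K M N) = smult (tensor_mod K M N)"
  "one (tensor_alg K M N) = tens K M N \<one>\<^bsub>M\<^esub> \<one>\<^bsub>N\<^esub>"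
  by (simp_all add: tensor_alg_def)

lemma tensor_alg_module: "\<lbrakk>module K M; module K N\<rbrakk> \<Longrightarrow> module K (tensor_alg K M N)"
  by (rule module_cong[OF tensor_module]) simp_all

context
  fixes K :: "('k, 'x) ring_scheme" and A :: "('k, 'a) module" and B :: "('k, 'b) module"
  assumes A: "algebra K A" and B: "algebra K B"
begin

interpretation A: algebra K A by (rule A)
interpretation B: algebra K B by (rule B)
interpretation T: module K "tensor_mod K A B" by (rule tensor_module[OF A.module B.module])

private lemmas AB = A.module B.module
private lemmas tens_simps = tens_closed[OF AB] tens_add_left[OF AB] tens_add_right[OF AB]
  tens_smult_left[OF AB] tens_smult_right[OF AB]

text \<open>
  The inner of the two nested lifts in the product of \<open>tensor_alg\<close>: left multiplication by \<open>a \<otimes> b\<close>.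
\<close>

private definition mult_by :: "'a \<Rightarrow> 'b \<Rightarrow> ('a \<times> 'b \<Rightarrow> 'k) set \<Rightarrow> ('a \<times> 'b \<Rightarrow> 'k) set" where
  "mult_by a b = tensor_lift K A B (tensor_mod K A B)
     (\<lambda>a' b'. tens K A B (a \<otimes>\<^bsub>A\<^esub> a') (b \<otimes>\<^bsub>B\<^esub> b'))"

private lemma mult_by:
  assumes "a \<in> carrier A" "b \<in> carrier B"
  shows "mult_by a b \<in> lin_hom K (tensor_mod K A B) (tensor_mod K A B)"
    and "\<lbrakk>a' \<in> carrier A; b' \<in> carrier B\<rbrakk> \<Longrightarrow>
      mult_by a b (tens K A B a' b') = tens K A B (a \<otimes>\<^bsub>A\<^esub> a') (b \<otimes>\<^bsub>B\<^esub> b')"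
proof -
  have bil: "bilinear_map K A B (tensor_mod K A B) (\<lambda>a' b'. tens K A B (a \<otimes>\<^bsub>A\<^esub> a') (b \<otimes>\<^bsub>B\<^esub> b'))"
    using assms
    by (simp add: bilinear_map_def tens_simps A.r_distr B.r_distr
        A.smult_mult_right B.smult_mult_right)
  show "mult_by a b \<in> lin_hom K (tensor_mod K A B) (tensor_mod K A B)"
    and "\<lbrakk>a' \<in> carrier A; b' \<in> carrier B\<rbrakk> \<Longrightarrow>
      mult_by a b (tens K A B a' b') = tens K A B (a \<otimes>\<^bsub>A\<^esub> a') (b \<otimes>\<^bsub>B\<^esub> b')"
    unfolding mult_by_def
    by (rule tensor_lift_hom[OF AB T.module_axioms bil] tensor_lift_tens[OF AB T.module_axioms bil];
        assumption)+
qed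

text \<open>
  Bilinearity in \<open>(a, b)\<close> is an additive property of \<open>Y\<close>, so it is enough to know it for pure \<open>Y\<close>, where it
  is bilinearity of the two products.
\<close>

private lemma mult_by_bilinear:
  assumes "Y \<in> carrier (tensor_mod K A B)"
  shows "bilinear_map K A B (tensor_mod K A B) (\<lambda>a b. mult_by a b Y)"
  using assms
proof (induction rule: tensor_induct[OF AB, consumes 1, case_names tens add])
  case (tens a b)
  then show ?case
    by (simp add: bilinear_map_def mult_by tens_simps A.l_distr B.l_distr
        A.smult_assoc2 B.smult_assoc2)
next
  case (add X Y)
  then show ?case
    unfolding bilinear_map_def
    by (simp add: mult_by lin_hom_add[OF mult_by(1)] T.smult_r_distr
        abelian_group_add4[OF T.abelian_group_axioms])
qed

lemma tensor_alg_mult: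
  "X \<otimes>\<^bsub>tensor_alg K A B\<^esub> Y = tensor_lift K A B (tensor_mod K A B) (\<lambda>a b. mult_by a b Y) X"
  by (simp add: tensor_alg_def mult_by_def)

lemma tensor_mult_tens:
  "\<lbrakk>a \<in> carrier A; b \<in> carrier B; a' \<in> carrier A; b' \<in> carrier B\<rbrakk> \<Longrightarrow>
    tens K A B a b \<otimes>\<^bsub>tensor_alg K A B\<^esub> tens K A B a' b' = tens K A B (a \<otimes>\<^bsub>A\<^esub> a') (b \<otimes>\<^bsub>B\<^esub> b')"
  by (simp add: tensor_alg_mult mult_by mult_by_bilinear tens_closed[OF AB]
      tensor_lift_tens[OF AB T.module_axioms])

lemma tensor_mult_add_left:
  "\<lbrakk>X \<in> carrier (tensor_mod K A B); X' \<in> carrier (tensor_mod K A B); Y \<in> carrier (tensor_mod K A B)\<rbrakk> \<Longrightarrow>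
    (X \<oplus>\<^bsub>tensor_mod K A B\<^esub> X') \<otimes>\<^bsub>tensor_alg K A B\<^esub> Y =
      X \<otimes>\<^bsub>tensor_alg K A B\<^esub> Y \<oplus>\<^bsub>tensor_mod K A B\<^esub> X' \<otimes>\<^bsub>tensor_alg K A B\<^esub> Y"
  unfolding tensor_alg_mult
  by (rule lin_hom_add[OF tensor_lift_hom[OF AB T.module_axioms mult_by_bilinear]])

lemma tensor_mult_closed:
  "\<lbrakk>X \<in> carrier (tensor_mod K A B); Y \<in> carrier (tensor_mod K A B)\<rbrakk> \<Longrightarrow>
    X \<otimes>\<^bsub>tensor_alg K A B\<^esub> Y \<in> carrier (tensor_mod K A B)"
  unfolding tensor_alg_mult
  by (rule lin_hom_closed[OF tensor_lift_hom[OF AB T.module_axioms mult_by_bilinear]])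

lemma tensor_mult_add_right:
  assumes "X \<in> carrier (tensor_mod K A B)" "Y \<in> carrier (tensor_mod K A B)" "Y' \<in> carrier (tensor_mod K A B)"
  shows "X \<otimes>\<^bsub>tensor_alg K A B\<^esub> (Y \<oplus>\<^bsub>tensor_mod K A B\<^esub> Y') =
      X \<otimes>\<^bsub>tensor_alg K A B\<^esub> Y \<oplus>\<^bsub>tensor_mod K A B\<^esub> X \<otimes>\<^bsub>tensor_alg K A B\<^esub> Y'"
  using assms(1)
proof (induction rule: tensor_induct[OF AB, consumes 1, case_names tens add])
  case (tens a b)
  have "tens K A B a b \<otimes>\<^bsub>tensor_alg K A B\<^esub> Z = mult_by a b Z"
    if "Z \<in> carrier (tensor_mod K A B)" for Z
    using tens that
    by (simp add: tensor_alg_mult tensor_lift_tens[OF AB T.module_axioms mult_by_bilinear])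
  then show ?case using tens assms(2,3) by (simp add: lin_hom_add[OF mult_by(1)])
next
  case (add X X')
  then show ?case
    using assms(2,3)
    by (simp add: tensor_mult_add_left tensor_mult_closed abelian_group_add4[OF T.abelian_group_axioms])
qed

end


section \<open>Base change\<close>

lemma base_change_simps [simp]:
  "carrier (base_change K M R) = carrier (tensor_mod K M R)"
  "zero (base_change K M R) = zero (tensor_mod K M R)"
  "add (base_change K M R) = add (tensor_mod K M R)"
  "mult (base_change K M R) = mult (tensor_alg K M R)"
  by (simp_all add: base_change_def Let_def)

text \<open>
  An \<open>R\<close>-module regarded as a \<open>K\<close>-module through the structure map \<open>c \<mapsto> c 1\<close> of \<open>R\<close>.
\<close>

definition restrict_scalars ::
  "('k, 'x) ring_scheme \<Rightarrow> ('k, 'r) module \<Rightarrow> ('r, 'p) module \<Rightarrow> ('k, 'p) module" where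
  "restrict_scalars K R P = \<lparr>carrier = carrier P, mult = mult P, one = one P, zero = zero P,
     add = add P, smult = (\<lambda>c x. (c \<odot>\<^bsub>R\<^esub> \<one>\<^bsub>R\<^esub>) \<odot>\<^bsub>P\<^esub> x)\<rparr>"

lemma restrict_scalars_simps [simp]:
  "carrier (restrict_scalars K R P) = carrier P"
  "zero (restrict_scalars K R P) = zero P"
  "add (restrict_scalars K R P) = add P"
  "smult (restrict_scalars K R P) c x = (c \<odot>\<^bsub>R\<^esub> \<one>\<^bsub>R\<^esub>) \<odot>\<^bsub>P\<^esub> x"
  by (simp_all add: restrict_scalars_def)

lemma restrict_scalars_module:
  assumes R: "algebra K R" and P: "module R P"
  shows "module K (restrict_scalars K R P)"
proof -
  interpret R: algebra K R by fact
  interpret P: module R P by fact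
  have "abelian_group (restrict_scalars K R P)"
    by (rule abelian_group_cong[OF P.abelian_group_axioms]) simp_all
  moreover have "(c \<otimes>\<^bsub>K\<^esub> d) \<odot>\<^bsub>R\<^esub> \<one>\<^bsub>R\<^esub> = (c \<odot>\<^bsub>R\<^esub> \<one>\<^bsub>R\<^esub>) \<otimes>\<^bsub>R\<^esub> (d \<odot>\<^bsub>R\<^esub> \<one>\<^bsub>R\<^esub>)"
    if "c \<in> carrier K" "d \<in> carrier K" for c d
    using that by (simp add: R.smult_assoc1 R.smult_assoc2)
  ultimately show ?thesis
    using R.R_cring
    by (intro moduleI)
      (simp_all add: P.smult_l_distr P.smult_r_distr P.smult_assoc1 R.smult_l_distr)
qed

context
  fixes K :: "('k, 'x) ring_scheme" and M :: "('k, 'm) module" and R :: "('k, 'r) module"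
  assumes M: "module K M" and R: "algebra K R"
begin

interpretation M: module K M by (rule M)
interpretation R: algebra K R by (rule R)
interpretation T: module K "tensor_mod K M R" by (rule tensor_module[OF M R.module])

private lemmas MR = M R.module
private lemmas tens_MR = tens_closed[OF MR] tens_add_left[OF MR] tens_add_right[OF MR]
  tens_smult_left[OF MR] tens_smult_right[OF MR]

lemma base_change_smult_hom:
  assumes r: "r \<in> carrier R"
  shows "(\<lambda>X. r \<odot>\<^bsub>base_change K M R\<^esub> X) \<in> lin_hom K (tensor_mod K M R) (tensor_mod K M R)"
    and "\<lbrakk>m \<in> carrier M; s \<in> carrier R\<rbrakk> \<Longrightarrow>
      r \<odot>\<^bsub>base_change K M R\<^esub> tens K M R m s = tens K M R m (r \<otimes>\<^bsub>R\<^esub> s)"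
proof -
  have bil: "bilinear_map K M R (tensor_alg K M R) (\<lambda>m s. tens K M R m (r \<otimes>\<^bsub>R\<^esub> s))"
    using r by (simp add: bilinear_map_def tens_MR R.r_distr R.smult_mult_right)
  have "smult (base_change K M R) r =
      tensor_lift K M R (tensor_alg K M R) (\<lambda>m s. tens K M R m (r \<otimes>\<^bsub>R\<^esub> s))"
    by (simp add: base_change_def Let_def)
  moreover have "lin_hom K (tensor_mod K M R) (tensor_alg K M R) =
      lin_hom K (tensor_mod K M R) (tensor_mod K M R)"
    by (rule lin_hom_cong) simp_all
  ultimately show "(\<lambda>X. r \<odot>\<^bsub>base_change K M R\<^esub> X) \<in> lin_hom K (tensor_mod K M R) (tensor_mod K M R)"
    and "\<lbrakk>m \<in> carrier M; s \<in> carrier R\<rbrakk> \<Longrightarrow>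
      r \<odot>\<^bsub>base_change K M R\<^esub> tens K M R m s = tens K M R m (r \<otimes>\<^bsub>R\<^esub> s)"
    using tensor_lift_hom[OF MR tensor_alg_module[OF MR] bil]
      tensor_lift_tens[OF MR tensor_alg_module[OF MR] bil]
    by simp_all
qed

lemmas base_change_smult_closed = lin_hom_closed[OF base_change_smult_hom(1)]
lemmas base_change_smult_add = lin_hom_add[OF base_change_smult_hom(1)]
lemmas base_change_smult_tens = base_change_smult_hom(2)

lemma base_change_module: "module R (base_change K M R)"
proof (rule moduleI)
  show "cring R" by (rule R.M_cring)
  show "abelian_group (base_change K M R)"
    by (rule abelian_group_cong[OF T.abelian_group_axioms]) simp_all
  fix r X assume r: "r \<in> carrier R" and X: "X \<in> carrier (base_change K M R)"
  then show "r \<odot>\<^bsub>base_change K M R\<^esub> X \<in> carrier (base_change K M R)"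
    by (simp add: base_change_smult_closed)
  show "r \<odot>\<^bsub>base_change K M R\<^esub> (X \<oplus>\<^bsub>base_change K M R\<^esub> Y) =
      r \<odot>\<^bsub>base_change K M R\<^esub> X \<oplus>\<^bsub>base_change K M R\<^esub> r \<odot>\<^bsub>base_change K M R\<^esub> Y"
    if "Y \<in> carrier (base_change K M R)" for Y
    using r X that by (simp add: base_change_smult_add)
  have X: "X \<in> carrier (tensor_mod K M R)" using X by simp
  show "(r \<oplus>\<^bsub>R\<^esub> s) \<odot>\<^bsub>base_change K M R\<^esub> X =
      r \<odot>\<^bsub>base_change K M R\<^esub> X \<oplus>\<^bsub>base_change K M R\<^esub> s \<odot>\<^bsub>base_change K M R\<^esub> X"
    if s: "s \<in> carrier R" for s
    using X
  proof (induction rule: tensor_induct[OF MR, consumes 1, case_names tens add])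
    case (tens m t)
    then show ?case using r s by (simp add: base_change_smult_tens tens_MR R.l_distr)
  next
    case (add X Y)
    then show ?case using r s
      by (simp add: base_change_smult_add base_change_smult_closed
          abelian_group_add4[OF T.abelian_group_axioms])
  qed
  show "(r \<otimes>\<^bsub>R\<^esub> s) \<odot>\<^bsub>base_change K M R\<^esub> X =
      r \<odot>\<^bsub>base_change K M R\<^esub> (s \<odot>\<^bsub>base_change K M R\<^esub> X)"
    if s: "s \<in> carrier R" for s
    using X
  proof (induction rule: tensor_induct[OF MR, consumes 1, case_names tens add])
    case (tens m t)
    then show ?case using r s by (simp add: base_change_smult_tens R.m_assoc)
  next
    case (add X Y)
    then show ?case using r s
      by (simp add: base_change_smult_add base_change_smult_closed)
  qed
next
  fix X assume "X \<in> carrier (base_change K M R)"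
  then have "X \<in> carrier (tensor_mod K M R)" by simp
  then show "\<one>\<^bsub>R\<^esub> \<odot>\<^bsub>base_change K M R\<^esub> X = X"
    by (induction rule: tensor_induct[OF MR, consumes 1, case_names tens add])
      (simp_all add: base_change_smult_tens base_change_smult_add)
qed

text \<open>
  Restricting the scalars of the \<open>R\<close>-module \<open>M \<otimes> R\<close> back to \<open>K\<close> recovers the tensor product over \<open>K\<close>.
\<close>

lemma base_change_scalars:
  assumes c: "c \<in> carrier K" and X: "X \<in> carrier (tensor_mod K M R)"
  shows "(c \<odot>\<^bsub>R\<^esub> \<one>\<^bsub>R\<^esub>) \<odot>\<^bsub>base_change K M R\<^esub> X = c \<odot>\<^bsub>tensor_mod K M R\<^esub> X"
  using X
proof (induction rule: tensor_induct[OF MR, consumes 1, case_names tens add])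
  case (tens m s)
  then show ?case using c by (simp add: base_change_smult_tens tens_MR R.smult_assoc2)
next
  case (add X Y)
  then show ?case using c by (simp add: base_change_smult_add T.smult_r_distr)
qed

text \<open>
  The elements \<open>m \<otimes> 1\<close> generate \<open>M \<otimes> R\<close> over \<open>R\<close>, because \<open>m \<otimes> r = r (m \<otimes> 1)\<close>.
\<close>

lemma base_hom_eqI:
  assumes P: "module R P"
    and h: "h \<in> lin_hom R (base_change K M R) P" and h': "h' \<in> lin_hom R (base_change K M R) P"
    and eq: "\<And>m. m \<in> carrier M \<Longrightarrow> h (tens K M R m \<one>\<^bsub>R\<^esub>) = h' (tens K M R m \<one>\<^bsub>R\<^esub>)"
  shows "h = h'"
proof
  fix X
  show "h X = h' X"
  proof (cases "X \<in> carrier (tensor_mod K M R)")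
    case True
    then show ?thesis
    proof (induction rule: tensor_induct[OF MR, consumes 1, case_names tens add])
      case (tens m r)
      then show ?case
        using lin_hom_smult[OF h, of r "tens K M R m \<one>\<^bsub>R\<^esub>"]
          lin_hom_smult[OF h', of r "tens K M R m \<one>\<^bsub>R\<^esub>"] eq
        by (simp add: tens_closed[OF MR] base_change_smult_tens)
    next
      case (add X Y)
      then show ?case using lin_hom_add[OF h, of X Y] lin_hom_add[OF h', of X Y] by simp
    qed
  next
    case False
    then show ?thesis using lin_hom_undefined[OF h, of X] lin_hom_undefined[OF h', of X] by simp
  qed
qed

text \<open>
  The map is \<open>m \<otimes> r \<mapsto> r \<phi>(m)\<close>; it comes from the universal property over \<open>K\<close>, and its linearity over \<open>R\<close>
  can be tested on pure tensors.
\<close>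

lemma base_lift_exists:
  assumes P: "module R P"
    and \<phi>: "restrict \<phi> (carrier M) \<in> lin_hom K M (restrict_scalars K R P)"
  shows "\<exists>h \<in> lin_hom R (base_change K M R) P. \<forall>m\<in>carrier M. h (tens K M R m \<one>\<^bsub>R\<^esub>) = \<phi> m"
proof -
  interpret P: module R P by fact
  have \<phi>_simps: "\<And>m. m \<in> carrier M \<Longrightarrow> \<phi> m \<in> carrier P"
    "\<And>m m'. \<lbrakk>m \<in> carrier M; m' \<in> carrier M\<rbrakk> \<Longrightarrow> \<phi> (m \<oplus>\<^bsub>M\<^esub> m') = \<phi> m \<oplus>\<^bsub>P\<^esub> \<phi> m'"
    "\<And>c m. \<lbrakk>c \<in> carrier K; m \<in> carrier M\<rbrakk> \<Longrightarrow> \<phi> (c \<odot>\<^bsub>M\<^esub> m) = (c \<odot>\<^bsub>R\<^esub> \<one>\<^bsub>R\<^esub>) \<odot>\<^bsub>P\<^esub> \<phi> m"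
    using lin_hom_closed[OF \<phi>] lin_hom_add[OF \<phi>] lin_hom_smult[OF \<phi>] by simp_all
  have sm: "(c \<odot>\<^bsub>R\<^esub> r) \<odot>\<^bsub>P\<^esub> p = (c \<odot>\<^bsub>R\<^esub> \<one>\<^bsub>R\<^esub>) \<odot>\<^bsub>P\<^esub> (r \<odot>\<^bsub>P\<^esub> p)"
    "r \<odot>\<^bsub>P\<^esub> ((c \<odot>\<^bsub>R\<^esub> \<one>\<^bsub>R\<^esub>) \<odot>\<^bsub>P\<^esub> p) = (c \<odot>\<^bsub>R\<^esub> \<one>\<^bsub>R\<^esub>) \<odot>\<^bsub>P\<^esub> (r \<odot>\<^bsub>P\<^esub> p)"
    if "c \<in> carrier K" "r \<in> carrier R" "p \<in> carrier P" for c r p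
    using that by (simp_all add: P.smult_assoc1[symmetric] R.smult_assoc2 R.smult_mult_right)
  have bil: "bilinear_map K M R (restrict_scalars K R P) (\<lambda>m r. r \<odot>\<^bsub>P\<^esub> \<phi> m)"
    unfolding bilinear_map_def
    by (intro conjI ballI)
      (simp_all add: \<phi>_simps P.smult_l_distr P.smult_r_distr, simp_all only: sm \<phi>_simps)
  let ?h = "tensor_lift K M R (restrict_scalars K R P) (\<lambda>m r. r \<odot>\<^bsub>P\<^esub> \<phi> m)"
  note RP = restrict_scalars_module[OF R P]
  note h = tensor_lift_hom[OF MR RP bil] and h_tens = tensor_lift_tens[OF MR RP bil]
  have h_smult: "?h (r \<odot>\<^bsub>base_change K M R\<^esub> X) = r \<odot>\<^bsub>P\<^esub> ?h X"
    if r: "r \<in> carrier R" and X: "X \<in> carrier (tensor_mod K M R)" for r X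
    using X
  proof (induction rule: tensor_induct[OF MR, consumes 1, case_names tens add])
    case (tens m s)
    then show ?case using r by (simp add: base_change_smult_tens h_tens P.smult_assoc1 \<phi>_simps)
  next
    case (add X Y)
    then show ?case
      using r lin_hom_add[OF h] lin_hom_closed[OF h]
      by (simp add: base_change_smult_add base_change_smult_closed P.smult_r_distr)
  qed
  have "?h \<in> lin_hom R (base_change K M R) P"
    using lin_hom_closed[OF h] lin_hom_undefined[OF h] lin_hom_add[OF h]
    by (intro lin_homI) (simp_all add: h_smult)
  then show ?thesis
    by (intro bexI[of _ ?h]) (simp_all add: h_tens \<phi>_simps)
qed

lemma
  assumes P: "module R P"
    and \<phi>: "restrict \<phi> (carrier M) \<in> lin_hom K M (restrict_scalars K R P)"
  shows base_lift_hom: "base_lift K M R P \<phi> \<in> lin_hom R (base_change K M R) P"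
    and base_lift_one: "m \<in> carrier M \<Longrightarrow> base_lift K M R P \<phi> (tens K M R m \<one>\<^bsub>R\<^esub>) = \<phi> m"
    and base_lift_tens: "\<lbrakk>m \<in> carrier M; r \<in> carrier R\<rbrakk> \<Longrightarrow>
      base_lift K M R P \<phi> (tens K M R m r) = r \<odot>\<^bsub>P\<^esub> \<phi> m"
proof -
  have "\<exists>!h. h \<in> lin_hom R (base_change K M R) P \<and>
      (\<forall>m\<in>carrier M. h (tens K M R m \<one>\<^bsub>R\<^esub>) = \<phi> m)"
    using base_lift_exists[OF P \<phi>] by (auto intro!: base_hom_eqI[OF P])
  from theI'[OF this] have hom: "base_lift K M R P \<phi> \<in> lin_hom R (base_change K M R) P"
    and one: "\<And>m. m \<in> carrier M \<Longrightarrow> base_lift K M R P \<phi> (tens K M R m \<one>\<^bsub>R\<^esub>) = \<phi> m"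
    by (simp_all add: base_lift_def)
  show "base_lift K M R P \<phi> \<in> lin_hom R (base_change K M R) P" by (rule hom)
  show "m \<in> carrier M \<Longrightarrow> base_lift K M R P \<phi> (tens K M R m \<one>\<^bsub>R\<^esub>) = \<phi> m" by (rule one)
  show "base_lift K M R P \<phi> (tens K M R m r) = r \<odot>\<^bsub>P\<^esub> \<phi> m" if "m \<in> carrier M" "r \<in> carrier R"
    using lin_hom_smult[OF hom, of r "tens K M R m \<one>\<^bsub>R\<^esub>"] one that
    by (simp add: tens_closed[OF MR] base_change_smult_tens)
qed

end


section \<open>Derivations at a point\<close>

lemma der_module_carrier:
  "D \<in> carrier (der_module K A \<epsilon>) \<longleftrightarrow> D \<in> lin_hom K A (ground K) \<and>
    (\<forall>f\<in>carrier A. \<forall>g\<in>carrier A. D (f \<otimes>\<^bsub>A\<^esub> g) = D f \<otimes>\<^bsub>K\<^esub> \<epsilon> g \<oplus>\<^bsub>K\<^esub> \<epsilon> f \<otimes>\<^bsub>K\<^esub> D g)"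
  by (simp add: der_module_def)

lemma der_module_simps [simp]:
  "zero (der_module K A \<epsilon>) = (\<lambda>a\<in>carrier A. \<zero>\<^bsub>K\<^esub>)"
  "add (der_module K A \<epsilon>) D E = (\<lambda>a\<in>carrier A. D a \<oplus>\<^bsub>K\<^esub> E a)"
  "smult (der_module K A \<epsilon>) c D = (\<lambda>a\<in>carrier A. c \<otimes>\<^bsub>K\<^esub> D a)"
  by (simp_all add: der_module_def)

text \<open>
  The hypotheses are what \<open>A\<close> over \<open>K\<close> and the base change \<open>A \<otimes> R\<close> over \<open>R\<close> have in common; both
  tangent spaces are instances.
\<close>

lemma der_module_module:
  assumes A: "module K A"
    and mult: "\<And>f g. \<lbrakk>f \<in> carrier A; g \<in> carrier A\<rbrakk> \<Longrightarrow> f \<otimes>\<^bsub>A\<^esub> g \<in> carrier A"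
    and \<epsilon>: "\<And>f. f \<in> carrier A \<Longrightarrow> \<epsilon> f \<in> carrier K"
  shows "module K (der_module K A \<epsilon>)"
proof -
  interpret A: module K A by fact
  let ?q = "der_module K A \<epsilon>"
  have lin: "D \<in> lin_hom K A (ground K)" if "D \<in> carrier ?q" for D
    using that by (simp add: der_module_carrier)
  have cl: "D a \<in> carrier K" if "D \<in> carrier ?q" "a \<in> carrier A" for D a
    using lin_hom_closed[OF lin[OF that(1)] that(2)] by simp
  have undef: "D a = undefined" if "D \<in> carrier ?q" "a \<notin> carrier A" for D a
    using lin_hom_undefined[OF lin[OF that(1)] that(2)] .
  have add_cl: "D \<oplus>\<^bsub>?q\<^esub> E \<in> carrier ?q" if D: "D \<in> carrier ?q" and E: "E \<in> carrier ?q" for D E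
  proof -
    have "D \<oplus>\<^bsub>?q\<^esub> E \<in> lin_hom K A (ground K)"
      unfolding der_module_simps
      by (rule restrict_lin_homI[OF A])
        (use D E in \<open>simp_all add: cl lin_hom_add[OF lin] lin_hom_smult[OF lin] A.R.r_distr A.R.a_ac\<close>)
    then show ?thesis
      using D E
      by (simp add: der_module_carrier mult \<epsilon> cl[unfolded der_module_carrier] A.R.l_distr A.R.r_distr A.R.a_ac)
  qed
  have smult_cl: "c \<odot>\<^bsub>?q\<^esub> D \<in> carrier ?q" if c: "c \<in> carrier K" and D: "D \<in> carrier ?q" for c D
  proof -
    have "c \<odot>\<^bsub>?q\<^esub> D \<in> lin_hom K A (ground K)"
      unfolding der_module_simps
      by (rule restrict_lin_homI[OF A])
        (use c D in \<open>simp_all add: cl lin_hom_add[OF lin] lin_hom_smult[OF lin] A.R.r_distr A.R.m_ac\<close>)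
    then show ?thesis
      using c D
      by (simp add: der_module_carrier mult \<epsilon> cl[unfolded der_module_carrier] A.R.r_distr A.R.m_ac)
  qed
  show ?thesis
  proof (rule moduleI)
    show "abelian_group ?q"
    proof (rule abelian_groupI)
      have "\<zero>\<^bsub>?q\<^esub> \<in> lin_hom K A (ground K)"
        unfolding der_module_simps by (rule restrict_lin_homI[OF A]) simp_all
      then show "\<zero>\<^bsub>?q\<^esub> \<in> carrier ?q" by (simp add: der_module_carrier mult \<epsilon>)
    next
      fix D assume D: "D \<in> carrier ?q"
      then show "\<zero>\<^bsub>?q\<^esub> \<oplus>\<^bsub>?q\<^esub> D = D"
        by (auto simp: fun_eq_iff cl undef)
      have "(\<ominus>\<^bsub>K\<^esub> \<one>\<^bsub>K\<^esub>) \<odot>\<^bsub>?q\<^esub> D \<oplus>\<^bsub>?q\<^esub> D = \<zero>\<^bsub>?q\<^esub>"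
        using D by (auto simp: fun_eq_iff cl A.R.l_minus A.R.l_neg)
      then show "\<exists>E\<in>carrier ?q. E \<oplus>\<^bsub>?q\<^esub> D = \<zero>\<^bsub>?q\<^esub>"
        using smult_cl[OF A.R.a_inv_closed[OF A.R.one_closed] D] by blast
    next
      fix D E assume "D \<in> carrier ?q" "E \<in> carrier ?q"
      then show "D \<oplus>\<^bsub>?q\<^esub> E \<in> carrier ?q" by (rule add_cl)
    qed (auto simp: fun_eq_iff cl A.R.a_ac)
  next
    fix c D assume "c \<in> carrier K" "D \<in> carrier ?q"
    then show "c \<odot>\<^bsub>?q\<^esub> D \<in> carrier ?q" by (rule smult_cl)
  qed (auto simp: fun_eq_iff cl undef A.is_cring A.R.l_distr A.R.r_distr A.R.m_assoc)
qed


section \<open>Pairings and convolutions of functionals\<close>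

text \<open>
  The functional \<open>D \<otimes> E\<close> on \<open>A \<otimes> A\<close>, with values in \<open>k \<otimes> k = k\<close>.
\<close>

definition pairing ::
  "('k, 'x) ring_scheme \<Rightarrow> ('k, 'a) module \<Rightarrow> ('a \<Rightarrow> 'k) \<Rightarrow> ('a \<Rightarrow> 'k) \<Rightarrow>
   ('a \<times> 'a \<Rightarrow> 'k) set \<Rightarrow> 'k" where
  "pairing K A D E = tensor_lift K A A (ground K) (\<lambda>a b. D a \<otimes>\<^bsub>K\<^esub> E b)"

lemma convolution_pairing: "convolution K A \<nu> D E = compose (carrier A) (pairing K A D E) \<nu>"
  by (simp add: convolution_def pairing_def)

context
  fixes K :: "('k, 'x) ring_scheme" and A :: "('k, 'a) module"
  assumes A: "module K A"
begin

interpretation A: module K A by (rule A)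

lemma functional_bilinear:
  assumes "D \<in> lin_hom K A (ground K)" "E \<in> lin_hom K A (ground K)"
  shows "bilinear_map K A A (ground K) (\<lambda>a b. D a \<otimes>\<^bsub>K\<^esub> E b)"
  using lin_hom_closed[OF assms(1)] lin_hom_closed[OF assms(2)]
  by (simp add: bilinear_map_def lin_hom_add[OF assms(1)] lin_hom_add[OF assms(2)]
      lin_hom_smult[OF assms(1)] lin_hom_smult[OF assms(2)]
      A.R.l_distr A.R.r_distr A.R.m_assoc A.R.m_lcomm)

lemma
  assumes "D \<in> lin_hom K A (ground K)" "E \<in> lin_hom K A (ground K)"
  shows pairing_hom: "pairing K A D E \<in> lin_hom K (tensor_mod K A A) (ground K)"
    and pairing_tens: "\<lbrakk>a \<in> carrier A; b \<in> carrier A\<rbrakk> \<Longrightarrow>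
      pairing K A D E (tens K A A a b) = D a \<otimes>\<^bsub>K\<^esub> E b"
  unfolding pairing_def
  by (rule tensor_lift_hom[OF A A ground_module[OF A.is_cring] functional_bilinear[OF assms]]
      tensor_lift_tens[OF A A ground_module[OF A.is_cring] functional_bilinear[OF assms]]; assumption)+

lemma pairing_closed:
  "\<lbrakk>D \<in> lin_hom K A (ground K); E \<in> lin_hom K A (ground K); X \<in> carrier (tensor_mod K A A)\<rbrakk> \<Longrightarrow>
    pairing K A D E X \<in> carrier K"
  using lin_hom_closed[OF pairing_hom] by simp

lemma pairing_add:
  "\<lbrakk>D \<in> lin_hom K A (ground K); E \<in> lin_hom K A (ground K);
    X \<in> carrier (tensor_mod K A A); Y \<in> carrier (tensor_mod K A A)\<rbrakk> \<Longrightarrow>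
    pairing K A D E (X \<oplus>\<^bsub>tensor_mod K A A\<^esub> Y) = pairing K A D E X \<oplus>\<^bsub>K\<^esub> pairing K A D E Y"
  using lin_hom_add[OF pairing_hom] by simp

lemma zero_functional: "(\<lambda>a\<in>carrier A. \<zero>\<^bsub>K\<^esub>) \<in> lin_hom K A (ground K)"
  by (rule restrict_lin_homI[OF A]) simp_all

lemma pairing_zero:
  assumes D: "D \<in> lin_hom K A (ground K)" and X: "X \<in> carrier (tensor_mod K A A)"
  shows "pairing K A (\<lambda>a\<in>carrier A. \<zero>\<^bsub>K\<^esub>) D X = \<zero>\<^bsub>K\<^esub>"
    and "pairing K A D (\<lambda>a\<in>carrier A. \<zero>\<^bsub>K\<^esub>) X = \<zero>\<^bsub>K\<^esub>"
  using X lin_hom_closed[OF D]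
  by (induction rule: tensor_induct[OF A A, consumes 1, case_names tens add])
    (simp_all add: pairing_tens pairing_add D zero_functional)

lemma convolution_hom:
  assumes "\<nu> \<in> lin_hom K A (tensor_mod K A A)"
    and "D \<in> lin_hom K A (ground K)" "E \<in> lin_hom K A (ground K)"
  shows "convolution K A \<nu> D E \<in> lin_hom K A (ground K)"
  unfolding convolution_pairing by (rule lin_hom_compose[OF A assms(1) pairing_hom[OF assms(2,3)]])

lemma convolution_add:
  assumes \<nu>: "\<nu> \<in> lin_hom K A (tensor_mod K A A)"
    and lin: "D \<in> lin_hom K A (ground K)" "E \<in> lin_hom K A (ground K)" "F \<in> lin_hom K A (ground K)"
  shows "convolution K A \<nu> D (\<lambda>a\<in>carrier A. E a \<oplus>\<^bsub>K\<^esub> F a) =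
      (\<lambda>a\<in>carrier A. convolution K A \<nu> D E a \<oplus>\<^bsub>K\<^esub> convolution K A \<nu> D F a)"
    and "convolution K A \<nu> (\<lambda>a\<in>carrier A. E a \<oplus>\<^bsub>K\<^esub> F a) D =
      (\<lambda>a\<in>carrier A. convolution K A \<nu> E D a \<oplus>\<^bsub>K\<^esub> convolution K A \<nu> F D a)"
proof -
  note cl = lin_hom_closed[OF lin(1), simplified] lin_hom_closed[OF lin(2), simplified]
    lin_hom_closed[OF lin(3), simplified]
  define S where "S = (\<lambda>a\<in>carrier A. E a \<oplus>\<^bsub>K\<^esub> F a)"
  have S: "S a = E a \<oplus>\<^bsub>K\<^esub> F a" if "a \<in> carrier A" for a
    using that by (simp add: S_def)
  have S_lin: "S \<in> lin_hom K A (ground K)"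
    unfolding S_def by (rule restrict_lin_homI[OF A])
      (simp_all add: cl lin_hom_add[OF lin(2)] lin_hom_add[OF lin(3)] lin_hom_smult[OF lin(2)]
        lin_hom_smult[OF lin(3)] A.R.r_distr A.R.a_ac)
  have "pairing K A D S X = pairing K A D E X \<oplus>\<^bsub>K\<^esub> pairing K A D F X \<and>
      pairing K A S D X = pairing K A E D X \<oplus>\<^bsub>K\<^esub> pairing K A F D X"
    if "X \<in> carrier (tensor_mod K A A)" for X
    using that
  proof (induction rule: tensor_induct[OF A A, consumes 1, case_names tens add])
    case (tens a b)
    then show ?case
      by (simp add: pairing_tens lin S_lin S cl A.R.l_distr A.R.r_distr)
  next
    case (add X Y)
    then show ?case
      by (simp add: pairing_add pairing_closed lin S_lin
          abelian_group_add4[OF A.R.abelian_group_axioms])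
  qed
  then show "convolution K A \<nu> D (\<lambda>a\<in>carrier A. E a \<oplus>\<^bsub>K\<^esub> F a) =
      (\<lambda>a\<in>carrier A. convolution K A \<nu> D E a \<oplus>\<^bsub>K\<^esub> convolution K A \<nu> D F a)"
    and "convolution K A \<nu> (\<lambda>a\<in>carrier A. E a \<oplus>\<^bsub>K\<^esub> F a) D =
      (\<lambda>a\<in>carrier A. convolution K A \<nu> E D a \<oplus>\<^bsub>K\<^esub> convolution K A \<nu> F D a)"
    unfolding S_def[symmetric]
    using lin_hom_closed[OF \<nu>] by (auto simp: convolution_pairing fun_eq_iff compose_def)
qed

lemma convolution_smult:
  assumes \<nu>: "\<nu> \<in> lin_hom K A (tensor_mod K A A)" and c: "c \<in> carrier K"
    and lin: "D \<in> lin_hom K A (ground K)" "E \<in> lin_hom K A (ground K)"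
  shows "convolution K A \<nu> D (\<lambda>a\<in>carrier A. c \<otimes>\<^bsub>K\<^esub> E a) =
      (\<lambda>a\<in>carrier A. c \<otimes>\<^bsub>K\<^esub> convolution K A \<nu> D E a)"
    and "convolution K A \<nu> (\<lambda>a\<in>carrier A. c \<otimes>\<^bsub>K\<^esub> E a) D =
      (\<lambda>a\<in>carrier A. c \<otimes>\<^bsub>K\<^esub> convolution K A \<nu> E D a)"
proof -
  note cl = lin_hom_closed[OF lin(1), simplified] lin_hom_closed[OF lin(2), simplified]
  define C where "C = (\<lambda>a\<in>carrier A. c \<otimes>\<^bsub>K\<^esub> E a)"
  have C: "C a = c \<otimes>\<^bsub>K\<^esub> E a" if "a \<in> carrier A" for a
    using that by (simp add: C_def)
  have C_lin: "C \<in> lin_hom K A (ground K)"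
    unfolding C_def by (rule restrict_lin_homI[OF A])
      (simp_all add: c cl lin_hom_add[OF lin(2)] lin_hom_smult[OF lin(2)] A.R.r_distr A.R.m_lcomm)
  have "pairing K A D C X = c \<otimes>\<^bsub>K\<^esub> pairing K A D E X \<and>
      pairing K A C D X = c \<otimes>\<^bsub>K\<^esub> pairing K A E D X"
    if "X \<in> carrier (tensor_mod K A A)" for X
    using that
  proof (induction rule: tensor_induct[OF A A, consumes 1, case_names tens add])
    case (tens a b)
    then show ?case
      by (simp add: pairing_tens lin C_lin C c cl A.R.m_assoc A.R.m_lcomm)
  next
    case (add X Y)
    then show ?case
      by (simp add: pairing_add pairing_closed lin C_lin c A.R.r_distr)
  qed
  then show "convolution K A \<nu> D (\<lambda>a\<in>carrier A. c \<otimes>\<^bsub>K\<^esub> E a) =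
      (\<lambda>a\<in>carrier A. c \<otimes>\<^bsub>K\<^esub> convolution K A \<nu> D E a)"
    and "convolution K A \<nu> (\<lambda>a\<in>carrier A. c \<otimes>\<^bsub>K\<^esub> E a) D =
      (\<lambda>a\<in>carrier A. c \<otimes>\<^bsub>K\<^esub> convolution K A \<nu> E D a)"
    unfolding C_def[symmetric]
    using lin_hom_closed[OF \<nu>] by (auto simp: convolution_pairing fun_eq_iff compose_def)
qed

end

text \<open>
  On pure tensors this is the product of the Leibniz rules \<open>D(aa') = D(a)\<epsilon>(a') + \<epsilon>(a)D(a')\<close> and
  \<open>E(bb') = E(b)\<epsilon>(b') + \<epsilon>(b)E(b')\<close>: two of the four terms carry both derivations on one tensor, and the
  other two are mixed.
\<close>

lemma pairing_mult:
  assumes A: "algebra K A" and \<epsilon>: "\<epsilon> \<in> alg_hom K A (ground K)"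
    and D: "D \<in> carrier (der_module K A \<epsilon>)" and E: "E \<in> carrier (der_module K A \<epsilon>)"
    and X: "X \<in> carrier (tensor_mod K A A)" and Y: "Y \<in> carrier (tensor_mod K A A)"
  shows "pairing K A D E (X \<otimes>\<^bsub>tensor_alg K A A\<^esub> Y) =
      (pairing K A D E X \<otimes>\<^bsub>K\<^esub> pairing K A \<epsilon> \<epsilon> Y \<oplus>\<^bsub>K\<^esub> pairing K A \<epsilon> \<epsilon> X \<otimes>\<^bsub>K\<^esub> pairing K A D E Y) \<oplus>\<^bsub>K\<^esub>
      (pairing K A D \<epsilon> X \<otimes>\<^bsub>K\<^esub> pairing K A \<epsilon> E Y \<oplus>\<^bsub>K\<^esub> pairing K A \<epsilon> E X \<otimes>\<^bsub>K\<^esub> pairing K A D \<epsilon> Y)"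
proof -
  interpret A: algebra K A by fact
  have lin: "\<epsilon> \<in> lin_hom K A (ground K)" "D \<in> lin_hom K A (ground K)" "E \<in> lin_hom K A (ground K)"
    using \<epsilon> D E by (simp_all add: alg_hom_def der_module_carrier)
  have cl: "\<epsilon> a \<in> carrier K" "D a \<in> carrier K" "E a \<in> carrier K" if "a \<in> carrier A" for a
    using that lin_hom_closed[OF lin(1)] lin_hom_closed[OF lin(2)] lin_hom_closed[OF lin(3)] by simp_all
  have \<epsilon>_mult: "\<epsilon> (a \<otimes>\<^bsub>A\<^esub> b) = \<epsilon> a \<otimes>\<^bsub>K\<^esub> \<epsilon> b" if "a \<in> carrier A" "b \<in> carrier A" for a b
    using \<epsilon> that ring_hom_mult[of \<epsilon> A "ground K"] by (simp add: alg_hom_def)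
  have der: "D (a \<otimes>\<^bsub>A\<^esub> b) = D a \<otimes>\<^bsub>K\<^esub> \<epsilon> b \<oplus>\<^bsub>K\<^esub> \<epsilon> a \<otimes>\<^bsub>K\<^esub> D b"
    "E (a \<otimes>\<^bsub>A\<^esub> b) = E a \<otimes>\<^bsub>K\<^esub> \<epsilon> b \<oplus>\<^bsub>K\<^esub> \<epsilon> a \<otimes>\<^bsub>K\<^esub> E b" if "a \<in> carrier A" "b \<in> carrier A" for a b
    using D E that by (simp_all add: der_module_carrier)
  note pt = pairing_tens[OF A.module] and pa = pairing_add[OF A.module]
    and pc = pairing_closed[OF A.module]
  from X show ?thesis
  proof (induction rule: tensor_induct[OF A.module A.module, consumes 1, case_names tens add])
    case (tens a b)
    from Y tens show ?case
    proof (induction rule: tensor_induct[OF A.module A.module, consumes 1, case_names tens add])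
      case (tens a' b')
      then show ?case
        by (simp add: tensor_mult_tens[OF A A] pt lin der \<epsilon>_mult cl A.R.l_distr A.R.r_distr
            A.R.a_ac A.R.m_ac)
    next
      case (add Y Y')
      then show ?case
        by (simp add: tensor_mult_add_right[OF A A] tensor_mult_closed[OF A A]
            tens_closed[OF A.module A.module] pa pc lin A.R.l_distr A.R.r_distr A.R.a_ac)
    qed
  next
    case (add X X')
    then show ?case
      using Y by (simp add: tensor_mult_add_left[OF A A] tensor_mult_closed[OF A A]
          pa pc lin A.R.l_distr A.R.r_distr A.R.a_ac)
  qed
qed

text \<open>
  Each of the two mixed terms in \<open>pairing_mult\<close> contains a factor \<open>D \<otimes> \<epsilon>\<close> and a factor \<open>\<epsilon> \<otimes> E\<close>, so the
  vanishing of either convolution removes both.  The first one vanishes for \<open>\<triangleright>\<close>, the second one for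
  the inverse operation.
\<close>

lemma convolution_derivation:
  assumes A: "algebra K A" and \<epsilon>: "\<epsilon> \<in> alg_hom K A (ground K)"
    and \<nu>: "\<nu> \<in> alg_hom K A (tensor_alg K A A)"
    and D: "D \<in> carrier (der_module K A \<epsilon>)" and E: "E \<in> carrier (der_module K A \<epsilon>)"
    and \<epsilon>\<epsilon>: "\<And>a. a \<in> carrier A \<Longrightarrow> convolution K A \<nu> \<epsilon> \<epsilon> a = \<epsilon> a"
    and mixed: "(\<forall>a\<in>carrier A. convolution K A \<nu> D \<epsilon> a = \<zero>\<^bsub>K\<^esub>) \<or>
      (\<forall>a\<in>carrier A. convolution K A \<nu> \<epsilon> E a = \<zero>\<^bsub>K\<^esub>)"
  shows "convolution K A \<nu> D E \<in> carrier (der_module K A \<epsilon>)"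
proof -
  interpret A: algebra K A by fact
  have lin: "\<epsilon> \<in> lin_hom K A (ground K)" "D \<in> lin_hom K A (ground K)" "E \<in> lin_hom K A (ground K)"
    using \<epsilon> D E by (simp_all add: alg_hom_def der_module_carrier)
  have \<nu>_lin: "\<nu> \<in> lin_hom K A (tensor_mod K A A)"
    using \<nu> lin_hom_cong[of "tensor_alg K A A" "tensor_mod K A A" K A] by (simp add: alg_hom_def)
  have \<nu>_mult: "\<nu> (a \<otimes>\<^bsub>A\<^esub> b) = \<nu> a \<otimes>\<^bsub>tensor_alg K A A\<^esub> \<nu> b" if "a \<in> carrier A" "b \<in> carrier A" for a b
    using \<nu> that ring_hom_mult[of \<nu> A "tensor_alg K A A"] by (simp add: alg_hom_def)
  have conv: "convolution K A \<nu> f g a = pairing K A f g (\<nu> a)" if "a \<in> carrier A" for f g a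
    using that by (simp add: convolution_pairing compose_def)
  have cl: "convolution K A \<nu> f g a \<in> carrier K"
    if "f \<in> lin_hom K A (ground K)" "g \<in> lin_hom K A (ground K)" "a \<in> carrier A" for f g a
    using lin_hom_closed[OF convolution_hom[OF A.module \<nu>_lin that(1,2)] that(3)] by simp
  have \<epsilon>_cl: "\<epsilon> a \<in> carrier K" if "a \<in> carrier A" for a
    using lin_hom_closed[OF lin(1) that] by simp
  show ?thesis
    unfolding der_module_carrier
  proof (intro conjI ballI)
    show "convolution K A \<nu> D E \<in> lin_hom K A (ground K)"
      by (rule convolution_hom[OF A.module \<nu>_lin lin(2,3)])
    fix a b assume ab: "a \<in> carrier A" "b \<in> carrier A"
    have "convolution K A \<nu> D E (a \<otimes>\<^bsub>A\<^esub> b) =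
        (convolution K A \<nu> D E a \<otimes>\<^bsub>K\<^esub> \<epsilon> b \<oplus>\<^bsub>K\<^esub> \<epsilon> a \<otimes>\<^bsub>K\<^esub> convolution K A \<nu> D E b) \<oplus>\<^bsub>K\<^esub>
        (convolution K A \<nu> D \<epsilon> a \<otimes>\<^bsub>K\<^esub> convolution K A \<nu> \<epsilon> E b \<oplus>\<^bsub>K\<^esub>
          convolution K A \<nu> \<epsilon> E a \<otimes>\<^bsub>K\<^esub> convolution K A \<nu> D \<epsilon> b)"
      using ab pairing_mult[OF A \<epsilon> D E, of "\<nu> a" "\<nu> b"] lin_hom_closed[OF \<nu>_lin]
      by (simp add: \<epsilon>\<epsilon>[symmetric] conv \<nu>_mult)
    also have "convolution K A \<nu> D \<epsilon> a \<otimes>\<^bsub>K\<^esub> convolution K A \<nu> \<epsilon> E b \<oplus>\<^bsub>K\<^esub>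
          convolution K A \<nu> \<epsilon> E a \<otimes>\<^bsub>K\<^esub> convolution K A \<nu> D \<epsilon> b = \<zero>\<^bsub>K\<^esub>"
      using mixed ab cl lin by auto
    finally show "convolution K A \<nu> D E (a \<otimes>\<^bsub>A\<^esub> b) =
        convolution K A \<nu> D E a \<otimes>\<^bsub>K\<^esub> \<epsilon> b \<oplus>\<^bsub>K\<^esub> \<epsilon> a \<otimes>\<^bsub>K\<^esub> convolution K A \<nu> D E b"
      using ab cl \<epsilon>_cl lin by simp
  qed
qed


section \<open>Points over the dual numbers\<close>

text \<open>
  The value \<open>pr a b\<close> represents \<open>a + \<delta>b\<close>.  The representation is a parameter because two of them are
  needed: pairs, over which the adjoint representations are differentiated, and lists, over which the
  rack axioms are available.
\<close>

locale dual_number_algebra =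
  fixes K :: "('k, 'x) ring_scheme" and R :: "('k, 'r) module" and pr :: "'k \<Rightarrow> 'k \<Rightarrow> 'r"
  assumes K: "cring K"
    and pr_inj: "pr a b = pr c d \<longleftrightarrow> a = c \<and> b = d"
    and carrier_pr: "carrier R = {pr a b | a b. a \<in> carrier K \<and> b \<in> carrier K}"
    and mult_pr: "pr a b \<otimes>\<^bsub>R\<^esub> pr c d = pr (a \<otimes>\<^bsub>K\<^esub> c) (a \<otimes>\<^bsub>K\<^esub> d \<oplus>\<^bsub>K\<^esub> b \<otimes>\<^bsub>K\<^esub> c)"
    and one_pr: "\<one>\<^bsub>R\<^esub> = pr \<one>\<^bsub>K\<^esub> \<zero>\<^bsub>K\<^esub>"
    and zero_pr: "\<zero>\<^bsub>R\<^esub> = pr \<zero>\<^bsub>K\<^esub> \<zero>\<^bsub>K\<^esub>"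
    and add_pr: "pr a b \<oplus>\<^bsub>R\<^esub> pr c d = pr (a \<oplus>\<^bsub>K\<^esub> c) (b \<oplus>\<^bsub>K\<^esub> d)"
    and smult_pr: "s \<odot>\<^bsub>R\<^esub> pr a b = pr (s \<otimes>\<^bsub>K\<^esub> a) (s \<otimes>\<^bsub>K\<^esub> b)"
begin

sublocale K: cring K by (rule K)

lemmas pr_simps = mult_pr one_pr zero_pr add_pr smult_pr pr_inj

lemma pr_closed [simp]: "pr a b \<in> carrier R \<longleftrightarrow> a \<in> carrier K \<and> b \<in> carrier K"
  by (auto simp: carrier_pr pr_inj)

lemma carrier_prE:
  assumes "z \<in> carrier R"
  obtains a b where "z = pr a b" "a \<in> carrier K" "b \<in> carrier K"
  using assms by (auto simp: carrier_pr)

lemma algebra_dual_numbers: "algebra K R"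
proof (rule algebraI)
  show "cring R"
  proof (rule cringI)
    show "abelian_group R"
    proof (rule abelian_groupI)
      fix z assume "z \<in> carrier R"
      then obtain a b where "z = pr a b" "a \<in> carrier K" "b \<in> carrier K" by (rule carrier_prE)
      then show "\<exists>y\<in>carrier R. y \<oplus>\<^bsub>R\<^esub> z = \<zero>\<^bsub>R\<^esub>"
        by (intro bexI[of _ "pr (\<ominus>\<^bsub>K\<^esub> a) (\<ominus>\<^bsub>K\<^esub> b)"]) (simp_all add: pr_simps K.l_neg)
    qed (auto elim!: carrier_prE simp: pr_simps K.a_ac)
    show "Group.comm_monoid R"
      by (rule comm_monoidI)
        (auto elim!: carrier_prE simp: pr_simps K.l_distr K.r_distr K.a_ac K.m_ac)
  qed (auto elim!: carrier_prE simp: pr_simps K.l_distr K.a_ac)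
qed (auto elim!: carrier_prE simp: K pr_simps K.l_distr K.r_distr K.m_assoc K.m_lcomm)

text \<open>
  The element \<open>\<delta>\<close> generates the algebra.
\<close>

lemma fin_gen_dual_numbers: "fin_gen_algebra K R"
  unfolding fin_gen_algebra_def
proof (intro conjI exI[of _ "{pr \<zero>\<^bsub>K\<^esub> \<one>\<^bsub>K\<^esub>}"] allI impI)
  interpret R: algebra K R by (rule algebra_dual_numbers)
  show "algebra K R" by (rule algebra_dual_numbers)
  fix H assume H: "subring H R \<and> submodule H K R \<and> {pr \<zero>\<^bsub>K\<^esub> \<one>\<^bsub>K\<^esub>} \<subseteq> H"
  then interpret H: subring H R by simp
  have sm: "c \<odot>\<^bsub>R\<^esub> z \<in> H" if "c \<in> carrier K" "z \<in> H" for c z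
    using H that by (auto intro: submodule.smult_closed)
  have "pr a b \<in> H" if "a \<in> carrier K" "b \<in> carrier K" for a b
  proof -
    have "pr a b = a \<odot>\<^bsub>R\<^esub> \<one>\<^bsub>R\<^esub> \<oplus>\<^bsub>R\<^esub> b \<odot>\<^bsub>R\<^esub> pr \<zero>\<^bsub>K\<^esub> \<one>\<^bsub>K\<^esub>"
      using that by (simp add: pr_simps)
    also have "\<dots> \<in> H"
      using H that sm by (intro subringE(7)[of H R]) auto
    finally show ?thesis .
  qed
  then have "carrier R \<subseteq> H" by (auto simp: carrier_pr)
  moreover have "H \<subseteq> carrier R" using H subringE(1) by blast
  ultimately show "H = carrier R" by blast
qed simp_all

end

lemma dual_numbers_algebra: "cring K \<Longrightarrow> dual_number_algebra K (dual_numbers K) Pair"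
  by (rule dual_number_algebra.intro) (auto simp: dual_numbers_def)

text \<open>
  The dual numbers with \<open>a + \<delta>b\<close> written as the list of its two coefficients: the algebras on which a
  rack is tested consist of lists of scalars.
\<close>

definition dual_number_lists :: "('k, 'x) ring_scheme \<Rightarrow> ('k, 'k list) module" where
  "dual_number_lists K = (let l = (\<lambda>(a, b). [a, b]); p = (\<lambda>z. (z ! 0, z ! 1)); R = dual_numbers K in
     \<lparr>carrier = l ` carrier R, mult = (\<lambda>y z. l (p y \<otimes>\<^bsub>R\<^esub> p z)), one = l \<one>\<^bsub>R\<^esub>, zero = l \<zero>\<^bsub>R\<^esub>,
      add = (\<lambda>y z. l (p y \<oplus>\<^bsub>R\<^esub> p z)), smult = (\<lambda>c z. l (c \<odot>\<^bsub>R\<^esub> p z))\<rparr>)"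

lemma dual_number_lists_algebra: "cring K \<Longrightarrow> dual_number_algebra K (dual_number_lists K) (\<lambda>a b. [a, b])"
  by (rule dual_number_algebra.intro) (auto simp: dual_number_lists_def dual_numbers_def Let_def)

context dual_number_algebra
begin

text \<open>
  The point \<open>\<epsilon> + \<delta>D\<close>; over pairs this is \<open>tangent_point\<close>.
\<close>

definition deformed_point :: "('k, 'a) module \<Rightarrow> ('a \<Rightarrow> 'k) \<Rightarrow> ('a \<Rightarrow> 'k) \<Rightarrow> 'a \<Rightarrow> 'r" where
  "deformed_point A \<epsilon> D = (\<lambda>a\<in>carrier A. pr (\<epsilon> a) (D a))"

lemma deformed_point_apply [simp]: "a \<in> carrier A \<Longrightarrow> deformed_point A \<epsilon> D a = pr (\<epsilon> a) (D a)"
  by (simp add: deformed_point_def)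

text \<open>
  Since \<open>\<delta>\<^sup>2 = 0\<close>, multiplicativity of \<open>\<epsilon> + \<delta>D\<close> is multiplicativity of \<open>\<epsilon>\<close> together with the Leibniz rule for
  \<open>D\<close>, and the latter forces \<open>D(1) = 0\<close>.
\<close>

lemma deformed_point_hom:
  assumes A: "algebra K A" and \<epsilon>: "\<epsilon> \<in> alg_hom K A (ground K)"
    and D: "D \<in> carrier (der_module K A \<epsilon>)"
  shows "deformed_point A \<epsilon> D \<in> alg_hom K A R"
proof -
  interpret A: algebra K A by fact
  have lin: "\<epsilon> \<in> lin_hom K A (ground K)" "D \<in> lin_hom K A (ground K)"
    using \<epsilon> D by (simp_all add: alg_hom_def der_module_carrier)
  have cl: "\<epsilon> a \<in> carrier K" "D a \<in> carrier K" if "a \<in> carrier A" for a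
    using that lin_hom_closed[OF lin(1)] lin_hom_closed[OF lin(2)] by simp_all
  have \<epsilon>_hom: "\<epsilon> \<one>\<^bsub>A\<^esub> = \<one>\<^bsub>K\<^esub>" "\<And>a b. \<lbrakk>a \<in> carrier A; b \<in> carrier A\<rbrakk> \<Longrightarrow> \<epsilon> (a \<otimes>\<^bsub>A\<^esub> b) = \<epsilon> a \<otimes>\<^bsub>K\<^esub> \<epsilon> b"
    using \<epsilon> ring_hom_one[of \<epsilon> A "ground K"] ring_hom_mult[of \<epsilon> A "ground K"]
    by (simp_all add: alg_hom_def)
  have der: "D (a \<otimes>\<^bsub>A\<^esub> b) = D a \<otimes>\<^bsub>K\<^esub> \<epsilon> b \<oplus>\<^bsub>K\<^esub> \<epsilon> a \<otimes>\<^bsub>K\<^esub> D b"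
    if "a \<in> carrier A" "b \<in> carrier A" for a b
    using D that by (simp add: der_module_carrier)
  have "D \<one>\<^bsub>A\<^esub> = D \<one>\<^bsub>A\<^esub> \<oplus>\<^bsub>K\<^esub> D \<one>\<^bsub>A\<^esub>"
    using der[of "\<one>\<^bsub>A\<^esub>" "\<one>\<^bsub>A\<^esub>"] by (simp add: cl \<epsilon>_hom)
  then have D_one: "D \<one>\<^bsub>A\<^esub> = \<zero>\<^bsub>K\<^esub>" by (simp add: cl)
  have "deformed_point A \<epsilon> D \<in> lin_hom K A R"
    unfolding deformed_point_def
    by (rule restrict_lin_homI[OF A.module])
      (simp_all add: pr_simps cl lin_hom_add[OF lin(1)] lin_hom_add[OF lin(2)]
        lin_hom_smult[OF lin(1)] lin_hom_smult[OF lin(2)])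
  moreover have "deformed_point A \<epsilon> D \<in> ring_hom A R"
    by (rule ring_hom_memI)
      (simp_all add: pr_simps cl \<epsilon>_hom D_one der K.a_comm
        lin_hom_add[OF lin(1)] lin_hom_add[OF lin(2)])
  ultimately show ?thesis by (simp add: alg_hom_def)
qed

lemma point_unit_deformed:
  assumes "\<epsilon> \<in> lin_hom K A (ground K)"
  shows "point_unit A \<epsilon> R = deformed_point A \<epsilon> (\<lambda>a\<in>carrier A. \<zero>\<^bsub>K\<^esub>)"
  using lin_hom_closed[OF assms]
  by (auto simp: point_unit_def deformed_point_def pr_simps)

text \<open>
  The expansion \<open>(\<epsilon> + \<delta>D) \<otimes> (\<epsilon> + \<delta>E) = \<epsilon> \<otimes> \<epsilon> + \<delta> (\<epsilon> \<otimes> E + D \<otimes> \<epsilon>)\<close>, composed with the comorphism.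
\<close>

lemma point_op_deformed:
  assumes A: "module K A" and \<epsilon>: "\<epsilon> \<in> lin_hom K A (ground K)"
    and D: "D \<in> lin_hom K A (ground K)" and E: "E \<in> lin_hom K A (ground K)"
    and \<nu>: "\<nu> \<in> lin_hom K A (tensor_mod K A A)" and a: "a \<in> carrier A"
  shows "point_op K A \<nu> R (deformed_point A \<epsilon> D) (deformed_point A \<epsilon> E) a =
    pr (convolution K A \<nu> \<epsilon> \<epsilon> a) (convolution K A \<nu> \<epsilon> E a \<oplus>\<^bsub>K\<^esub> convolution K A \<nu> D \<epsilon> a)"
proof -
  interpret R: algebra K R by (rule algebra_dual_numbers)
  interpret A: module K A by fact
  have cl: "\<epsilon> a \<in> carrier K" "D a \<in> carrier K" "E a \<in> carrier K" if "a \<in> carrier A" for a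
    using that lin_hom_closed[OF \<epsilon>] lin_hom_closed[OF D] lin_hom_closed[OF E] by simp_all
  note ops = lin_hom_add[OF \<epsilon>] lin_hom_add[OF D] lin_hom_add[OF E]
    lin_hom_smult[OF \<epsilon>] lin_hom_smult[OF D] lin_hom_smult[OF E]
  have bil: "bilinear_map K A A R (\<lambda>a b. deformed_point A \<epsilon> D a \<otimes>\<^bsub>R\<^esub> deformed_point A \<epsilon> E b)"
    unfolding bilinear_map_def
    by (intro conjI ballI)
      (simp_all add: pr_simps cl ops K.l_distr K.r_distr K.a_ac K.m_ac)
  let ?h = "\<lambda>X. pr (pairing K A \<epsilon> \<epsilon> X) (pairing K A \<epsilon> E X \<oplus>\<^bsub>K\<^esub> pairing K A D \<epsilon> X)"
  have "tensor_lift K A A R (\<lambda>a b. deformed_point A \<epsilon> D a \<otimes>\<^bsub>R\<^esub> deformed_point A \<epsilon> E b) X = ?h X"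
    if "X \<in> carrier (tensor_mod K A A)" for X
    using that
  proof (induction rule: tensor_induct[OF A A, consumes 1, case_names tens add])
    case (tens a b)
    then show ?case
      by (simp add: tensor_lift_tens[OF A A R.module bil] pairing_tens[OF A] \<epsilon> D E pr_simps)
  next
    case (add X Y)
    then show ?case
      by (simp add: lin_hom_add[OF tensor_lift_hom[OF A A R.module bil]] pairing_add[OF A]
          pairing_closed[OF A] \<epsilon> D E pr_simps K.a_ac)
  qed
  then show ?thesis
    using a lin_hom_closed[OF \<nu>] by (simp add: point_op_def convolution_pairing compose_def)
qed

end


section \<open>Counit identities for the brackets\<close>

lemma (in pointed_rack) unit_rki: "x \<in> Q \<Longrightarrow> e \<triangleright>i x = e"
  using rk_rki[of x e] unit_closed rk_unit by simp

lemma (in pointed_rack) rki_unit: "x \<in> Q \<Longrightarrow> x \<triangleright>i e = x"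
  using rk_rki[of e x] unit_closed unit_rk by simp

context affine_algebraic_rack
begin

lemma algebra_coordinates: "algebra K A"
  using coordinate_algebra by (simp add: fin_gen_algebra_def)

sublocale A: algebra K A by (rule algebra_coordinates)

abbreviation "q \<equiv> der_module K A \<epsilon>"

lemma comorphism_lin:
  "nabla \<in> lin_hom K A (tensor_mod K A A)" "nabla_inv \<in> lin_hom K A (tensor_mod K A A)"
  using nabla nabla_inv lin_hom_cong[of "tensor_alg K A A" "tensor_mod K A A" K A]
  by (simp_all add: alg_hom_def)

lemma counit_lin: "\<epsilon> \<in> lin_hom K A (ground K)"
  using counit by (simp add: alg_hom_def)

lemma tangent_lin: "D \<in> carrier q \<Longrightarrow> D \<in> lin_hom K A (ground K)"
  by (simp add: der_module_carrier)

lemma tangent_space_module: "module K q"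
  using lin_hom_closed[OF counit_lin] by (intro der_module_module A.module) simp_all

text \<open>
  The four unit laws \<open>e \<triangleright> x = x\<close>, \<open>x \<triangleright> e = e\<close>, \<open>x \<triangleright>\<inverse> e = x\<close> and \<open>e \<triangleright>\<inverse> x = e\<close> at the point \<open>x = \<epsilon> + \<delta>D\<close>, with
  \<open>e = \<epsilon> + \<delta>0\<close>.  The constant coefficients give the first two identities and those of \<open>\<delta>\<close> the others.
\<close>

lemma convolution_counit:
  assumes D: "D \<in> carrier q" and a: "a \<in> carrier A"
  shows "convolution K A nabla \<epsilon> \<epsilon> a = \<epsilon> a" "convolution K A nabla_inv \<epsilon> \<epsilon> a = \<epsilon> a"
    and "convolution K A nabla \<epsilon> D a = D a" "convolution K A nabla D \<epsilon> a = \<zero>\<^bsub>K\<^esub>"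
    and "convolution K A nabla_inv D \<epsilon> a = D a" "convolution K A nabla_inv \<epsilon> D a = \<zero>\<^bsub>K\<^esub>"
proof -
  let ?R = "dual_number_lists K"
  interpret R: dual_number_algebra K ?R "\<lambda>a b. [a, b]"
    by (rule dual_number_lists_algebra) (rule A.R_cring)
  let ?x = "R.deformed_point A \<epsilon> D" and ?e = "point_unit A \<epsilon> ?R"
  let ?z = "\<lambda>a\<in>carrier A. \<zero>\<^bsub>K\<^esub>"
  interpret Q: pointed_rack "alg_hom K A ?R" ?e "point_op K A nabla ?R" "point_op K A nabla_inv ?R"
    by (rule points_rack[OF R.fin_gen_dual_numbers])
  have x: "?x \<in> alg_hom K A ?R" by (rule R.deformed_point_hom[OF A.algebra_axioms counit D])
  note lin = tangent_lin[OF D]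
  have zero: "convolution K A \<nu> ?z \<epsilon> a = \<zero>\<^bsub>K\<^esub>" "convolution K A \<nu> \<epsilon> ?z a = \<zero>\<^bsub>K\<^esub>"
    if "\<nu> \<in> lin_hom K A (tensor_mod K A A)" for \<nu>
    using pairing_zero[OF A.module counit_lin lin_hom_closed[OF that a]] a
    by (simp_all add: convolution_pairing compose_def)
  have cl: "convolution K A \<nu> D \<epsilon> a \<in> carrier K" "convolution K A \<nu> \<epsilon> D a \<in> carrier K"
    if "\<nu> \<in> lin_hom K A (tensor_mod K A A)" for \<nu>
    using lin_hom_closed[OF convolution_hom[OF A.module that lin counit_lin] a]
      lin_hom_closed[OF convolution_hom[OF A.module that counit_lin lin] a] by simp_all
  note op = R.point_op_deformed[OF A.module counit_lin _ _ _ a, OF lin zero_functional[OF A.module]]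
    R.point_op_deformed[OF A.module counit_lin _ _ _ a, OF zero_functional[OF A.module] lin]
  note e = R.point_unit_deformed[OF counit_lin]
  have eval: "?x a = [\<epsilon> a, D a]" "?e a = [\<epsilon> a, \<zero>\<^bsub>K\<^esub>]"
    using a by (simp_all add: e)
  have eqs: "point_op K A nabla ?R ?e ?x a = ?x a" "point_op K A nabla ?R ?x ?e a = ?e a"
    "point_op K A nabla_inv ?R ?x ?e a = ?x a" "point_op K A nabla_inv ?R ?e ?x a = ?e a"
    using Q.unit_rk[OF x] Q.rk_unit[OF x] Q.unit_rki[OF x] Q.rki_unit[OF x] by simp_all
  show "convolution K A nabla \<epsilon> \<epsilon> a = \<epsilon> a" "convolution K A nabla_inv \<epsilon> \<epsilon> a = \<epsilon> a"
    "convolution K A nabla \<epsilon> D a = D a" "convolution K A nabla D \<epsilon> a = \<zero>\<^bsub>K\<^esub>"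
    "convolution K A nabla_inv D \<epsilon> a = D a" "convolution K A nabla_inv \<epsilon> D a = \<zero>\<^bsub>K\<^esub>"
    using eqs unfolding eval unfolding e
    by (simp_all add: op comorphism_lin zero cl)
qed

lemma bracket_closed:
  assumes "D \<in> carrier q" "E \<in> carrier q"
  shows "convolution K A nabla D E \<in> carrier q" "convolution K A nabla_inv D E \<in> carrier q"
proof -
  note cc = convolution_counit[OF assms(1)] convolution_counit[OF assms(2)]
  show "convolution K A nabla D E \<in> carrier q"
    by (rule convolution_derivation[OF A.algebra_axioms counit nabla assms]) (simp_all add: cc)
  show "convolution K A nabla_inv D E \<in> carrier q"
    by (rule convolution_derivation[OF A.algebra_axioms counit nabla_inv assms]) (simp_all add: cc)
qed

end


section \<open>Base change of tangent spaces\<close>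

context
  fixes K :: "('k, 'x) ring_scheme" and A :: "('k, 'a) module" and R :: "('k, 'r) module"
  assumes A: "algebra K A" and R: "algebra K R"
begin

interpretation A: algebra K A by (rule A)
interpretation R: algebra K R by (rule R)
interpretation AR: module R "base_change K A R" by (rule base_change_module[OF A.module R])

lemma
  assumes f: "f \<in> lin_hom K A (ground K)"
  shows functional_base_change_hom:
      "functional_base_change K A R f \<in> lin_hom R (base_change K A R) (ground R)"
    and functional_base_change_tens: "\<lbrakk>a \<in> carrier A; r \<in> carrier R\<rbrakk> \<Longrightarrow>
      functional_base_change K A R f (tens K A R a r) = f a \<odot>\<^bsub>R\<^esub> r"
proof -
  have cl: "f a \<in> carrier K" if "a \<in> carrier A" for a
    using lin_hom_closed[OF f that] by simp
  have \<phi>: "restrict (\<lambda>a. f a \<odot>\<^bsub>R\<^esub> \<one>\<^bsub>R\<^esub>) (carrier A) \<in>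
      lin_hom K A (restrict_scalars K R (ground R))"
    by (rule restrict_lin_homI[OF A.module])
      (simp_all add: cl lin_hom_add[OF f] lin_hom_smult[OF f] R.smult_l_distr R.smult_assoc1
        R.smult_assoc2)
  note P = ground_module[OF R.M_cring]
  show "functional_base_change K A R f \<in> lin_hom R (base_change K A R) (ground R)"
    unfolding functional_base_change_def by (rule base_lift_hom[OF A.module R P \<phi>])
  show "functional_base_change K A R f (tens K A R a r) = f a \<odot>\<^bsub>R\<^esub> r"
    if "a \<in> carrier A" "r \<in> carrier R"
    using that by (simp add: functional_base_change_def base_lift_tens[OF A.module R P \<phi>] cl
        R.smult_mult_right)
qed

text \<open>
  The Leibniz rule for the extended functional is additive in both factors, and on
  \<open>(a \<otimes> r)(b \<otimes> s) = ab \<otimes> rs\<close> it is the Leibniz rule for \<open>D\<close> multiplied by \<open>rs\<close>.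
\<close>

lemma functional_base_change_derivation:
  assumes \<epsilon>: "\<epsilon> \<in> alg_hom K A (ground K)" and D: "D \<in> carrier (der_module K A \<epsilon>)"
  shows "functional_base_change K A R D \<in> carrier (tangent_base_change K A \<epsilon> R)"
proof -
  have lin: "\<epsilon> \<in> lin_hom K A (ground K)" "D \<in> lin_hom K A (ground K)"
    using \<epsilon> D by (simp_all add: alg_hom_def der_module_carrier)
  have cl: "\<epsilon> a \<in> carrier K" "D a \<in> carrier K" if "a \<in> carrier A" for a
    using that lin_hom_closed[OF lin(1)] lin_hom_closed[OF lin(2)] by simp_all
  have der: "D (a \<otimes>\<^bsub>A\<^esub> b) = D a \<otimes>\<^bsub>K\<^esub> \<epsilon> b \<oplus>\<^bsub>K\<^esub> \<epsilon> a \<otimes>\<^bsub>K\<^esub> D b"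
    if "a \<in> carrier A" "b \<in> carrier A" for a b
    using D that by (simp add: der_module_carrier)
  let ?D = "functional_base_change K A R D" and ?\<epsilon> = "functional_base_change K A R \<epsilon>"
  note hom = functional_base_change_hom[OF lin(1)] functional_base_change_hom[OF lin(2)]
  note ft = functional_base_change_tens[OF lin(1)] functional_base_change_tens[OF lin(2)]
  have fa: "?\<epsilon> (X \<oplus>\<^bsub>tensor_mod K A R\<^esub> Y) = ?\<epsilon> X \<oplus>\<^bsub>R\<^esub> ?\<epsilon> Y" "?D (X \<oplus>\<^bsub>tensor_mod K A R\<^esub> Y) = ?D X \<oplus>\<^bsub>R\<^esub> ?D Y"
    if "X \<in> carrier (tensor_mod K A R)" "Y \<in> carrier (tensor_mod K A R)" for X Y
    using that lin_hom_add[OF hom(1)] lin_hom_add[OF hom(2)] by simp_all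
  have fc: "?\<epsilon> X \<in> carrier R" "?D X \<in> carrier R" if "X \<in> carrier (tensor_mod K A R)" for X
    using that lin_hom_closed[OF hom(1)] lin_hom_closed[OF hom(2)] by simp_all
  have "?D (X \<otimes>\<^bsub>tensor_alg K A R\<^esub> Y) = ?D X \<otimes>\<^bsub>R\<^esub> ?\<epsilon> Y \<oplus>\<^bsub>R\<^esub> ?\<epsilon> X \<otimes>\<^bsub>R\<^esub> ?D Y"
    if X: "X \<in> carrier (tensor_mod K A R)" and Y: "Y \<in> carrier (tensor_mod K A R)" for X Y
    using X
  proof (induction rule: tensor_induct[OF A.module R.module, consumes 1, case_names tens add])
    case (tens a r)
    from Y tens show ?case
    proof (induction rule: tensor_induct[OF A.module R.module, consumes 1, case_names tens add])
      case (tens b s)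
      then show ?case
        by (simp add: tensor_mult_tens[OF A R] ft der cl R.smult_l_distr R.smult_assoc1
            R.smult_assoc2 R.smult_mult_right R.smult_left_commute)
    next
      case (add Y Y')
      then show ?case
        by (simp add: tensor_mult_add_right[OF A R] tensor_mult_closed[OF A R]
            tens_closed[OF A.module R.module] fa fc R.r_distr R.a_ac)
    qed
  next
    case (add X X')
    then show ?case
      using Y by (simp add: tensor_mult_add_left[OF A R] tensor_mult_closed[OF A R]
          fa fc R.l_distr R.a_ac)
  qed
  then show ?thesis
    using hom(2) by (simp add: tangent_base_change_def der_module_carrier)
qed

lemma tangent_base_change_module:
  assumes "\<epsilon> \<in> lin_hom K A (ground K)"
  shows "module R (tangent_base_change K A \<epsilon> R)"
  unfolding tangent_base_change_def
  using lin_hom_closed[OF functional_base_change_hom[OF assms]] tensor_mult_closed[OF A R]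
  by (intro der_module_module AR.module_axioms) simp_all

lemma tangent_base_change_lin:
  "T \<in> carrier (tangent_base_change K A \<epsilon> R) \<Longrightarrow> T \<in> lin_hom R (base_change K A R) (ground R)"
  by (simp add: tangent_base_change_def der_module_carrier)

lemma tangent_base_change_apply:
  assumes "X \<in> carrier (tensor_mod K A R)"
  shows "(S \<oplus>\<^bsub>tangent_base_change K A \<epsilon> R\<^esub> T) X = S X \<oplus>\<^bsub>R\<^esub> T X"
    and "(r \<odot>\<^bsub>tangent_base_change K A \<epsilon> R\<^esub> T) X = r \<otimes>\<^bsub>R\<^esub> T X"
  using assms by (simp_all add: tangent_base_change_def)

text \<open>
  This linearity is what makes the universal property of \<open>q \<otimes> R\<close> applicable in the definition of
  \<open>tangent_iso\<close>.  An \<open>R\<close>-linear functional on \<open>A \<otimes> R\<close> is determined by its values at the \<open>a \<otimes> 1\<close>, where the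
  claim is immediate.
\<close>

lemma functional_base_change_linear:
  assumes \<epsilon>: "\<epsilon> \<in> alg_hom K A (ground K)"
  shows "restrict (functional_base_change K A R) (carrier (der_module K A \<epsilon>)) \<in>
    lin_hom K (der_module K A \<epsilon>) (restrict_scalars K R (tangent_base_change K A \<epsilon> R))"
proof -
  let ?q = "der_module K A \<epsilon>" and ?T = "tangent_base_change K A \<epsilon> R"
  have \<epsilon>_lin: "\<epsilon> \<in> lin_hom K A (ground K)" using \<epsilon> by (simp add: alg_hom_def)
  interpret q: module K ?q
    using lin_hom_closed[OF \<epsilon>_lin] by (intro der_module_module A.module) simp_all
  interpret T: module R ?T by (rule tangent_base_change_module[OF \<epsilon>_lin])
  have lin: "D \<in> lin_hom K A (ground K)" if "D \<in> carrier ?q" for D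
    using that by (simp add: der_module_carrier)
  have cl: "D a \<in> carrier K" if "D \<in> carrier ?q" "a \<in> carrier A" for D a
    using lin_hom_closed[OF lin[OF that(1)] that(2)] by simp
  note der = functional_base_change_derivation[OF \<epsilon>]
  note ft = functional_base_change_tens[OF lin]
  have eq: "S = T"
    if "S \<in> carrier ?T" "T \<in> carrier ?T"
      "\<And>a. a \<in> carrier A \<Longrightarrow> S (tens K A R a \<one>\<^bsub>R\<^esub>) = T (tens K A R a \<one>\<^bsub>R\<^esub>)" for S T
    using that
    by (intro base_hom_eqI[OF A.module R ground_module[OF R.M_cring]] tangent_base_change_lin)
  show ?thesis
  proof (rule restrict_lin_homI[OF q.module_axioms])
    fix D assume D: "D \<in> carrier ?q"
    then show "functional_base_change K A R D \<in> carrier (restrict_scalars K R ?T)"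
      by (simp add: der)
    fix E assume E: "E \<in> carrier ?q"
    have "functional_base_change K A R (D \<oplus>\<^bsub>?q\<^esub> E) =
        functional_base_change K A R D \<oplus>\<^bsub>?T\<^esub> functional_base_change K A R E"
    proof (rule eq)
      fix a assume a: "a \<in> carrier A"
      then show "functional_base_change K A R (D \<oplus>\<^bsub>?q\<^esub> E) (tens K A R a \<one>\<^bsub>R\<^esub>) =
        (functional_base_change K A R D \<oplus>\<^bsub>?T\<^esub> functional_base_change K A R E) (tens K A R a \<one>\<^bsub>R\<^esub>)"
        using D E ft[OF q.a_closed[OF D E] a R.one_closed]
        by (simp add: tangent_base_change_apply tens_closed[OF A.module R.module] ft cl R.smult_l_distr)
    qed (use D E q.a_closed[OF D E] der in simp_all)
    then show "functional_base_change K A R (D \<oplus>\<^bsub>?q\<^esub> E) =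
        functional_base_change K A R D \<oplus>\<^bsub>restrict_scalars K R ?T\<^esub> functional_base_change K A R E"
      by simp
  next
    fix c D assume c: "c \<in> carrier K" and D: "D \<in> carrier ?q"
    have "functional_base_change K A R (c \<odot>\<^bsub>?q\<^esub> D) =
        (c \<odot>\<^bsub>R\<^esub> \<one>\<^bsub>R\<^esub>) \<odot>\<^bsub>?T\<^esub> functional_base_change K A R D"
    proof (rule eq)
      fix a assume a: "a \<in> carrier A"
      then show "functional_base_change K A R (c \<odot>\<^bsub>?q\<^esub> D) (tens K A R a \<one>\<^bsub>R\<^esub>) =
        ((c \<odot>\<^bsub>R\<^esub> \<one>\<^bsub>R\<^esub>) \<odot>\<^bsub>?T\<^esub> functional_base_change K A R D) (tens K A R a \<one>\<^bsub>R\<^esub>)"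
        using c D ft[OF q.smult_closed[OF c D] a R.one_closed]
        by (simp add: tangent_base_change_apply tens_closed[OF A.module R.module] ft cl
            R.smult_assoc1 R.smult_assoc2)
    qed (use c D q.smult_closed[OF c D] der in simp_all)
    then show "functional_base_change K A R (c \<odot>\<^bsub>?q\<^esub> D) =
        c \<odot>\<^bsub>restrict_scalars K R ?T\<^esub> functional_base_change K A R D"
      by simp
  qed
qed

lemma
  assumes \<epsilon>: "\<epsilon> \<in> alg_hom K A (ground K)"
  shows tangent_iso_hom: "tangent_iso K A \<epsilon> R \<in>
      lin_hom R (base_change K (der_module K A \<epsilon>) R) (tangent_base_change K A \<epsilon> R)"
    and tangent_iso_tens: "\<lbrakk>D \<in> carrier (der_module K A \<epsilon>); r \<in> carrier R;
        X \<in> carrier (tensor_mod K A R)\<rbrakk> \<Longrightarrow>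
      tangent_iso K A \<epsilon> R (tens K (der_module K A \<epsilon>) R D r) X =
        r \<otimes>\<^bsub>R\<^esub> functional_base_change K A R D X"
proof -
  have \<epsilon>_lin: "\<epsilon> \<in> lin_hom K A (ground K)" using \<epsilon> by (simp add: alg_hom_def)
  have q: "module K (der_module K A \<epsilon>)"
    using lin_hom_closed[OF \<epsilon>_lin] by (intro der_module_module A.module) simp_all
  note facts = q R tangent_base_change_module[OF \<epsilon>_lin] functional_base_change_linear[OF \<epsilon>]
  show "tangent_iso K A \<epsilon> R \<in>
      lin_hom R (base_change K (der_module K A \<epsilon>) R) (tangent_base_change K A \<epsilon> R)"
    unfolding tangent_iso_def by (rule base_lift_hom[OF facts])
  show "tangent_iso K A \<epsilon> R (tens K (der_module K A \<epsilon>) R D r) X =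
      r \<otimes>\<^bsub>R\<^esub> functional_base_change K A R D X"
    if "D \<in> carrier (der_module K A \<epsilon>)" "r \<in> carrier R" "X \<in> carrier (tensor_mod K A R)"
    using that by (simp add: tangent_iso_def base_lift_tens[OF facts] tangent_base_change_apply)
qed

text \<open>
  The condition on \<open>a \<otimes> 1 \<mapsto> \<phi>(a)\<close> under which \<open>base_lift\<close> turns it into an \<open>R\<close>-linear endomorphism of
  \<open>A \<otimes> R\<close>, for the maps \<open>\<phi>\<close> that define the comorphisms of \<open>L\<^sub>x\<close> and of its inverse.
\<close>

lemma point_op_linear:
  assumes \<beta>: "bilinear_map K A A (tensor_alg K A R) (\<lambda>a b. x a \<otimes>\<^bsub>tensor_alg K A R\<^esub> y b)"
    and \<nu>: "\<nu> \<in> lin_hom K A (tensor_mod K A A)"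
  shows "restrict (point_op K A \<nu> (tensor_alg K A R) x y) (carrier A) \<in>
    lin_hom K A (restrict_scalars K R (base_change K A R))"
proof -
  have "point_op K A \<nu> (tensor_alg K A R) x y \<in> lin_hom K A (tensor_alg K A R)"
    unfolding point_op_def
    by (rule lin_hom_compose[OF A.module \<nu> tensor_lift_hom[OF A.module A.module
        tensor_alg_module[OF A.module R.module] \<beta>]])
  note p = lin_hom_closed[OF this, simplified] lin_hom_add[OF this, simplified]
    lin_hom_smult[OF this, simplified]
  show ?thesis
    by (rule restrict_lin_homI[OF A.module])
      (simp_all add: p base_change_scalars[OF A.module R])
qed

text \<open>
  The product of \<open>1 \<otimes> x(a)\<close> and \<open>b \<otimes> 1\<close>, in either order: the pure tensors to which the comorphisms of
  \<open>L\<^sub>x\<close> and of its inverse reduce.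
\<close>

lemma extended_universal_mult:
  assumes "x \<in> lin_hom K A R" "a \<in> carrier A" "b \<in> carrier A"
  shows "extended_point K A R x a \<otimes>\<^bsub>tensor_alg K A R\<^esub> universal_point K A R b = tens K A R b (x a)"
    and "universal_point K A R b \<otimes>\<^bsub>tensor_alg K A R\<^esub> extended_point K A R x a = tens K A R b (x a)"
  using assms lin_hom_closed[OF assms(1,2)]
  by (simp_all add: extended_point_def universal_point_def
      tensor_mult_tens[OF A R])

lemma extended_universal_bilinear:
  assumes x: "x \<in> lin_hom K A R"
  shows "bilinear_map K A A (tensor_alg K A R)
      (\<lambda>a b. extended_point K A R x a \<otimes>\<^bsub>tensor_alg K A R\<^esub> universal_point K A R b)"
    and "bilinear_map K A A (tensor_alg K A R)
      (\<lambda>a b. universal_point K A R a \<otimes>\<^bsub>tensor_alg K A R\<^esub> extended_point K A R x b)"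
  unfolding bilinear_map_def
  by (simp_all add: extended_universal_mult[OF x] lin_hom_closed[OF x] lin_hom_add[OF x] lin_hom_smult[OF x]
      tens_closed[OF A.module R.module] tens_add_left[OF A.module R.module]
      tens_add_right[OF A.module R.module] tens_smult_left[OF A.module R.module]
      tens_smult_right[OF A.module R.module])

end


section \<open>Modules over the dual numbers\<close>

context
  fixes K :: "('k, 'x) ring_scheme" and V :: "('k, 'v) module"
  assumes V: "module K V"
begin

interpretation V: module K V by (rule V)
interpretation dn: dual_number_algebra K "dual_numbers K" Pair
  by (rule dual_numbers_algebra[OF V.is_cring])
interpretation R: algebra K "dual_numbers K" by (rule dn.algebra_dual_numbers)
interpretation T: module K "tensor_mod K V (dual_numbers K)" by (rule tensor_module[OF V R.module])
interpretation B: module "dual_numbers K" "base_change K V (dual_numbers K)"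
  by (rule base_change_module[OF V dn.algebra_dual_numbers])

text \<open>
  The dual numbers are free with basis \<open>1\<close>, \<open>\<delta>\<close>, so \<open>v \<otimes> (a + \<delta>b) = av \<otimes> 1 + bv \<otimes> \<delta>\<close>.
\<close>

lemma dual_number_tensor_cases:
  assumes "u \<in> carrier (tensor_mod K V (dual_numbers K))"
  obtains v w where "v \<in> carrier V" "w \<in> carrier V"
    "u = tens K V (dual_numbers K) v \<one>\<^bsub>dual_numbers K\<^esub> \<oplus>\<^bsub>tensor_mod K V (dual_numbers K)\<^esub>
      tens K V (dual_numbers K) w (\<zero>\<^bsub>K\<^esub>, \<one>\<^bsub>K\<^esub>)"
proof -
  note ts = tens_add_left[OF V R.module] tens_add_right[OF V R.module]
    tens_smult_left[OF V R.module] tens_smult_right[OF V R.module] tens_closed[OF V R.module]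
  have "\<exists>v\<in>carrier V. \<exists>w\<in>carrier V.
      u = tens K V (dual_numbers K) v \<one>\<^bsub>dual_numbers K\<^esub> \<oplus>\<^bsub>tensor_mod K V (dual_numbers K)\<^esub>
        tens K V (dual_numbers K) w (\<zero>\<^bsub>K\<^esub>, \<one>\<^bsub>K\<^esub>)"
    using assms
  proof (induction rule: tensor_induct[OF V R.module, consumes 1, case_names tens add])
    case (tens v r)
    then obtain a b where r: "r = (a, b)" "a \<in> carrier K" "b \<in> carrier K"
      by (auto elim: dn.carrier_prE)
    have "r = a \<odot>\<^bsub>dual_numbers K\<^esub> \<one>\<^bsub>dual_numbers K\<^esub> \<oplus>\<^bsub>dual_numbers K\<^esub>
        b \<odot>\<^bsub>dual_numbers K\<^esub> (\<zero>\<^bsub>K\<^esub>, \<one>\<^bsub>K\<^esub>)"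
      using r by (simp add: dn.pr_simps)
    then have "tens K V (dual_numbers K) v r =
        tens K V (dual_numbers K) (a \<odot>\<^bsub>V\<^esub> v) \<one>\<^bsub>dual_numbers K\<^esub> \<oplus>\<^bsub>tensor_mod K V (dual_numbers K)\<^esub>
        tens K V (dual_numbers K) (b \<odot>\<^bsub>V\<^esub> v) (\<zero>\<^bsub>K\<^esub>, \<one>\<^bsub>K\<^esub>)"
      using r tens by (simp only: ts V.smult_closed R.smult_closed R.one_closed dn.pr_closed
          V.R.zero_closed V.R.one_closed simp_thms)
    then show ?case using r tens V.smult_closed by blast
  next
    case (add X Y)
    then obtain v w v' w' where *: "v \<in> carrier V" "w \<in> carrier V" "v' \<in> carrier V" "w' \<in> carrier V"
      and XY: "X = tens K V (dual_numbers K) v \<one>\<^bsub>dual_numbers K\<^esub> \<oplus>\<^bsub>tensor_mod K V (dual_numbers K)\<^esub>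
        tens K V (dual_numbers K) w (\<zero>\<^bsub>K\<^esub>, \<one>\<^bsub>K\<^esub>)"
      "Y = tens K V (dual_numbers K) v' \<one>\<^bsub>dual_numbers K\<^esub> \<oplus>\<^bsub>tensor_mod K V (dual_numbers K)\<^esub>
        tens K V (dual_numbers K) w' (\<zero>\<^bsub>K\<^esub>, \<one>\<^bsub>K\<^esub>)" by blast
    show ?case
      by (intro bexI[of _ "v \<oplus>\<^bsub>V\<^esub> v'"] bexI[of _ "w \<oplus>\<^bsub>V\<^esub> w'"])
        (simp_all add: * XY ts abelian_group_add4[OF T.abelian_group_axioms])
  qed
  then show ?thesis using that by blast
qed

lemma id_plus_delta_linear:
  assumes f: "f \<in> gl K V"
  shows "restrict (\<lambda>v. tens K V (dual_numbers K) v \<one>\<^bsub>dual_numbers K\<^esub> \<oplus>\<^bsub>base_change K V (dual_numbers K)\<^esub>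
      tens K V (dual_numbers K) (f v) (\<zero>\<^bsub>K\<^esub>, \<one>\<^bsub>K\<^esub>)) (carrier V)
    \<in> lin_hom K V (restrict_scalars K (dual_numbers K) (base_change K V (dual_numbers K)))"
  using f unfolding gl_def
  by (intro restrict_lin_homI[OF V])
    (simp_all add: lin_hom_closed[of f K V V] lin_hom_add[of f K V V] lin_hom_smult[of f K V V]
      tens_add_left[OF V R.module] tens_smult_left[OF V R.module] tens_closed[OF V R.module]
      base_change_scalars[OF V dn.algebra_dual_numbers] T.smult_r_distr
      abelian_group_add4[OF T.abelian_group_axioms])

lemma
  assumes f: "f \<in> gl K V"
  shows id_plus_delta_hom: "id_plus_delta K V f \<in>
      lin_hom (dual_numbers K) (base_change K V (dual_numbers K)) (base_change K V (dual_numbers K))"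
    and id_plus_delta_one: "v \<in> carrier V \<Longrightarrow>
      id_plus_delta K V f (tens K V (dual_numbers K) v \<one>\<^bsub>dual_numbers K\<^esub>) =
        tens K V (dual_numbers K) v \<one>\<^bsub>dual_numbers K\<^esub> \<oplus>\<^bsub>tensor_mod K V (dual_numbers K)\<^esub>
        tens K V (dual_numbers K) (f v) (\<zero>\<^bsub>K\<^esub>, \<one>\<^bsub>K\<^esub>)"
  unfolding id_plus_delta_def Let_def
  using base_lift_hom[OF V dn.algebra_dual_numbers B.module_axioms id_plus_delta_linear[OF f]]
    base_lift_one[OF V dn.algebra_dual_numbers B.module_axioms id_plus_delta_linear[OF f]]
  by simp_all

text \<open>
  The map \<open>v \<otimes> (a + \<delta>b) \<mapsto> bv\<close> extracts the coefficient of \<open>\<delta>\<close>.  Applied to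
  \<open>(id + \<delta>f)(v \<otimes> 1) = v \<otimes> 1 + f(v) \<otimes> \<delta>\<close> it returns \<open>f(v)\<close>.
\<close>

lemma id_plus_delta_inj:
  assumes f: "f \<in> gl K V" and g: "g \<in> gl K V" and eq: "id_plus_delta K V f = id_plus_delta K V g"
  shows "f = g"
proof
  have "bilinear_map K V (dual_numbers K) V (\<lambda>v r. snd r \<odot>\<^bsub>V\<^esub> v)"
    unfolding bilinear_map_def
    by (intro conjI ballI; elim dn.carrier_prE)
      (simp_all add: dn.pr_simps V.smult_l_distr V.smult_r_distr V.smult_assoc1[symmetric] V.R.m_comm)
  then obtain h where h: "h \<in> lin_hom K (tensor_mod K V (dual_numbers K)) V"
    and h_tens: "\<And>v r. \<lbrakk>v \<in> carrier V; r \<in> carrier (dual_numbers K)\<rbrakk> \<Longrightarrow>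
      h (tens K V (dual_numbers K) v r) = snd r \<odot>\<^bsub>V\<^esub> v"
    using tensor_lift_exists[OF V R.module V] by blast
  have delta: "h (id_plus_delta K V k (tens K V (dual_numbers K) v \<one>\<^bsub>dual_numbers K\<^esub>)) = k v"
    if k: "k \<in> gl K V" and v: "v \<in> carrier V" for k v
  proof -
    have kv: "k v \<in> carrier V" using lin_hom_closed[of k K V V v] k v by (simp add: gl_def)
    have "h (id_plus_delta K V k (tens K V (dual_numbers K) v \<one>\<^bsub>dual_numbers K\<^esub>)) =
        snd \<one>\<^bsub>dual_numbers K\<^esub> \<odot>\<^bsub>V\<^esub> v \<oplus>\<^bsub>V\<^esub> \<one>\<^bsub>K\<^esub> \<odot>\<^bsub>V\<^esub> k v"
      using v kv
      by (simp add: id_plus_delta_one[OF k] lin_hom_add[OF h] tens_closed[OF V R.module] h_tens)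
    also have "\<dots> = k v" using v kv by (simp add: dn.one_pr)
    finally show ?thesis .
  qed
  fix v
  show "f v = g v"
  proof (cases "v \<in> carrier V")
    case True
    then show ?thesis using delta[OF f] delta[OF g] eq by metis
  next
    case False
    then show ?thesis using lin_hom_undefined[of f K V V v] lin_hom_undefined[of g K V V v] f g by (simp add: gl_def)
  qed
qed

end


section \<open>The adjoint representations on dual numbers\<close>

context affine_algebraic_rack
begin

abbreviation "R \<equiv> dual_numbers K"

sublocale dn: dual_number_algebra K R Pair
  by (rule dual_numbers_algebra[OF A.R_cring])

sublocale R: algebra K R by (rule dn.algebra_dual_numbers)

lemma functional_dual_numbers:
  assumes "E \<in> carrier q" "a \<in> carrier A" "r \<in> carrier R"
  shows "functional_base_change K A R E (tens K A R a r) = (E a \<otimes>\<^bsub>K\<^esub> fst r, E a \<otimes>\<^bsub>K\<^esub> snd r)"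
  using assms functional_base_change_tens[OF A.algebra_axioms R.algebra_axioms tangent_lin]
  by (auto elim!: dn.carrier_prE simp: dn.pr_simps)

lemma functional_dual_numbers_hom:
  "E \<in> carrier q \<Longrightarrow> functional_base_change K A R E \<in> lin_hom R (base_change K A R) (ground R)"
  by (rule functional_base_change_hom[OF A.algebra_axioms R.algebra_axioms tangent_lin])

lemma tangent_value: "\<lbrakk>E \<in> carrier q; a \<in> carrier A\<rbrakk> \<Longrightarrow> E a \<in> carrier K"
  using lin_hom_closed[OF tangent_lin] by simp

lemma tangent_iso_value:
  assumes E: "E \<in> carrier q" and F: "F \<in> carrier q" and X: "X \<in> carrier (tensor_mod K A R)"
  shows "tangent_iso K A \<epsilon> R (tens K q R E \<one>\<^bsub>R\<^esub> \<oplus>\<^bsub>tensor_mod K q R\<^esub> tens K q R F (\<zero>\<^bsub>K\<^esub>, \<one>\<^bsub>K\<^esub>)) X =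
    functional_base_change K A R E X \<oplus>\<^bsub>R\<^esub> (\<zero>\<^bsub>K\<^esub>, \<one>\<^bsub>K\<^esub>) \<otimes>\<^bsub>R\<^esub> functional_base_change K A R F X"
proof -
  note iso = tangent_iso_hom[OF A.algebra_axioms R.algebra_axioms counit]
  note iso_tens = tangent_iso_tens[OF A.algebra_axioms R.algebra_axioms counit]
  note tc = tens_closed[OF tangent_space_module R.module]
  have "functional_base_change K A R E X \<in> carrier R"
    using lin_hom_closed[OF functional_dual_numbers_hom[OF E]] X by simp
  then show ?thesis
    using E F X lin_hom_add[OF iso]
    by (simp add: tc tangent_base_change_apply[OF A.algebra_axioms R.algebra_axioms] iso_tens)
qed

lemma tangent_iso_unit_value:
  assumes E: "E \<in> carrier q" and F: "F \<in> carrier q" and a: "a \<in> carrier A"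
  shows "tangent_iso K A \<epsilon> R (tens K q R E \<one>\<^bsub>R\<^esub> \<oplus>\<^bsub>tensor_mod K q R\<^esub> tens K q R F (\<zero>\<^bsub>K\<^esub>, \<one>\<^bsub>K\<^esub>))
    (tens K A R a \<one>\<^bsub>R\<^esub>) = (E a, F a)"
  using a tangent_value[OF E a] tangent_value[OF F a]
  by (simp add: tangent_iso_value[OF E F] tens_closed[OF A.module R.module]
      functional_dual_numbers[OF E] functional_dual_numbers[OF F])
    (simp add: dn.pr_simps)

text \<open>
  The components \<open>E\<close> and \<open>F\<close> of \<open>E \<otimes> 1 + F \<otimes> \<delta>\<close> are recovered from the values \<open>E(a) + \<delta>F(a)\<close> at \<open>a \<otimes> 1\<close>.
\<close>

lemma tangent_iso_inj: "inj_on (tangent_iso K A \<epsilon> R) (carrier (base_change K q R))"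
proof (rule inj_onI)
  fix u u' assume u: "u \<in> carrier (base_change K q R)" and u': "u' \<in> carrier (base_change K q R)"
    and eq: "tangent_iso K A \<epsilon> R u = tangent_iso K A \<epsilon> R u'"
  from u have "u \<in> carrier (tensor_mod K q R)" by simp
  then obtain E F where E: "E \<in> carrier q" and F: "F \<in> carrier q"
    and u_eq: "u = tens K q R E \<one>\<^bsub>R\<^esub> \<oplus>\<^bsub>tensor_mod K q R\<^esub> tens K q R F (\<zero>\<^bsub>K\<^esub>, \<one>\<^bsub>K\<^esub>)"
    by (rule dual_number_tensor_cases[OF tangent_space_module])
  from u' have "u' \<in> carrier (tensor_mod K q R)" by simp
  then obtain E' F' where E': "E' \<in> carrier q" and F': "F' \<in> carrier q"
    and u'_eq: "u' = tens K q R E' \<one>\<^bsub>R\<^esub> \<oplus>\<^bsub>tensor_mod K q R\<^esub> tens K q R F' (\<zero>\<^bsub>K\<^esub>, \<one>\<^bsub>K\<^esub>)"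
    by (rule dual_number_tensor_cases[OF tangent_space_module])
  have ag: "E a = E' a \<and> F a = F' a" if a: "a \<in> carrier A" for a
    using tangent_iso_unit_value[OF E F a] tangent_iso_unit_value[OF E' F' a] eq u_eq u'_eq by simp
  have ext: "D = D'" if "D \<in> carrier q" "D' \<in> carrier q" "\<And>a. a \<in> carrier A \<Longrightarrow> D a = D' a" for D D'
    using lin_hom_undefined[OF tangent_lin[OF that(1)]] lin_hom_undefined[OF tangent_lin[OF that(2)]]
      that(3) by (metis ext)
  have "E = E'" "F = F'" using ag ext[OF E E'] ext[OF F F'] by blast+
  then show "u = u'" using u_eq u'_eq by simp
qed

text \<open>
  With \<open>L\<close> the comorphism given by \<open>\<phi>\<close> and \<open>g = id + \<delta>f\<close>, the claim is \<open>iso(u) \<circ> L = iso(g(u))\<close>, after which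
  injectivity of \<open>iso\<close> evaluates its inverse.  Both sides are \<open>R\<close>-linear functionals on \<open>A \<otimes> R\<close>, so they are
  compared at \<open>a \<otimes> 1\<close>; the resulting expressions are \<open>R\<close>-linear in \<open>u\<close>, so they are compared at
  \<open>u = E \<otimes> 1\<close>, where both equal \<open>E(a) + \<delta> f(E)(a)\<close>.
\<close>

lemma tangent_map_id_plus_delta:
  assumes \<phi>: "restrict \<phi> (carrier A) \<in> lin_hom K A (restrict_scalars K R (base_change K A R))"
    and f: "f \<in> gl K q"
    and eval: "\<And>E a. \<lbrakk>E \<in> carrier q; a \<in> carrier A\<rbrakk> \<Longrightarrow>
      functional_base_change K A R E (\<phi> a) = (E a, f E a)"
  shows "tangent_map K A \<epsilon> R (base_lift K A R (base_change K A R) \<phi>) = id_plus_delta K q f"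
proof -
  let ?iso = "tangent_iso K A \<epsilon> R" and ?g = "id_plus_delta K q f"
    and ?L = "base_lift K A R (base_change K A R) \<phi>"
    and ?B = "base_change K q R" and ?C = "base_change K A R"
  interpret C: module R ?C by (rule base_change_module[OF A.module R.algebra_axioms])
  interpret B: module R ?B by (rule base_change_module[OF tangent_space_module R.algebra_axioms])
  note G = ground_module[OF R.M_cring]
  note iso = tangent_iso_hom[OF A.algebra_axioms R.algebra_axioms counit]
  note iso_lin = tangent_base_change_lin[OF A.algebra_axioms R.algebra_axioms lin_hom_closed[OF iso]]
  have iso_closed: "?iso u X \<in> carrier R" if "u \<in> carrier ?B" "X \<in> carrier (tensor_mod K A R)" for u X
    using lin_hom_closed[OF iso_lin[OF that(1)], of X] that(2) by simp
  note g = id_plus_delta_hom[OF tangent_space_module f]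
  have L: "?L \<in> lin_hom R ?C ?C" and L_one: "\<And>a. a \<in> carrier A \<Longrightarrow> ?L (tens K A R a \<one>\<^bsub>R\<^esub>) = \<phi> a"
    by (rule base_lift_hom[OF A.module R.algebra_axioms C.module_axioms \<phi>]
        base_lift_one[OF A.module R.algebra_axioms C.module_axioms \<phi>]; assumption)+
  have \<phi>_closed: "\<phi> a \<in> carrier (tensor_mod K A R)" if "a \<in> carrier A" for a
    using lin_hom_closed[OF \<phi> that] that by simp
  have one: "tens K A R a \<one>\<^bsub>R\<^esub> \<in> carrier (tensor_mod K A R)" if "a \<in> carrier A" for a
    using that by (simp add: tens_closed[OF A.module R.module])
  note app = tangent_base_change_apply[OF A.algebra_axioms R.algebra_axioms]
  have agree: "?iso u (\<phi> a) = ?iso (?g u) (tens K A R a \<one>\<^bsub>R\<^esub>)"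
    if a: "a \<in> carrier A" and u: "u \<in> carrier ?B" for a u
  proof -
    have "restrict (\<lambda>u. ?iso u (\<phi> a)) (carrier ?B) = restrict (\<lambda>u. ?iso (?g u) (tens K A R a \<one>\<^bsub>R\<^esub>)) (carrier ?B)"
    proof (rule base_hom_eqI[OF tangent_space_module R.algebra_axioms G])
      show "restrict (\<lambda>u. ?iso u (\<phi> a)) (carrier ?B) \<in> lin_hom R ?B (ground R)"
        using \<phi>_closed[OF a]
        by (intro restrict_lin_homI[OF B.module_axioms])
          (simp_all only: lin_hom_add[OF iso] lin_hom_smult[OF iso] app ground_simps
            iso_closed)
      show "restrict (\<lambda>u. ?iso (?g u) (tens K A R a \<one>\<^bsub>R\<^esub>)) (carrier ?B) \<in> lin_hom R ?B (ground R)"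
        using one[OF a]
        by (intro restrict_lin_homI[OF B.module_axioms])
          (simp_all only: lin_hom_add[OF g] lin_hom_smult[OF g] lin_hom_closed[OF g]
            lin_hom_add[OF iso] lin_hom_smult[OF iso] app ground_simps
            iso_closed)
      fix E assume E: "E \<in> carrier q"
      have fE: "f E \<in> carrier q" using f E lin_hom_closed[of f K q q E] by (simp add: gl_def)
      have EB: "tens K q R E \<one>\<^bsub>R\<^esub> \<in> carrier ?B"
        using E by (simp add: tens_closed[OF tangent_space_module R.module])
      have "?iso (tens K q R E \<one>\<^bsub>R\<^esub>) (\<phi> a) = \<one>\<^bsub>R\<^esub> \<otimes>\<^bsub>R\<^esub> (E a, f E a)"
        using tangent_iso_tens[OF A.algebra_axioms R.algebra_axioms counit E R.one_closed \<phi>_closed[OF a]]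
          eval[OF E a] by simp
      also have "\<dots> = (E a, f E a)"
        using tangent_value[OF E a] tangent_value[OF fE a] by (simp add: dn.pr_simps)
      also have "\<dots> = ?iso (?g (tens K q R E \<one>\<^bsub>R\<^esub>)) (tens K A R a \<one>\<^bsub>R\<^esub>)"
        by (simp only: id_plus_delta_one[OF tangent_space_module f E] tangent_iso_unit_value[OF E fE a])
      finally show "restrict (\<lambda>u. ?iso u (\<phi> a)) (carrier ?B) (tens K q R E \<one>\<^bsub>R\<^esub>) =
          restrict (\<lambda>u. ?iso (?g u) (tens K A R a \<one>\<^bsub>R\<^esub>)) (carrier ?B) (tens K q R E \<one>\<^bsub>R\<^esub>)"
        using EB by (simp only: restrict_apply' )
    qed
    from fun_cong[OF this, of u] show ?thesis using u by (simp only: restrict_apply')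
  qed
  have comp: "compose (carrier ?C) (?iso u) ?L = ?iso (?g u)" if u: "u \<in> carrier ?B" for u
  proof (rule base_hom_eqI[OF A.module R.algebra_axioms G])
    show "compose (carrier ?C) (?iso u) ?L \<in> lin_hom R ?C (ground R)"
      by (rule lin_hom_compose[OF C.module_axioms L iso_lin[OF u]])
    show "?iso (?g u) \<in> lin_hom R ?C (ground R)"
      by (rule iso_lin[OF lin_hom_closed[OF g u]])
    fix a assume a: "a \<in> carrier A"
    then show "compose (carrier ?C) (?iso u) ?L (tens K A R a \<one>\<^bsub>R\<^esub>) = ?iso (?g u) (tens K A R a \<one>\<^bsub>R\<^esub>)"
      using one[OF a] agree[OF a u] by (simp add: compose_def L_one)
  qed
  show ?thesis
  proof
    fix u
    show "tangent_map K A \<epsilon> R ?L u = ?g u"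
    proof (cases "u \<in> carrier ?B")
      case True
      then show ?thesis
        unfolding tangent_map_def
        by (simp only: restrict_apply' comp inv_into_f_f[OF tangent_iso_inj lin_hom_closed[OF g True]])
    next
      case False
      then show ?thesis
        unfolding tangent_map_def using lin_hom_undefined[OF g False] by (simp only: restrict_apply if_False)
    qed
  qed
qed

lemma differential_GL_eq:
  assumes "f \<in> gl K q" "\<Phi> (tangent_point A \<epsilon> D) = id_plus_delta K q f"
  shows "differential_GL K A \<epsilon> q \<Phi> D = f"
  unfolding differential_GL_def
  by (rule the_equality) (use assms id_plus_delta_inj[OF tangent_space_module] in auto)

lemma tangent_point_lin:
  assumes "D \<in> carrier q"
  shows "tangent_point A \<epsilon> D \<in> lin_hom K A R"
  using dn.deformed_point_hom[OF A.algebra_axioms counit assms]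
  by (simp add: alg_hom_def tangent_point_def dn.deformed_point_def)

text \<open>
  For \<open>\<nu>(a) = \<Sum> a' \<otimes> a''\<close> the two points are \<open>\<Sum> a'' \<otimes> x(a')\<close> and \<open>\<Sum> a' \<otimes> x(a'')\<close>, with
  \<open>x = \<epsilon> + \<delta>D\<close>.  The extension of \<open>E\<close> applies \<open>E\<close> to the left factor and keeps the right one.
\<close>

lemma functional_point_op:
  assumes D: "D \<in> carrier q" and E: "E \<in> carrier q" and a: "a \<in> carrier A"
    and \<nu>: "\<nu> \<in> lin_hom K A (tensor_mod K A A)"
  shows "functional_base_change K A R E (point_op K A \<nu> (tensor_alg K A R)
      (extended_point K A R (tangent_point A \<epsilon> D)) (universal_point K A R) a) =
      (convolution K A \<nu> \<epsilon> E a, convolution K A \<nu> D E a)"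
    and "functional_base_change K A R E (point_op K A \<nu> (tensor_alg K A R)
      (universal_point K A R) (extended_point K A R (tangent_point A \<epsilon> D)) a) =
      (convolution K A \<nu> E \<epsilon> a, convolution K A \<nu> E D a)"
proof -
  let ?x = "tangent_point A \<epsilon> D" and ?E = "functional_base_change K A R E"
  note x = tangent_point_lin[OF D]
  note AA = A.module A.module and AR = tensor_alg_module[OF A.module R.module]
  note lin = counit_lin tangent_lin[OF D] tangent_lin[OF E]
  have cl: "\<epsilon> a \<in> carrier K" "D a \<in> carrier K" "E a \<in> carrier K" if "a \<in> carrier A" for a
    using that lin_hom_closed[OF counit_lin] tangent_value[OF D] tangent_value[OF E] by simp_all
  have xa: "?x a = (\<epsilon> a, D a)" if "a \<in> carrier A" for a
    using that by (simp add: tangent_point_def)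
  have fa: "?E (X \<oplus>\<^bsub>tensor_mod K A R\<^esub> Y) = ?E X \<oplus>\<^bsub>R\<^esub> ?E Y"
    if "X \<in> carrier (tensor_mod K A R)" "Y \<in> carrier (tensor_mod K A R)" for X Y
    using that lin_hom_add[OF functional_dual_numbers_hom[OF E]] by simp
  note \<nu>a = lin_hom_closed[OF \<nu> a]
  {
    let ?h = "tensor_lift K A A (tensor_alg K A R)
      (\<lambda>a b. extended_point K A R ?x a \<otimes>\<^bsub>tensor_alg K A R\<^esub> universal_point K A R b)"
    note h = tensor_lift_hom[OF AA AR extended_universal_bilinear(1)[OF A.algebra_axioms R.algebra_axioms x]]
    note h_simps = lin_hom_closed[OF h, simplified] lin_hom_add[OF h, simplified]
      tensor_lift_tens[OF AA AR extended_universal_bilinear(1)[OF A.algebra_axioms R.algebra_axioms x]]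
    have "?E (?h X) = (pairing K A \<epsilon> E X, pairing K A D E X)"
      if "X \<in> carrier (tensor_mod K A A)" for X
      using that
    proof (induction rule: tensor_induct[OF AA, consumes 1, case_names tens add])
      case (tens a b)
      then show ?case
        by (simp add: h_simps extended_universal_mult[OF A.algebra_axioms R.algebra_axioms x] xa functional_dual_numbers[OF E] cl
            pairing_tens[OF A.module] lin A.R.m_comm)
    next
      case (add X Y)
      then show ?case
        by (simp add: h_simps fa pairing_add[OF A.module] lin dn.pr_simps)
    qed
    from this[OF \<nu>a] show "functional_base_change K A R E (point_op K A \<nu> (tensor_alg K A R)
        (extended_point K A R ?x) (universal_point K A R) a) =
        (convolution K A \<nu> \<epsilon> E a, convolution K A \<nu> D E a)"
      using a by (simp add: point_op_def convolution_pairing compose_def)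
  }
  {
    let ?h = "tensor_lift K A A (tensor_alg K A R)
      (\<lambda>a b. universal_point K A R a \<otimes>\<^bsub>tensor_alg K A R\<^esub> extended_point K A R ?x b)"
    note h = tensor_lift_hom[OF AA AR extended_universal_bilinear(2)[OF A.algebra_axioms R.algebra_axioms x]]
    note h_simps = lin_hom_closed[OF h, simplified] lin_hom_add[OF h, simplified]
      tensor_lift_tens[OF AA AR extended_universal_bilinear(2)[OF A.algebra_axioms R.algebra_axioms x]]
    have "?E (?h X) = (pairing K A E \<epsilon> X, pairing K A E D X)"
      if "X \<in> carrier (tensor_mod K A A)" for X
      using that
    proof (induction rule: tensor_induct[OF AA, consumes 1, case_names tens add])
      case (tens a b)
      then show ?case
        by (simp add: h_simps extended_universal_mult[OF A.algebra_axioms R.algebra_axioms x] xa functional_dual_numbers[OF E] cl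
            pairing_tens[OF A.module] lin)
    next
      case (add X Y)
      then show ?case
        by (simp add: h_simps fa pairing_add[OF A.module] lin dn.pr_simps)
    qed
    from this[OF \<nu>a] show "functional_base_change K A R E (point_op K A \<nu> (tensor_alg K A R)
        (universal_point K A R) (extended_point K A R ?x) a) =
        (convolution K A \<nu> E \<epsilon> a, convolution K A \<nu> E D a)"
      using a by (simp add: point_op_def convolution_pairing compose_def)
  }
qed

lemma bracket_gl:
  assumes D: "D \<in> carrier q"
  shows "restrict (\<lambda>E. convolution K A nabla D E) (carrier q) \<in> gl K q"
    and "restrict (\<lambda>E. convolution K A nabla_inv E D) (carrier q) \<in> gl K q"
  unfolding gl_def
  using D
  by (intro restrict_lin_homI[OF tangent_space_module];
      simp add: bracket_closed convolution_add[OF A.module] convolution_smult[OF A.module]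
        comorphism_lin tangent_lin)+

text \<open>
  The constant coefficient in \<open>functional_point_op\<close> is \<open>(\<epsilon> \<otimes> E) \<circ> \<nabla> = E\<close>, so \<open>Ad\<close> has the form \<open>id + \<delta>f\<close>
  with \<open>f\<close> the coefficient of \<open>\<delta>\<close>.
\<close>

lemma ad_eq:
  assumes D: "D \<in> carrier q"
  shows "ad K A nabla \<epsilon> D = restrict (\<lambda>E. convolution K A nabla D E) (carrier q)"
  unfolding ad_def
proof (rule differential_GL_eq[OF bracket_gl(1)[OF D]])
  show "Ad K A nabla \<epsilon> R (tangent_point A \<epsilon> D) =
      id_plus_delta K q (restrict (\<lambda>E. convolution K A nabla D E) (carrier q))"
    unfolding Ad_def L_comorphism_def
    by (rule tangent_map_id_plus_delta[OF point_op_linear[OF A.algebra_axioms R.algebra_axioms,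
          OF extended_universal_bilinear(1)[OF A.algebra_axioms R.algebra_axioms tangent_point_lin[OF D]]
            comorphism_lin(1)] bracket_gl(1)[OF D]])
      (simp add: functional_point_op(1)[OF D _ _ comorphism_lin(1)] convolution_counit)
qed

text \<open>
  Here \<open>x\<close> is the second argument, and the constant coefficient is \<open>(E \<otimes> \<epsilon>) \<circ> \<nabla>\<inverse> = E\<close>.
\<close>

lemma ad_inv_eq:
  assumes D: "D \<in> carrier q"
  shows "ad_inv K A nabla_inv \<epsilon> D = restrict (\<lambda>E. convolution K A nabla_inv E D) (carrier q)"
  unfolding ad_inv_def
proof (rule differential_GL_eq[OF bracket_gl(2)[OF D]])
  show "Ad_inv K A nabla_inv \<epsilon> R (tangent_point A \<epsilon> D) =
      id_plus_delta K q (restrict (\<lambda>E. convolution K A nabla_inv E D) (carrier q))"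
    unfolding Ad_inv_def L_inv_comorphism_def
    by (rule tangent_map_id_plus_delta[OF point_op_linear[OF A.algebra_axioms R.algebra_axioms,
          OF extended_universal_bilinear(2)[OF A.algebra_axioms R.algebra_axioms tangent_point_lin[OF D]]
            comorphism_lin(2)] bracket_gl(2)[OF D]])
      (simp add: functional_point_op(2)[OF D _ _ comorphism_lin(2)] convolution_counit)
qed

end

theorem proposition8p2:
  fixes K :: "'k ring" and A :: "('k, 'a) module"
    and nabla nabla_inv :: "'a \<Rightarrow> ('a \<times> 'a \<Rightarrow> 'k) set" and \<epsilon> :: "'a \<Rightarrow> 'k"
    and q :: "('a \<Rightarrow> 'k) set"
  assumes "field K"
    and "affine_algebraic_rack K A nabla nabla_inv \<epsilon>"
    and "q = carrier (der_module K A \<epsilon>)"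
  shows "ad K A nabla \<epsilon> \<in> q \<rightarrow> gl K (der_module K A \<epsilon>) \<and>
    ad_inv K A nabla_inv \<epsilon> \<in> q \<rightarrow> gl K (der_module K A \<epsilon>) \<and>
    (\<forall>D\<in>q. \<forall>E\<in>q. ad K A nabla \<epsilon> D E = convolution K A nabla D E) \<and>
    (\<forall>D\<in>q. \<forall>E\<in>q. ad_inv K A nabla_inv \<epsilon> D E = convolution K A nabla_inv E D) \<and>
    (\<forall>D\<in>q. \<forall>E\<in>q. convolution K A nabla D E \<in> q) \<and>
    (\<forall>D\<in>q. \<forall>E\<in>q. convolution K A nabla_inv D E \<in> q)"
proof -
  interpret affine_algebraic_rack K A nabla nabla_inv \<epsilon> by fact
  show ?thesis
    using assms(3) bracket_gl bracket_closed by (auto simp: ad_eq ad_inv_eq)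
qed

end
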